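(* Let $G$ be a finite group and let $\varphi : \Gamma \to \Gamma'$ be a $G$-Galois covering between tropical curves. Let $A'$ be the set of all finite harmonic morphisms $\psi : \Gamma \to \Gamma''$ ($\Gamma''$ a tropical curve) such that $\psi$ is $G(\psi)$-Galois, let $\sim$ be the equivalence relation on $A'$ defined by: $\psi_1 \sim \psi_2$ if there exists a finite harmonic morphism $\psi_{12}$ of degree one satisfying $\psi_1 = \psi_{12} \circ \psi_2$; and let $A := A'/\!\sim$. Let $\le_A$ be the partial order on $A$ defined by: $[\psi_1] \le_A [\psi_2]$ if for any $\psi_1' \in [\psi_1]$ and $\psi_2' \in [\psi_2]$ there exists a finite harmonic morphism $\theta$ satisfying $\psi_1' = \theta \circ \psi_2'$. Let $B$ be the set of all subgroups of $G$, with the partial order $\le_B$ defined by: $G_1 \le_B G_2$ if $G_1 \subset G_2$. Then there exists a one-to-one correspondence between $(A, \le_A)$ and $(B, \le_B)$ reversing the partial orders.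
   Context: Graphs are unweighted, undirected, finite, connected, nonempty multigraphs that may have loops. A leaf end is a vertex of degree one (a loop counts twice), and a leaf edge is an edge incident to a leaf end. A tropical curve $\Gamma$ is the underlying topological space of a pair $(\mathcal{G}, l)$, where $\mathcal{G}$ is a graph and $l : E(\mathcal{G}) \to \mathbf{R}_{>0} \cup \{\infty\}$ is a length function taking the value $\infty$ only on leaf edges, together with an identification of each edge $e$ with the closed interval $[0, l(e)]$; when $l(e) = \infty$, $[0,\infty]$ is the one-point compactification of $[0,\infty)$ and the leaf end of $e$ must be identified with $\infty$ (if $e$ is the only edge, either leaf end may be identified with $\infty$). The distance between $\infty$ and any other point is infinite. Such a pair $(\mathcal{G}, l)$ is called a model for $\Gamma$ (a given $\Gamma$ has many models); it is loopless if $\mathcal{G}$ is loopless. $\Gamma_\infty$ denotes the set of points identified with $\infty$. Vertices and edges are identified with the corresponding points and closed subsets of $\Gamma$. A continuous map $\varphi : \Gamma \to \Gamma'$ between tropical curves is a finite morphism if there exist loopless models $(\mathcal{G}, l)$ and $(\mathcal{G}', l')$ for $\Gamma$ and $\Gamma'$ such that $\varphi(V(\mathcal{G})) \subset V(\mathcal{G}')$, $\varphi(E(\mathcal{G})) \subset E(\mathcal{G}')$, and for any edge $e$ of $\mathcal{G}$ there is a positive integer $\deg_e(\varphi)$ with $\operatorname{dist}(\varphi(x), \varphi(y)) = \deg_e(\varphi) \cdot \operatorname{dist}(x,y)$ for all $x, y \in e$. A finite morphism $\varphi$ is harmonic if for every vertex $v$ of $\mathcal{G}$ the sum $\sum_{e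 \in E(\mathcal{G}):\, e \mapsto e',\, v \in e} \deg_e(\varphi)$ is independent of the choice of $e' \in E(\mathcal{G}')$ incident to $\varphi(v)$; this sum is denoted $\deg_v(\varphi)$. Then $\sum_{v \in V(\mathcal{G}):\, v \mapsto v'} \deg_v(\varphi)$ is independent of the vertex $v'$ of $\mathcal{G}'$ and is called the degree $\deg(\varphi)$. If both $\Gamma$ and $\Gamma'$ are singletons, $\varphi$ is regarded as a finite harmonic morphism that can have any number as its degree. A finite group $G$ acts isometrically on $\Gamma$ if $G$ acts continuously on $\Gamma$ and the action is isometric on $\Gamma \setminus \Gamma_\infty$. For an isometric action of a finite group $G$ on $\Gamma$, a map $\varphi : \Gamma \to \Gamma'$ between tropical curves is $G$-Galois (a $G$-Galois covering) if (1) $\varphi$ is a finite harmonic morphism, (2) the order of $G$ coincides with the degree of $\varphi$, (3) the action of $G$ on $\Gamma$ induces a transitive action on every fiber of $\varphi$, and (4) the stabilizer subgroup of $G$ is trivial at all but finitely many points of $\Gamma$. Given such an action of $G$ on $\Gamma$ and a finite harmonic morphism $\psi : \Gamma \to \Gamma''$, $G(\psi)$ denotes the set of all $g \in G$ satisfying $\psi \circ g = \psi$; it is a subgroup of $G$ and acts on $\Gamma$ by restriction. $[\psi]$ denotes the equivalence class of $\psi$. The order $\le_A$ is well defined.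
   Formalization: If Γ is a single point, G is assumed trivial (otherwise A has one element but B has at least two, so the claim fails); the targets Γ'' range over tropical curves with points in a fixed set into which Γ injects, which represents all of A' up to isomorphism. *)

theory Defs
  imports "HOL-Analysis.Analysis" "HOL-Algebra.Group_Action"
begin

section \<open>Multigraphs\<close>

text \<open>The ends of an edge form a multiset of size two, so that a loop at \<open>v\<close> has the
  ends \<open>{#v, v#}\<close> and counts twice in the degree of \<open>v\<close>.\<close>

record ('v, 'e) multigraph =
  verts :: "'v set"
  edges :: "'e set"
  ends :: "'e \<Rightarrow> 'v multiset"

definition finite_multigraph :: "('v, 'e, 'm) multigraph_scheme \<Rightarrow> bool" where
  "finite_multigraph M \<longleftrightarrow> finite (verts M) \<and> finite (edges M) \<and>
     (\<forall>e\<in>edges M. size (ends M e) = 2 \<and> set_mset (ends M e) \<subseteq> verts M)"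

definition connected_multigraph :: "('v, 'e, 'm) multigraph_scheme \<Rightarrow> bool" where
  "connected_multigraph M \<longleftrightarrow> verts M \<noteq> {} \<and>
     (\<forall>u\<in>verts M. \<forall>v\<in>verts M. (u, v) \<in> {(a, b). \<exists>e\<in>edges M. ends M e = {#a, b#}}\<^sup>*)"

definition vertex_degree :: "('v, 'e, 'm) multigraph_scheme \<Rightarrow> 'v \<Rightarrow> nat" where
  "vertex_degree M v = (\<Sum>e\<in>edges M. count (ends M e) v)"

definition leaf_end :: "('v, 'e, 'm) multigraph_scheme \<Rightarrow> 'v \<Rightarrow> bool" where
  "leaf_end M v \<longleftrightarrow> v \<in> verts M \<and> vertex_degree M v = 1"

definition loopless :: "('v, 'e, 'm) multigraph_scheme \<Rightarrow> bool" where
  "loopless M \<longleftrightarrow> (\<forall>e\<in>edges M. \<forall>v. ends M e \<noteq> {#v, v#})"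


section \<open>Tropical curves and their models\<close>

text \<open>A curve is recorded by the data that do not depend on a model: its topological space,
  whose underlying set is the set of points, and its distance function, which is only
  meaningful on points.\<close>

record 'p curve =
  topo :: "'p topology"
  distance :: "'p \<Rightarrow> 'p \<Rightarrow> ereal"

abbreviation points :: "('p, 'm) curve_scheme \<Rightarrow> 'p set" where
  "points \<Gamma> \<equiv> topspace (topo \<Gamma>)"

text \<open>A model is a graph whose vertices are points and whose edges are sets of points, together
  with the lengths \<open>len e\<close> and the identifications \<open>chart e\<close> of \<open>{0..len e}\<close> with \<open>e\<close>.
  In \<open>ereal\<close>, the subspace \<open>{0..\<infinity>}\<close> is the one-point compactification of \<open>[0, \<infinity>)\<close>.\<close>

record 'p model = "('p, 'p set) multigraph" +
  len :: "'p set \<Rightarrow> ereal"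
  chart :: "'p set \<Rightarrow> ereal \<Rightarrow> 'p"

text \<open>A route is a list of segments \<open>(e, s, t)\<close>, each of which runs inside the edge \<open>e\<close> from
  the parameter \<open>s\<close> to the parameter \<open>t\<close>. In \<open>ereal\<close>, \<open>\<bar>\<infinity> - s\<bar> = \<infinity>\<close> for all \<open>s \<ge> 0\<close>, so a route
  with a segment that starts or ends at infinity has infinite length; the empty route has
  length \<open>0\<close>.\<close>

fun route :: "('p, 'm) model_scheme \<Rightarrow> 'p \<Rightarrow> ('p set \<times> ereal \<times> ereal) list \<Rightarrow> 'p \<Rightarrow> bool" where
  "route M x [] y \<longleftrightarrow> x = y"
| "route M x ((e, s, t) # r) y \<longleftrightarrow>
     e \<in> edges M \<and> s \<in> {0..len M e} \<and> t \<in> {0..len M e} \<and> chart M e s = x \<and>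
     route M (chart M e t) r y"

definition route_length :: "('p set \<times> ereal \<times> ereal) list \<Rightarrow> ereal" where
  "route_length r = (\<Sum>(e, s, t)\<leftarrow>r. \<bar>t - s\<bar>)"

definition path_distance :: "('p, 'm) model_scheme \<Rightarrow> 'p \<Rightarrow> 'p \<Rightarrow> ereal" where
  "path_distance M x y = (INF r\<in>{r. route M x r y}. route_length r)"

text \<open>The pair \<open>(G, l)\<close> with its identifications: edges are glued to each other only along their
  ends, and an edge of length \<open>\<infinity>\<close> is a leaf edge whose leaf end is the point at infinity.\<close>

definition metric_graph :: "('p, 'm) model_scheme \<Rightarrow> bool" where
  "metric_graph M \<longleftrightarrow> finite_multigraph M \<and> connected_multigraph M \<and>
     (\<forall>e\<in>edges M. 0 < len M e \<and>
        chart M e ` {0..len M e} = e \<and>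
        ends M e = {#chart M e 0, chart M e (len M e)#} \<and>
        inj_on (chart M e) {0<..<len M e} \<and>
        chart M e ` {0<..<len M e} \<inter> verts M = {} \<and>
        (len M e = \<infinity> \<longrightarrow> leaf_end M (chart M e \<infinity>))) \<and>
     (\<forall>e\<in>edges M. \<forall>e'\<in>edges M. e \<noteq> e' \<longrightarrow>
        chart M e ` {0<..<len M e} \<inter> chart M e' ` {0<..<len M e'} = {})"

text \<open>The topology is the quotient topology of the disjoint union of the vertices and the
  intervals \<open>{0..len e}\<close>.\<close>

definition model_of :: "('p, 'm) model_scheme \<Rightarrow> ('p, 'n) curve_scheme \<Rightarrow> bool" where
  "model_of M \<Gamma> \<longleftrightarrow> metric_graph M \<and>
     points \<Gamma> = verts M \<union> \<Union>(edges M) \<and>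
     (\<forall>U. openin (topo \<Gamma>) U \<longleftrightarrow> U \<subseteq> points \<Gamma> \<and>
        (\<forall>e\<in>edges M. openin (top_of_set {0..len M e}) {t \<in> {0..len M e}. chart M e t \<in> U})) \<and>
     (\<forall>x\<in>points \<Gamma>. \<forall>y\<in>points \<Gamma>. distance \<Gamma> x y = path_distance M x y)"

definition tropical_curve :: "'p curve \<Rightarrow> bool" where
  "tropical_curve \<Gamma> \<longleftrightarrow> (\<exists>M :: 'p model. model_of M \<Gamma>)"

definition infinite_points :: "'p curve \<Rightarrow> 'p set" where
  "infinite_points \<Gamma> =
     {p. \<exists>M :: 'p model. model_of M \<Gamma> \<and> (\<exists>e\<in>edges M. len M e = \<infinity> \<and> p = chart M e \<infinity>)}"


section \<open>Finite harmonic morphisms\<close>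

text \<open>\<open>D e\<close> is the degree of \<open>\<phi>\<close> on the edge \<open>e\<close>.\<close>

definition finite_morphism_wrt ::
  "'p curve \<Rightarrow> 'q curve \<Rightarrow> ('p \<Rightarrow> 'q) \<Rightarrow> 'p model \<Rightarrow> 'q model \<Rightarrow> ('p set \<Rightarrow> nat) \<Rightarrow> bool" where
  "finite_morphism_wrt \<Gamma> \<Gamma>' \<phi> M M' D \<longleftrightarrow>
     continuous_map (topo \<Gamma>) (topo \<Gamma>') \<phi> \<and>
     model_of M \<Gamma> \<and> loopless M \<and> model_of M' \<Gamma>' \<and> loopless M' \<and>
     (\<forall>v\<in>verts M. \<phi> v \<in> verts M') \<and>
     (\<forall>e\<in>edges M. \<phi> ` e \<in> edges M') \<and>
     (\<forall>e\<in>edges M. D e > 0 \<and>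
        (\<forall>x\<in>e. \<forall>y\<in>e. distance \<Gamma>' (\<phi> x) (\<phi> y) = ereal (D e) * distance \<Gamma> x y))"

text \<open>\<open>m v\<close> is the common value of the sums at \<open>v\<close>, the local degree. If the target is a
  singleton, then there is no edge incident to \<open>\<phi> v\<close> and \<open>m v\<close> is unconstrained.\<close>

definition harmonic_wrt ::
  "('p \<Rightarrow> 'q) \<Rightarrow> 'p model \<Rightarrow> 'q model \<Rightarrow> ('p set \<Rightarrow> nat) \<Rightarrow> ('p \<Rightarrow> nat) \<Rightarrow> bool" where
  "harmonic_wrt \<phi> M M' D m \<longleftrightarrow>
     (\<forall>v\<in>verts M. \<forall>e'\<in>edges M'. \<phi> v \<in> e' \<longrightarrow>
        (\<Sum>e | e \<in> edges M \<and> \<phi> ` e = e' \<and> v \<in> e. D e) = m v)"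

definition finite_harmonic :: "'p curve \<Rightarrow> 'q curve \<Rightarrow> ('p \<Rightarrow> 'q) \<Rightarrow> bool" where
  "finite_harmonic \<Gamma> \<Gamma>' \<phi> \<longleftrightarrow>
     (\<exists>M M' D m. finite_morphism_wrt \<Gamma> \<Gamma>' \<phi> M M' D \<and> harmonic_wrt \<phi> M M' D m)"

text \<open>\<open>has_degree \<Gamma> \<Gamma>' \<phi> d\<close>: \<open>\<phi>\<close> is a finite harmonic morphism of degree \<open>d\<close>. Since \<open>m\<close> is
  unconstrained for a singleton target, a map between singletons has every natural number
  as a degree, in accordance with the usual convention.\<close>

definition has_degree :: "'p curve \<Rightarrow> 'q curve \<Rightarrow> ('p \<Rightarrow> 'q) \<Rightarrow> nat \<Rightarrow> bool" where
  "has_degree \<Gamma> \<Gamma>' \<phi> d \<longleftrightarrow>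
     (\<exists>M M' D m. finite_morphism_wrt \<Gamma> \<Gamma>' \<phi> M M' D \<and> harmonic_wrt \<phi> M M' D m \<and>
        (\<forall>v'\<in>verts M'. (\<Sum>v | v \<in> verts M \<and> \<phi> v = v'. m v) = d))"


section \<open>Galois coverings\<close>

definition isometric_action ::
  "('g, 'm) monoid_scheme \<Rightarrow> ('g \<Rightarrow> 'p \<Rightarrow> 'p) \<Rightarrow> 'p curve \<Rightarrow> bool" where
  "isometric_action G \<alpha> \<Gamma> \<longleftrightarrow> group_action G (points \<Gamma>) \<alpha> \<and>
     (\<forall>g\<in>carrier G. continuous_map (topo \<Gamma>) (topo \<Gamma>) (\<alpha> g)) \<and>
     (\<forall>g\<in>carrier G. \<forall>x\<in>points \<Gamma> - infinite_points \<Gamma>. \<forall>y\<in>points \<Gamma> - infinite_points \<Gamma>.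
        distance \<Gamma> (\<alpha> g x) (\<alpha> g y) = distance \<Gamma> x y)"

text \<open>Group actions of HOL-Algebra act by maps that are extensional on the set acted on;
  hence the \<open>restrict\<close> in the action on a fiber.\<close>

definition galois_covering ::
  "('g, 'm) monoid_scheme \<Rightarrow> ('g \<Rightarrow> 'p \<Rightarrow> 'p) \<Rightarrow> 'p curve \<Rightarrow> 'q curve \<Rightarrow> ('p \<Rightarrow> 'q) \<Rightarrow> bool" where
  "galois_covering G \<alpha> \<Gamma> \<Gamma>' \<phi> \<longleftrightarrow>
     isometric_action G \<alpha> \<Gamma> \<and>
     finite_harmonic \<Gamma> \<Gamma>' \<phi> \<and>
     has_degree \<Gamma> \<Gamma>' \<phi> (order G) \<and>
     (\<forall>y\<in>points \<Gamma>'. let F = {x \<in> points \<Gamma>. \<phi> x = y} in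
        transitive_action G F (\<lambda>g. restrict (\<alpha> g) F)) \<and>
     finite {x \<in> points \<Gamma>. stabilizer G \<alpha> x \<noteq> {\<one>\<^bsub>G\<^esub>}}"

definition deck_group ::
  "('g, 'm) monoid_scheme \<Rightarrow> ('g \<Rightarrow> 'p \<Rightarrow> 'p) \<Rightarrow> 'p curve \<Rightarrow> ('p \<Rightarrow> 'q) \<Rightarrow> 'g set" where
  "deck_group G \<alpha> \<Gamma> \<psi> = {g \<in> carrier G. \<forall>x\<in>points \<Gamma>. \<psi> (\<alpha> g x) = \<psi> x}"


section \<open>The poset of intermediate Galois coverings\<close>

text \<open>A morphism out of \<open>\<Gamma>\<close> is a pair of its target and its map. The targets range over all
  tropical curves whose points have type \<open>'c\<close>. Maps are compared on \<open>points \<Gamma>\<close> only.\<close>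

type_synonym ('p, 'c) arrow = "'c curve \<times> ('p \<Rightarrow> 'c)"

definition galois_arrows ::
  "('g, 'm) monoid_scheme \<Rightarrow> ('g \<Rightarrow> 'p \<Rightarrow> 'p) \<Rightarrow> 'p curve \<Rightarrow> ('p, 'c) arrow set" where
  "galois_arrows G \<alpha> \<Gamma> =
     {(\<Gamma>'', \<psi>). tropical_curve \<Gamma>'' \<and> finite_harmonic \<Gamma> \<Gamma>'' \<psi> \<and>
        galois_covering (G\<lparr>carrier := deck_group G \<alpha> \<Gamma> \<psi>\<rparr>) \<alpha> \<Gamma> \<Gamma>'' \<psi>}"

definition arrow_equiv ::
  "('g, 'm) monoid_scheme \<Rightarrow> ('g \<Rightarrow> 'p \<Rightarrow> 'p) \<Rightarrow> 'p curve \<Rightarrow> ('p, 'c) arrow rel" where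
  "arrow_equiv G \<alpha> \<Gamma> =
     {((\<Gamma>1, \<psi>1), (\<Gamma>2, \<psi>2)).
        (\<Gamma>1, \<psi>1) \<in> galois_arrows G \<alpha> \<Gamma> \<and> (\<Gamma>2, \<psi>2) \<in> galois_arrows G \<alpha> \<Gamma> \<and>
        (\<exists>\<psi>12. finite_harmonic \<Gamma>2 \<Gamma>1 \<psi>12 \<and> has_degree \<Gamma>2 \<Gamma>1 \<psi>12 1 \<and>
           (\<forall>x\<in>points \<Gamma>. \<psi>1 x = (\<psi>12 \<circ> \<psi>2) x))}"

definition galois_classes ::
  "('g, 'm) monoid_scheme \<Rightarrow> ('g \<Rightarrow> 'p \<Rightarrow> 'p) \<Rightarrow> 'p curve \<Rightarrow> ('p, 'c) arrow set set" where
  "galois_classes G \<alpha> \<Gamma> = galois_arrows G \<alpha> \<Gamma> // arrow_equiv G \<alpha> \<Gamma>"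

definition class_le :: "'p curve \<Rightarrow> ('p, 'c) arrow set \<Rightarrow> ('p, 'c) arrow set \<Rightarrow> bool" where
  "class_le \<Gamma> a1 a2 \<longleftrightarrow>
     (\<forall>(\<Gamma>1, \<psi>1)\<in>a1. \<forall>(\<Gamma>2, \<psi>2)\<in>a2.
        \<exists>\<theta>. finite_harmonic \<Gamma>2 \<Gamma>1 \<theta> \<and> (\<forall>x\<in>points \<Gamma>. \<psi>1 x = (\<theta> \<circ> \<psi>2) x))"

end

theory Submission
  imports Defs
begin

text \<open>A Galois covering is the quotient by its group: the points, the topology and the distance of
  the target are determined by the action on the source. The predicate \<open>quotient_by\<close> describes
  such a quotient without a model; the distance between two points of the target is the distance
  from a point to an orbit. The theorem follows from two facts. A Galois covering \<open>\<psi>\<close> is the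
  quotient by \<open>G(\<psi>)\<close> (\<open>galois_covering_quotient_by\<close>). Conversely, every subgroup has a quotient
  (\<open>quotient_exists\<close>), which is Galois with exactly this deck group, and for \<open>H2 \<subseteq> H1\<close> the
  induced map from the quotient by \<open>H2\<close> to the quotient by \<open>H1\<close> is a finite harmonic morphism of
  degree \<open>|H1|/|H2|\<close> (\<open>has_degree_index\<close>). Hence \<open>[\<psi>] \<mapsto> G(\<psi>)\<close> is a well-defined bijection that
  reverses the orders: a morphism of degree one is injective, so equivalent coverings have the
  same group; a factorisation \<open>\<psi>\<^sub>1 = \<theta> \<circ> \<psi>\<^sub>2\<close> gives \<open>G(\<psi>\<^sub>2) \<subseteq> G(\<psi>\<^sub>1)\<close>, and an inclusion of the
  groups gives the factorisation.

  That a Galois covering is a quotient rests on a count. The dilation factors on the edges above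
  a given edge add up to the degree, that is to \<open>|G|\<close>. The orbit of a point with trivial stabilizer
  has \<open>|G|\<close> elements, which lie on different edges. Hence there are \<open>|G|\<close> such edges, and all factors
  are \<open>1\<close> (\<open>dilation_eq_one\<close>). The covering is then an isometry in the charts of each edge, after
  reversal of some edges of the source (\<open>aligned_model\<close>), and by continuity the group permutes the
  edges compatibly with the charts (\<open>act_edge\<close>). Routes in the target now lift to routes of the same
  length, which identifies the distance of the target with the distance to an orbit
  (\<open>path_distance_image\<close>).

  Different coverings come with different models of the source; they are compared on a single one.
  The vertices of the model that comes with the given covering \<open>\<phi>\<close> are the preimage of the vertices
  of its target, so all of \<open>G\<close> acts on it by automorphisms; its image under the quotient map of any
  subgroup is a model of the quotient (\<open>model_of_quotient_model\<close>). Distances are global, so an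
  edge need not be a shortest path between its ends. Still the distances on an edge are preserved by
  every intermediate quotient, because a quotient map does not increase distances and the last one,
  \<open>\<phi>\<close>, preserves those between points of one edge.\<close>

section \<open>Edges and distances in a loopless metric graph\<close>

lemma path_distance_le:
  assumes "route M x r y" shows "path_distance M x y \<le> route_length r"
  unfolding path_distance_def using assms by (intro INF_lower) auto

lemma path_distance_self: "path_distance M x x \<le> 0"
  using path_distance_le[of M x "[]" x] by (simp add: route_length_def)

lemma route_length_Cons: "route_length ((e, s, t) # r) = \<bar>t - s\<bar> + route_length r"
  by (simp add: route_length_def)

lemma path_distance_nonneg: "0 \<le> path_distance M x y"
proof -
  have "0 \<le> route_length r" for r
    by (induction r) (auto simp: route_length_def)
  then show ?thesis unfolding path_distance_def by (auto intro: INF_greatest)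
qed

lemma ereal_abs_diff_triangle:
  fixes a b c :: ereal
  assumes "0 \<le> a" "0 \<le> b" "0 \<le> c"
  shows "\<bar>c - a\<bar> \<le> \<bar>b - a\<bar> + \<bar>c - b\<bar>"
  using assms by (cases a; cases b; cases c) auto

locale loopless_graph =
  fixes M :: "'p model"
  assumes graph: "metric_graph M" and loopless: "loopless M"
begin

lemma finite_edges: "finite (edges M)" and finite_verts: "finite (verts M)"
  using graph by (auto simp: metric_graph_def finite_multigraph_def)

lemma verts_nonempty: "verts M \<noteq> {}"
  using graph by (auto simp: metric_graph_def connected_multigraph_def)

context
  fixes e assumes e: "e \<in> edges M"
begin

lemma len_pos: "0 < len M e"
  and chart_image: "chart M e ` {0..len M e} = e"
  and ends_eq: "ends M e = {#chart M e 0, chart M e (len M e)#}"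
  and interior_not_vert: "\<And>t. 0 < t \<Longrightarrow> t < len M e \<Longrightarrow> chart M e t \<notin> verts M"
  using graph e unfolding metric_graph_def by (auto simp: disjoint_iff)

lemma end_verts: "chart M e 0 \<in> verts M" "chart M e (len M e) \<in> verts M"
  using graph e ends_eq by (auto simp: metric_graph_def finite_multigraph_def)

lemma vert_iff:
  assumes "t \<in> {0..len M e}"
  shows "chart M e t \<in> verts M \<longleftrightarrow> t = 0 \<or> t = len M e"
  using assms interior_not_vert[of t] end_verts by (auto simp: less_le)

lemma chart_inj: "inj_on (chart M e) {0..len M e}"
proof -
  have i: "inj_on (chart M e) {0<..<len M e}"
    using graph e by (auto simp: metric_graph_def)
  have n: "chart M e 0 \<noteq> chart M e (len M e)"
    using loopless e ends_eq by (auto simp: loopless_def)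
  show ?thesis
  proof (rule inj_onI)
    fix s t assume st: "s \<in> {0..len M e}" "t \<in> {0..len M e}" "chart M e s = chart M e t"
    show "s = t"
    proof (cases "chart M e s \<in> verts M")
      case True
      then show ?thesis using st n vert_iff[of s] vert_iff[of t] by auto
    next
      case False
      then have "s \<in> {0<..<len M e}" "t \<in> {0<..<len M e}"
        using st vert_iff[of s] vert_iff[of t] by (auto simp: less_le)
      then show ?thesis using i st(3) by (auto dest: inj_onD)
    qed
  qed
qed

lemma chart_eq_iff:
  "s \<in> {0..len M e} \<Longrightarrow> t \<in> {0..len M e} \<Longrightarrow> chart M e s = chart M e t \<longleftrightarrow> s = t"
  using chart_inj by (auto dest: inj_onD)

lemma chart_in: "t \<in> {0..len M e} \<Longrightarrow> chart M e t \<in> e"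
  using chart_image by blast

lemma in_edgeE: assumes "x \<in> e" obtains t where "t \<in> {0..len M e}" "x = chart M e t"
  using assms chart_image by blast

lemma path_distance_edge_le:
  assumes "s \<in> {0..len M e}" "t \<in> {0..len M e}"
  shows "path_distance M (chart M e s) (chart M e t) \<le> \<bar>t - s\<bar>"
  using path_distance_le[of M "chart M e s" "[(e, s, t)]" "chart M e t"] assms e
  by (simp add: route_length_def)

end

lemma edges_meet_in_vert:
  assumes "e \<in> edges M" "e' \<in> edges M" "e \<noteq> e'" "x \<in> e" "x \<in> e'"
  shows "x \<in> verts M"
proof (rule ccontr)
  assume x: "x \<notin> verts M"
  obtain s t where "s \<in> {0..len M e}" "x = chart M e s" "t \<in> {0..len M e'}" "x = chart M e' t"
    using assms in_edgeE by metis
  then have "x \<in> chart M e ` {0<..<len M e}" "x \<in> chart M e' ` {0<..<len M e'}"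
    using x vert_iff[OF assms(1), of s] vert_iff[OF assms(2), of t]
    by (auto simp: less_le intro!: image_eqI[of _ "chart M e" s] image_eqI[of _ "chart M e'" t])
  moreover have "chart M e ` {0<..<len M e} \<inter> chart M e' ` {0<..<len M e'} = {}"
    using graph assms(1-3) unfolding metric_graph_def by blast
  ultimately show False by blast
qed

text \<open>Let \<open>r\<close> be at most the length, along each edge at \<open>x\<close>, from \<open>x\<close> to another end. A route
  from \<open>x\<close> of length less than \<open>r\<close> never reaches such an end, so by induction on the route each of
  its points lies on an edge at \<open>x\<close>, at a parameter whose difference from that of \<open>x\<close> is at most the
  length travelled. In this way the path distance determines the parametrisation near each point, although
  on a long edge the shortest way between two points may lead around.\<close>

lemma path_distance_local:
  assumes e0: "e0 \<in> edges M" and s0: "s0 \<in> {0..len M e0}"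
  obtains r where "0 < r"
    and "\<And>t. t \<in> {0..len M e0} \<Longrightarrow> t \<noteq> s0 \<Longrightarrow>
      min r \<bar>t - s0\<bar> \<le> path_distance M (chart M e0 s0) (chart M e0 t)"
proof -
  define x where "x = chart M e0 s0"
  define R where "R = {\<bar>t - s\<bar> | e s t. e \<in> edges M \<and> s \<in> {0..len M e} \<and> chart M e s = x \<and>
    t \<in> {0, len M e} \<and> t \<noteq> s}"
  have "R \<subseteq> (\<Union>e\<in>edges M. (\<lambda>t. \<bar>t - the_inv_into {0..len M e} (chart M e) x\<bar>) ` {0, len M e})"
    unfolding R_def using chart_inj by (fastforce simp: the_inv_into_f_f)
  then have finR: "finite R" using finite_edges by (auto intro: finite_subset)
  have posR: "0 < a" if "a \<in> R" for a
  proof -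
    have "\<bar>t - s\<bar> > 0" if "s \<noteq> t" for s t :: ereal
      using that by (cases s; cases t) auto
    then show ?thesis using that unfolding R_def by auto
  qed
  define r where "r = Min (insert 1 R)"
  have r: "0 < r" unfolding r_def using finR posR by (auto simp: Min_gr_iff)
  have end_far: "r \<le> \<bar>t - s\<bar>"
    if "e \<in> edges M" "s \<in> {0..len M e}" "chart M e s = x" "t \<in> {0, len M e}" "t \<noteq> s" for e s t
    unfolding r_def using finR that by (intro Min_le) (auto simp: R_def)
  \<comment> \<open>The invariant of the induction; it claims nothing once the length \<open>a\<close> has reached \<open>r\<close>.\<close>
  define near where "near y a \<longleftrightarrow> r \<le> a \<or> y = x \<or> (\<exists>e\<in>edges M. \<exists>s\<in>{0..len M e}. \<exists>t\<in>{0..len M e}.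
    chart M e s = x \<and> chart M e t = y \<and> \<bar>t - s\<bar> \<le> a)" for y a
  have near_step: "near (chart M e t') (a + \<bar>t' - t\<bar>)"
    if near: "near (chart M e t) a" and a: "0 \<le> a"
      and e: "e \<in> edges M" and t: "t \<in> {0..len M e}" "t' \<in> {0..len M e}" for e t t' a
  proof -
    have direct: ?thesis if "chart M e t = x"
    proof -
      have "\<bar>t' - t\<bar> \<le> a + \<bar>t' - t\<bar>" using a by (cases a; cases "\<bar>t' - t\<bar>") auto
      then show ?thesis unfolding near_def using that e t by blast
    qed
    have le: "a \<le> a + \<bar>t' - t\<bar>" by (rule ereal_le_add_self) simp
    show ?thesis
    proof (cases "r \<le> a \<or> chart M e t = x")
      case True
      then show ?thesis using direct le unfolding near_def by (auto intro: order_trans)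
    next
      case False
      then obtain e2 s2 t2 where 2: "e2 \<in> edges M" "s2 \<in> {0..len M e2}" "t2 \<in> {0..len M e2}"
          "chart M e2 s2 = x" "chart M e2 t2 = chart M e t" "\<bar>t2 - s2\<bar> \<le> a"
        using near unfolding near_def by blast
      have "e2 = e"
      proof (rule ccontr)
        assume "e2 \<noteq> e"
        then have "chart M e2 t2 \<in> verts M"
          using edges_meet_in_vert[of e2 e] 2 e t chart_in by metis
        then have "t2 \<in> {0, len M e2}" using vert_iff 2 by blast
        then have "t2 = s2" using end_far[of e2 s2 t2] 2 False order_trans by blast
        then show False using 2 False by simp
      qed
      then have "t2 = t" using chart_eq_iff 2 e t by metis
      have "\<bar>t' - s2\<bar> \<le> \<bar>t - s2\<bar> + \<bar>t' - t\<bar>"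
        using ereal_abs_diff_triangle 2 t by auto
      also have "\<dots> \<le> a + \<bar>t' - t\<bar>"
        using 2 \<open>t2 = t\<close> by (intro add_right_mono) auto
      finally show ?thesis unfolding near_def using 2 e t \<open>e2 = e\<close> by blast
    qed
  qed
  have near_route: "near z (a + route_length q)" if "route M y q z" "near y a" "0 \<le> a" for y q z a
    using that
  proof (induction q arbitrary: y a)
    case Nil
    then show ?case by (simp add: route_length_def)
  next
    case (Cons seg q)
    obtain e t t' where seg: "seg = (e, t, t')" by (cases seg)
    have "near z ((a + \<bar>t' - t\<bar>) + route_length q)"
      using Cons near_step[of e t a t'] unfolding seg
      by (intro Cons.IH[of "chart M e t'"]) auto
    then show ?case unfolding seg route_length_Cons by (simp add: add.assoc)
  qed
  have "min r \<bar>t - s0\<bar> \<le> path_distance M x (chart M e0 t)" if t: "t \<in> {0..len M e0}" "t \<noteq> s0" for t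
    unfolding path_distance_def
  proof (rule INF_greatest)
    fix q assume "q \<in> {q. route M x q (chart M e0 t)}"
    then have "near (chart M e0 t) (0 + route_length q)"
      using near_route[of x q "chart M e0 t" 0] unfolding near_def[of x] by auto
    moreover have "chart M e0 t \<noteq> x" using chart_eq_iff[OF e0] t s0 unfolding x_def by blast
    ultimately consider "r \<le> route_length q"
      | e2 s2 t2 where "e2 \<in> edges M" "s2 \<in> {0..len M e2}" "t2 \<in> {0..len M e2}"
          "chart M e2 s2 = x" "chart M e2 t2 = chart M e0 t" "\<bar>t2 - s2\<bar> \<le> route_length q"
      unfolding near_def by auto
    then show "min r \<bar>t - s0\<bar> \<le> route_length q"
    proof cases
      case 1 then show ?thesis by (simp add: min.coboundedI1)
    next
      case 2
      show ?thesis
      proof (cases "e2 = e0")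
        case True
        then have "s2 = s0" "t2 = t" using 2 chart_eq_iff[OF e0] t s0 unfolding x_def by metis+
        then show ?thesis using 2 by (simp add: min.coboundedI2)
      next
        case False
        then have "chart M e2 t2 \<in> verts M"
          using edges_meet_in_vert[of e2 e0] 2 e0 t chart_in by metis
        then have t2: "t2 \<in> {0, len M e2}" using vert_iff 2 by blast
        have "t2 \<noteq> s2"
          using 2 \<open>chart M e0 t \<noteq> x\<close> by metis
        then have "r \<le> \<bar>t2 - s2\<bar>" using end_far 2 t2 by blast
        then show ?thesis using 2 by (meson min.coboundedI1 order_trans)
      qed
    qed
  qed
  then show thesis using that r unfolding x_def by blast
qed

end

section \<open>Local isometries of intervals\<close>

text \<open>The function \<open>w t - t\<close> is locally constant on \<open>[0, l)\<close> and vanishes at \<open>0\<close>. The end \<open>l\<close> is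
  treated apart, since differences say nothing there if \<open>l = \<infinity>\<close>. In the hypothesis \<open>t \<noteq> s\<close> is
  assumed because \<open>\<bar>w s - w s\<bar> = \<infinity>\<close> if \<open>w s = \<infinity>\<close>.\<close>

lemma increasing_local_isometry_interval:
  fixes w :: "ereal \<Rightarrow> ereal"
  assumes l: "0 < l" and w0: "w 0 = 0"
    and mono: "\<And>s t. s \<in> {0..l} \<Longrightarrow> t \<in> {0..l} \<Longrightarrow> s < t \<Longrightarrow> w s < w t"
    and loc: "\<And>s. s \<in> {0..l} \<Longrightarrow> s \<noteq> \<infinity> \<Longrightarrow>
      \<exists>r>0. \<forall>t\<in>{0..l}. t \<noteq> s \<longrightarrow> \<bar>t - s\<bar> < r \<longrightarrow> \<bar>w t - w s\<bar> = \<bar>t - s\<bar>"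
  shows "\<forall>t\<in>{0..l}. w t = t"
proof -
  have fin: "0 \<le> w t \<and> w t < \<infinity>" if "t \<in> {0..<l}" for t
    using mono[of 0 t] mono[of t l] w0 that l
    by (metis atLeastAtMost_iff atLeastLessThan_iff ereal_infty_less(1) less_imp_neq
        less_le_trans order.order_iff_strict order_refl not_less_iff_gr_or_eq)
  have interior: "w t = t" if t: "t \<in> {0..<l}" for t
  proof -
    have "w 0 - 0 = w t - t"
    proof (rule connected_local_const[of "{0..<l}" 0 t "\<lambda>a. w a - a"])
      show "\<forall>a\<in>{0..<l}. eventually (\<lambda>b. w a - a = w b - b) (at a within {0..<l})"
      proof
        fix a assume a: "a \<in> {0..<l}"
        then have aI: "a \<in> {0..l}" "a \<noteq> \<infinity>" by auto
        then obtain r where r: "r > 0" "\<And>t. t \<in> {0..l} \<Longrightarrow> t \<noteq> a \<Longrightarrow> \<bar>t - a\<bar> < r \<Longrightarrow> \<bar>w t - w a\<bar> = \<bar>t - a\<bar>"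
          using loc by metis
        have "eventually (\<lambda>b. b \<in> {a - r<..<a + r}) (at a within {0..<l})"
          unfolding eventually_at_topological using a r(1)
          by (intro exI[of _ "{a - r<..<a + r}"]) (cases a; cases r; auto)
        moreover have "eventually (\<lambda>b. b \<in> {0..<l}) (at a within {0..<l})"
          by (auto simp: eventually_at_topological)
        ultimately show "eventually (\<lambda>b. w a - a = w b - b) (at a within {0..<l})"
        proof eventually_elim
          case (elim b)
          show ?case
          proof (cases "b = a")
            case False
            have "\<bar>b - a\<bar> < r" using elim a r(1) by (cases a; cases b; cases r) auto
            then have "\<bar>w b - w a\<bar> = \<bar>b - a\<bar>" using r(2) elim False by auto
            moreover have "a < b \<Longrightarrow> w a < w b" "b < a \<Longrightarrow> w b < w a"
              using mono a elim by auto
            moreover obtain ra where ra: "a = ereal ra" using a by (cases a) auto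
            moreover obtain rb where rb: "b = ereal rb" using elim(2) by (cases b) auto
            moreover obtain wa where wa: "w a = ereal wa" using fin[OF a] by (cases "w a") auto
            moreover obtain wb where wb: "w b = ereal wb" using fin[OF elim(2)] by (cases "w b") auto
            ultimately have "\<bar>wb - wa\<bar> = \<bar>rb - ra\<bar>" "ra < rb \<Longrightarrow> wa < wb" "rb < ra \<Longrightarrow> wb < wa"
              by simp_all
            then have "wa - ra = wb - rb" by linarith
            then show ?thesis using ra rb wa wb by simp
          qed simp
        qed
      qed
    qed (use t l in \<open>auto simp: connected_Ico\<close>)
    then show ?thesis using fin[OF t] t w0 by (cases t; cases "w t") (auto simp: zero_ereal_def)
  qed
  have "w l = l"
  proof (cases "l = \<infinity>")
    case True
    have "ereal x \<le> w l" for x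
    proof -
      have m: "ereal (max x 0) \<in> {0..<l}" using True by (auto simp: zero_ereal_def simp flip: ereal_max)
      then have "ereal (max x 0) < w l"
        using mono[of "ereal (max x 0)" l] interior[OF m] l by (auto simp del: ereal_max)
      then show ?thesis by (meson ereal_less_eq(3) less_imp_le max.cobounded1 order_trans)
    qed
    then show ?thesis using True ereal_top by blast
  next
    case False
    have "l \<in> {0..l}" using l by simp
    then obtain r where r0: "r > 0" "\<forall>t\<in>{0..l}. t \<noteq> l \<longrightarrow> \<bar>t - l\<bar> < r \<longrightarrow> \<bar>w t - w l\<bar> = \<bar>t - l\<bar>"
      using loc[OF _ False] by blast
    note r = r0(1) r0(2)[rule_format]
    have "max 0 (l - r) < l" using l r(1) False by (cases l; cases r) auto
    then obtain t where t: "max 0 (l - r) < t" "t < l" using dense by blast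
    have "\<bar>t - l\<bar> < r" using t False l r(1) by (cases t; cases l; cases r) (auto simp: max_def split: if_splits)
    then have "\<bar>t - w l\<bar> = \<bar>t - l\<bar>" using r(2)[of t] interior[of t] t less_imp_le[OF t(2)] by auto
    moreover have "t < w l" using mono[of t l] interior[of t] t less_imp_le[OF t(2)] less_imp_le[OF l] by auto
    ultimately show ?thesis using t False l by (cases t; cases l; cases "w l") auto
  qed
  then show ?thesis using interior by (metis atLeastAtMost_iff atLeastLessThan_iff order.order_iff_strict)
qed

text \<open>A continuous injection of an interval is monotone. If \<open>w\<close> decreases then \<open>w 0 = l'\<close> is finite, since
  \<open>w\<close> differs from \<open>w 0\<close> by finite amounts near \<open>0\<close>; so \<open>l' - w\<close> is increasing, starts at \<open>0\<close>, and is
  again a local isometry.\<close>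

lemma local_isometry_interval:
  fixes w :: "ereal \<Rightarrow> ereal"
  assumes l: "0 < l" and l': "0 < l'"
    and cont: "continuous_on {0..l} w" and bij: "bij_betw w {0..l} {0..l'}"
    and loc: "\<And>s. s \<in> {0..l} \<Longrightarrow> s \<noteq> \<infinity> \<Longrightarrow>
      \<exists>r>0. \<forall>t\<in>{0..l}. t \<noteq> s \<longrightarrow> \<bar>t - s\<bar> < r \<longrightarrow> \<bar>w t - w s\<bar> = \<bar>t - s\<bar>"
  shows "l' = l \<and> ((\<forall>t\<in>{0..l}. w t = t) \<or> l \<noteq> \<infinity> \<and> (\<forall>t\<in>{0..l}. w t = l - t))"
proof -
  have inj: "inj_on w {0..l}" and img: "w ` {0..l} = {0..l'}"
    using bij by (auto simp: bij_betw_def)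
  have between: "w a < w x \<and> w x < w b \<or> w b < w x \<and> w x < w a"
    if "a \<in> {0..l}" "b \<in> {0..l}" "a < x" "x < b" for a x b
    using continuous_inj_imp_mono[of a x b w] that
      continuous_on_subset[OF cont, of "{a..b}"] inj_on_subset[OF inj, of "{a..b}"] by auto
  have in_l': "w t \<in> {0..l'}" if "t \<in> {0..l}" for t using img that by blast
  show ?thesis
  proof (cases "w 0 < w l")
    case True
    have ends: "w 0 < w x \<and> w x < w l" if "0 < x" "x < l" for x
      using between[of 0 l x] that True less_imp_le[OF l] by auto
    have mono: "w s < w t" if "s \<in> {0..l}" "t \<in> {0..l}" "s < t" for s t
    proof -
      have "s < l" "0 < t" using that by (auto intro: less_le_trans le_less_trans)
      then show ?thesis
        using ends[of s] ends[of t] between[of 0 t s] that True less_imp_le[OF l]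
        by (cases "s = 0"; cases "t = l") (auto simp: less_le)
    qed
    have "w 0 \<le> w t" "w t \<le> w l" if "t \<in> {0..l}" for t
    proof -
      have "t = 0 \<or> 0 < t" "t = l \<or> t < l" using that by (auto simp: le_less)
      then show "w 0 \<le> w t" "w t \<le> w l"
        using mono[of 0 t] mono[of t l] that less_imp_le[OF l] by (auto simp: less_imp_le)
    qed
    moreover obtain t0 t1 where "t0 \<in> {0..l}" "w t0 = 0" "t1 \<in> {0..l}" "w t1 = l'"
      using img l' by (smt (verit) atLeastAtMost_iff imageE order_refl less_imp_le)
    ultimately have w: "w 0 = 0" "w l = l'" using in_l'[of 0] in_l'[of l] l
      by (metis atLeastAtMost_iff order.antisym less_imp_le order_refl)+
    have "\<forall>t\<in>{0..l}. w t = t"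
      by (rule increasing_local_isometry_interval[OF l w(1) mono loc])
    then have "w l = l" using less_imp_le[OF l] by (metis atLeastAtMost_iff order_refl)
    then show ?thesis using w(2) \<open>\<forall>t\<in>{0..l}. w t = t\<close> by blast
  next
    case False
    moreover have "w 0 \<noteq> w l" using inj_on_eq_iff[OF inj, of 0 l] l by simp
    ultimately have True: "w l < w 0" by simp
    have ends: "w l < w x \<and> w x < w 0" if "0 < x" "x < l" for x
      using between[of 0 l x] that True less_imp_le[OF l] by auto
    have mono: "w t < w s" if "s \<in> {0..l}" "t \<in> {0..l}" "s < t" for s t
    proof -
      have "s < l" "0 < t" using that by (auto intro: less_le_trans le_less_trans)
      then show ?thesis
        using ends[of s] ends[of t] between[of 0 t s] that True less_imp_le[OF l]
        by (cases "s = 0"; cases "t = l") (auto simp: less_le)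
    qed
    have "w l \<le> w t" "w t \<le> w 0" if "t \<in> {0..l}" for t
    proof -
      have "t = 0 \<or> 0 < t" "t = l \<or> t < l" using that by (auto simp: le_less)
      then show "w l \<le> w t" "w t \<le> w 0"
        using mono[of 0 t] mono[of t l] that less_imp_le[OF l] by (auto simp: less_imp_le)
    qed
    moreover obtain t0 t1 where "t0 \<in> {0..l}" "w t0 = 0" "t1 \<in> {0..l}" "w t1 = l'"
      using img l' by (smt (verit) atLeastAtMost_iff imageE order_refl less_imp_le)
    ultimately have w: "w l = 0" "w 0 = l'" using in_l'[of 0] in_l'[of l] l
      by (metis atLeastAtMost_iff order.antisym less_imp_le order_refl)+
    have l'_fin: "l' \<noteq> \<infinity>"
    proof
      assume inf: "l' = \<infinity>"
      have "0 \<in> {0..l}" using l by simp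
      then obtain r where r0: "r > 0" "\<forall>t\<in>{0..l}. t \<noteq> 0 \<longrightarrow> \<bar>t - 0\<bar> < r \<longrightarrow> \<bar>w t - w 0\<bar> = \<bar>t - 0\<bar>"
        using loc[of 0] by (metis PInfty_neq_ereal(1) zero_ereal_def)
      note r = r0(1) r0(2)[rule_format, simplified]
      obtain t where t: "0 < t" "t < min r l" using dense[of 0 "min r l"] l r(1) by auto
      then have "\<bar>w t - w 0\<bar> = \<bar>t\<bar>" using r(2)[of t] by (cases t) auto
      then show False using inf w t by (cases t; cases "w t") auto
    qed
    have "\<forall>t\<in>{0..l}. l' - w t = t"
    proof (rule increasing_local_isometry_interval[OF l])
      show "l' - w 0 = 0" using w l' l'_fin by (cases l') auto
      show "l' - w s < l' - w t" if "s \<in> {0..l}" "t \<in> {0..l}" "s < t" for s t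
        using mono[OF that] in_l'[of s] in_l'[of t] that l'_fin by (cases l'; cases "w s"; cases "w t") auto
      show "\<exists>r>0. \<forall>t\<in>{0..l}. t \<noteq> s \<longrightarrow> \<bar>t - s\<bar> < r \<longrightarrow> \<bar>l' - w t - (l' - w s)\<bar> = \<bar>t - s\<bar>"
        if s: "s \<in> {0..l}" "s \<noteq> \<infinity>" for s
      proof -
        have "\<bar>l' - w t - (l' - w s)\<bar> = \<bar>w t - w s\<bar>" if "t \<in> {0..l}" for t
          using in_l'[of s] in_l'[of t] that s l'_fin by (cases l'; cases "w s"; cases "w t") auto
        then show ?thesis using loc[OF s] by metis
      qed
    qed
    then have *: "l' - w t = t" if "t \<in> {0..l}" for t using that by blast
    have "l' = l" using *[of l] w l by (cases l') auto
    moreover have "w t = l' - t" if "t \<in> {0..l}" for t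
      using *[OF that] in_l'[OF that] that l'_fin by (cases l'; cases "w t"; cases t) auto
    ultimately show ?thesis using l'_fin by auto
  qed
qed

section \<open>The topology of a model\<close>

lemma
  assumes "model_of M \<Gamma>"
  shows model_points: "points \<Gamma> = verts M \<union> \<Union>(edges M)"
    and model_openin: "openin (topo \<Gamma>) U \<longleftrightarrow> U \<subseteq> points \<Gamma> \<and>
        (\<forall>e\<in>edges M. openin (top_of_set {0..len M e}) {t \<in> {0..len M e}. chart M e t \<in> U})"
    and model_distance: "x \<in> points \<Gamma> \<Longrightarrow> y \<in> points \<Gamma> \<Longrightarrow> distance \<Gamma> x y = path_distance M x y"
    and model_graph: "metric_graph M"
  using assms unfolding model_of_def by blast+

locale loopless_model = loopless_graph +
  fixes \<Gamma> :: "'a curve"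
  assumes model: "model_of M \<Gamma>"
begin

lemmas points_eq = model_points[OF model]
  and openin_iff = model_openin[OF model]
  and distance_eq = model_distance[OF model]

lemma edge_subset_points: "e \<in> edges M \<Longrightarrow> e \<subseteq> points \<Gamma>"
  using points_eq by blast

lemma chart_in_points: "e \<in> edges M \<Longrightarrow> t \<in> {0..len M e} \<Longrightarrow> chart M e t \<in> points \<Gamma>"
  using chart_in edge_subset_points by blast

lemma closedin_imp_closed:
  assumes e: "e \<in> edges M" and C: "closedin (topo \<Gamma>) C"
  shows "closed {t \<in> {0..len M e}. chart M e t \<in> C}"
proof -
  have "openin (top_of_set {0..len M e}) {t \<in> {0..len M e}. chart M e t \<in> points \<Gamma> - C}"
    using openin_iff[of "points \<Gamma> - C"] C e by (auto simp: closedin_def)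
  then have "closedin (top_of_set {0..len M e})
      ({0..len M e} - {t \<in> {0..len M e}. chart M e t \<in> points \<Gamma> - C})"
    by (metis closedin_diff closedin_topspace topspace_euclidean_subtopology)
  also have "{0..len M e} - {t \<in> {0..len M e}. chart M e t \<in> points \<Gamma> - C} =
      {t \<in> {0..len M e}. chart M e t \<in> C}"
    using chart_in_points[OF e] by auto
  finally show ?thesis by (simp add: closedin_closed_eq)
qed

text \<open>The preimage of the set in the chart of another edge is finite, as two edges meet in vertices
  only.\<close>

lemma closedin_chart_image:
  assumes e: "e \<in> edges M" and C: "closed C" "C \<subseteq> {0..len M e}"
  shows "closedin (topo \<Gamma>) (chart M e ` C)"
proof -
  have "openin (top_of_set {0..len M e2}) {t \<in> {0..len M e2}. chart M e2 t \<in> points \<Gamma> - chart M e ` C}"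
    if e2: "e2 \<in> edges M" for e2
  proof -
    define T where "T = {t \<in> {0..len M e2}. chart M e2 t \<in> chart M e ` C}"
    have "closed T"
    proof (cases "e2 = e")
      case True
      have "chart M e t \<in> chart M e ` C \<longleftrightarrow> t \<in> C" if "t \<in> {0..len M e}" for t
        using that C chart_eq_iff[OF e] by blast
      then have "T = C" unfolding T_def using True C by auto
      then show ?thesis using C by simp
    next
      case False
      have "T \<subseteq> {0, len M e2}"
      proof
        fix t assume "t \<in> T"
        then have "t \<in> {0..len M e2}" "chart M e2 t \<in> e"
          using chart_in[OF e] C unfolding T_def by (auto simp del: atLeastAtMost_iff)
        moreover from this have "chart M e2 t \<in> verts M"
          using edges_meet_in_vert[OF e2 e False] chart_in[OF e2] by blast
        ultimately have "chart M e2 t \<in> verts M" "t \<in> {0..len M e2}" by blast+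
        then show "t \<in> {0, len M e2}" using vert_iff[OF e2] by auto
      qed
      then show ?thesis by (meson finite.emptyI finite.insertI finite_imp_closed finite_subset)
    qed
    moreover have "{t \<in> {0..len M e2}. chart M e2 t \<in> points \<Gamma> - chart M e ` C} = {0..len M e2} \<inter> - T"
      unfolding T_def using chart_in_points[OF e2] by auto
    ultimately show ?thesis by (auto simp: openin_open)
  qed
  then have "openin (topo \<Gamma>) (points \<Gamma> - chart M e ` C)" using openin_iff by blast
  then show ?thesis using C chart_in_points[OF e] by (auto simp: closedin_def)
qed

lemma openin_interior:
  assumes e: "e \<in> edges M"
  shows "openin (topo \<Gamma>) (chart M e ` {0<..<len M e})"
proof -
  have "openin (top_of_set {0..len M e2}) {t \<in> {0..len M e2}. chart M e2 t \<in> chart M e ` {0<..<len M e}}"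
    if e2: "e2 \<in> edges M" for e2
  proof (cases "e2 = e")
    case True
    have "chart M e t \<in> chart M e ` {0<..<len M e} \<longleftrightarrow> t \<in> {0<..<len M e}" if "t \<in> {0..len M e}" for t
      using inj_on_image_mem_iff[OF chart_inj[OF e] that, of "{0<..<len M e}"] by fastforce
    then have "{t \<in> {0..len M e2}. chart M e2 t \<in> chart M e ` {0<..<len M e}} = {0<..<len M e}"
      unfolding True by fastforce
    then show ?thesis by (auto simp: openin_open intro!: exI[of _ "{0<..<len M e}"])
  next
    case False
    have "{t \<in> {0..len M e2}. chart M e2 t \<in> chart M e ` {0<..<len M e}} = {}"
    proof (rule equals0I)
      fix t assume t: "t \<in> {t \<in> {0..len M e2}. chart M e2 t \<in> chart M e ` {0<..<len M e}}"
      then obtain s where s: "0 < s" "s < len M e" "chart M e2 t = chart M e s" by auto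
      then have "chart M e s \<in> verts M"
        using edges_meet_in_vert[OF e2 e False, of "chart M e s"] chart_in[OF e2, of t]
          chart_in[OF e, of s] t less_imp_le[OF s(1)] less_imp_le[OF s(2)] by auto
      then show False using interior_not_vert[OF e] s by blast
    qed
    then show ?thesis by (simp only: openin_empty)
  qed
  moreover have "chart M e ` {0<..<len M e} \<subseteq> points \<Gamma>"
    using chart_in_points[OF e] by (auto intro!: chart_in_points[OF e])
  ultimately show ?thesis using openin_iff by blast
qed

lemma distance_self: "x \<in> points \<Gamma> \<Longrightarrow> distance \<Gamma> x x = 0"
  using distance_eq path_distance_self[of M x] path_distance_nonneg[of M x x] by auto

lemma distance_local:
  assumes "e \<in> edges M" "s \<in> {0..len M e}"
  obtains r where "0 < r"
    and "\<And>t. t \<in> {0..len M e} \<Longrightarrow> t \<noteq> s \<Longrightarrow> min r \<bar>t - s\<bar> \<le> distance \<Gamma> (chart M e s) (chart M e t)"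
  using path_distance_local[OF assms] distance_eq chart_in_points assms by metis

lemma distance_edge_le:
  assumes "e \<in> edges M" "s \<in> {0..len M e}" "t \<in> {0..len M e}"
  shows "distance \<Gamma> (chart M e s) (chart M e t) \<le> \<bar>t - s\<bar>"
  using path_distance_edge_le[OF assms] distance_eq chart_in_points assms by metis

lemma distance_edge_pos:
  assumes e: "e \<in> edges M" and xy: "x \<in> e" "y \<in> e" "x \<noteq> y"
  shows "0 < distance \<Gamma> x y"
proof -
  obtain s t where st: "s \<in> {0..len M e}" "x = chart M e s" "t \<in> {0..len M e}" "y = chart M e t"
    using in_edgeE[OF e] xy by metis
  then have "t \<noteq> s" using xy by auto
  then have "0 < \<bar>t - s\<bar>" by (cases s; cases t) auto
  obtain r where "0 < r" "min r \<bar>t - s\<bar> \<le> distance \<Gamma> x y"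
    using distance_local[OF e st(1)] st \<open>t \<noteq> s\<close> by metis
  then show ?thesis using \<open>0 < \<bar>t - s\<bar>\<close> by (metis less_le_trans min_less_iff_conj)
qed

end

text \<open>Read in the charts, \<open>\<psi>\<close> is a continuous bijection \<open>w\<close> of intervals. Near each finite parameter
  the distances of both curves are the differences of the parameters, so \<open>w\<close> is a local isometry and
  hence the identity or a reflection. Reflection is impossible on an infinite edge, where one end
  is at a finite distance from the interior and the other is not.\<close>

lemma model_edge_isometry:
  assumes M: "loopless_model M \<Gamma>" and N: "loopless_model N \<Gamma>'"
    and cont: "continuous_map (topo \<Gamma>) (topo \<Gamma>') \<psi>"
    and e: "e \<in> edges M" and f: "\<psi> ` e \<in> edges N"
    and iso: "\<And>x y. x \<in> e \<Longrightarrow> y \<in> e \<Longrightarrow> distance \<Gamma>' (\<psi> x) (\<psi> y) = distance \<Gamma> x y"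
  shows "len N (\<psi> ` e) = len M e \<and>
    ((\<forall>t\<in>{0..len M e}. \<psi> (chart M e t) = chart N (\<psi> ` e) t) \<or>
     len M e \<noteq> \<infinity> \<and> (\<forall>t\<in>{0..len M e}. \<psi> (chart M e t) = chart N (\<psi> ` e) (len M e - t)))"
proof -
  interpret M: loopless_model M \<Gamma> by (fact M)
  interpret N: loopless_model N \<Gamma>' by (fact N)
  define c where "c = chart M e" define c' where "c' = chart N (\<psi> ` e)"
  define l where "l = len M e" define l' where "l' = len N (\<psi> ` e)"
  define w where "w t = the_inv_into {0..l'} c' (\<psi> (c t))" for t
  have inj: "inj_on \<psi> e"
  proof (rule inj_onI, rule ccontr)
    fix x y assume xy: "x \<in> e" "y \<in> e" "\<psi> x = \<psi> y" "x \<noteq> y"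
    have "distance \<Gamma>' (\<psi> x) (\<psi> y) = 0"
      using N.distance_self[of "\<psi> x"] N.edge_subset_points[OF f] xy by auto
    then show False using iso[of x y] M.distance_edge_pos[OF e xy(1,2,4)] xy by auto
  qed
  have c'bij: "bij_betw c' {0..l'} (\<psi> ` e)"
    unfolding c'_def l'_def bij_betw_def using N.chart_inj[OF f] N.chart_image[OF f] by blast
  have cbij: "bij_betw c {0..l} e"
    unfolding c_def l_def bij_betw_def using M.chart_inj[OF e] M.chart_image[OF e] by blast
  have \<psi>bij: "bij_betw \<psi> e (\<psi> ` e)" using inj by (simp add: bij_betw_def)
  have cw: "w t \<in> {0..l'}" "c' (w t) = \<psi> (c t)" if "t \<in> {0..l}" for t
    using that cbij c'bij unfolding w_def bij_betw_def
    by (auto intro!: the_inv_into_into f_the_inv_into_f simp del: atLeastAtMost_iff)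
  have wbij: "bij_betw w {0..l} {0..l'}"
    using bij_betw_trans[OF bij_betw_trans[OF cbij \<psi>bij] bij_betw_the_inv_into[OF c'bij]]
    unfolding w_def comp_def .
  have wcont: "continuous_on {0..l} w"
    unfolding continuous_on_closed_vimage[OF closed_atLeastAtMost]
  proof (intro allI impI)
    fix B :: "ereal set" assume "closed B"
    then have "closedin (topo \<Gamma>') (c' ` (B \<inter> {0..l'}))"
      unfolding c'_def l'_def by (intro N.closedin_chart_image[OF f]) auto
    then have "closedin (topo \<Gamma>) {x \<in> points \<Gamma>. \<psi> x \<in> c' ` (B \<inter> {0..l'})}"
      using cont by (rule closedin_continuous_map_preimage[rotated])
    then have "closed {t \<in> {0..l}. c t \<in> {x \<in> points \<Gamma>. \<psi> x \<in> c' ` (B \<inter> {0..l'})}}"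
      unfolding l_def c_def by (rule M.closedin_imp_closed[OF e])
    also have "{t \<in> {0..l}. c t \<in> {x \<in> points \<Gamma>. \<psi> x \<in> c' ` (B \<inter> {0..l'})}} = w -` B \<inter> {0..l}"
    proof -
      have "\<psi> (c t) \<in> c' ` (B \<inter> {0..l'}) \<longleftrightarrow> w t \<in> B" if t: "t \<in> {0..l}" for t
        unfolding cw(2)[OF t, symmetric]
        using inj_on_image_mem_iff[OF bij_betw_imp_inj_on[OF c'bij], of "w t" "B \<inter> {0..l'}"] cw(1)[OF t]
        by auto
      then show ?thesis using M.chart_in_points[OF e] unfolding c_def l_def by auto
    qed
    finally show "closed (w -` B \<inter> {0..l})" .
  qed
  have loc: "\<exists>r>0. \<forall>t\<in>{0..l}. t \<noteq> s \<longrightarrow> \<bar>t - s\<bar> < r \<longrightarrow> \<bar>w t - w s\<bar> = \<bar>t - s\<bar>"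
    if s: "s \<in> {0..l}" "s \<noteq> \<infinity>" for s
  proof -
    obtain r1 where r1: "0 < r1"
      "\<And>t. t \<in> {0..l} \<Longrightarrow> t \<noteq> s \<Longrightarrow> min r1 \<bar>t - s\<bar> \<le> distance \<Gamma> (c s) (c t)"
      using M.distance_local[OF e] s unfolding c_def l_def by metis
    obtain r2 where r2: "0 < r2"
      "\<And>t. t \<in> {0..l'} \<Longrightarrow> t \<noteq> w s \<Longrightarrow> min r2 \<bar>t - w s\<bar> \<le> distance \<Gamma>' (c' (w s)) (c' t)"
      using N.distance_local[OF f] cw(1)[OF s(1)] unfolding c'_def l'_def by metis
    have "\<bar>w t - w s\<bar> = \<bar>t - s\<bar>" if t: "t \<in> {0..l}" "t \<noteq> s" "\<bar>t - s\<bar> < min r1 r2" for t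
    proof -
      have ne: "w t \<noteq> w s" using wbij t s unfolding bij_betw_def inj_on_def by blast
      have d: "distance \<Gamma>' (c' (w s)) (c' (w t)) = distance \<Gamma> (c s) (c t)"
        unfolding cw(2)[OF s(1)] cw(2)[OF t(1)]
        using iso cbij s t unfolding bij_betw_def by blast
      have "\<bar>t - s\<bar> \<le> distance \<Gamma> (c s) (c t)" using r1(2)[OF t(1,2)] t(3) by (auto simp: min_def split: if_splits)
      moreover have "distance \<Gamma> (c s) (c t) \<le> \<bar>t - s\<bar>"
        using M.distance_edge_le[OF e] s t unfolding c_def l_def by metis
      moreover have "min r2 \<bar>w t - w s\<bar> \<le> distance \<Gamma> (c s) (c t)"
        using r2(2)[OF cw(1)[OF t(1)] ne] d by simp
      moreover have "distance \<Gamma> (c s) (c t) \<le> \<bar>w t - w s\<bar>"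
        using N.distance_edge_le[OF f, of "w s" "w t"] cw(1) s t d unfolding c'_def l'_def by metis
      ultimately show ?thesis using t(3) by (auto simp: min_def split: if_splits)
    qed
    then show ?thesis using r1(1) r2(1) by (intro exI[of _ "min r1 r2"]) auto
  qed
  have "l' = l \<and> ((\<forall>t\<in>{0..l}. w t = t) \<or> l \<noteq> \<infinity> \<and> (\<forall>t\<in>{0..l}. w t = l - t))"
    using M.len_pos[OF e] N.len_pos[OF f] wcont wbij loc
    unfolding l_def l'_def by (intro local_isometry_interval)
  then show ?thesis using cw(2) unfolding l_def[symmetric] l'_def[symmetric] c_def[symmetric] c'_def[symmetric]
    by metis
qed

section \<open>Reversing edges\<close>

lemma openin_reflect_ereal_interval:
  fixes l :: ereal
  assumes l: "0 \<le> l" "l \<noteq> \<infinity>" and S: "openin (top_of_set {0..l}) S"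
  shows "openin (top_of_set {0..l}) {t \<in> {0..l}. l - t \<in> S}"
proof -
  have "continuous_on {0..l} (\<lambda>t. l - t)"
    using l by (intro continuous_on_diff_ereal continuous_intros) auto
  moreover have "(\<lambda>t. l - t) \<in> {0..l} \<rightarrow> {0..l}"
  proof
    fix t assume "t \<in> {0..l}"
    then show "l - t \<in> {0..l}" using l by (cases l; cases t) auto
  qed
  ultimately have "openin (top_of_set {0..l}) ({0..l} \<inter> (\<lambda>t. l - t) -` S)"
    using S by (rule continuous_openin_preimage)
  moreover have "{0..l} \<inter> (\<lambda>t. l - t) -` S = {t \<in> {0..l}. l - t \<in> S}" by auto
  ultimately show ?thesis by simp
qed

definition reverse_edges :: "'p set set \<Rightarrow> 'p model \<Rightarrow> 'p model" where
  "reverse_edges R M = M\<lparr>chart := \<lambda>e t. chart M e (if e \<in> R then len M e - t else t)\<rparr>"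

text \<open>The reflection \<open>t \<mapsto> l - t\<close> of the parameter interval is an isometric involution, so it turns
  the routes of either model into routes of the other.\<close>

lemma model_of_reverse_edges:
  assumes model: "model_of M \<Gamma>" and R: "\<And>e. e \<in> R \<Longrightarrow> e \<in> edges M \<Longrightarrow> len M e \<noteq> \<infinity>"
  shows "model_of (reverse_edges R M) \<Gamma>"
proof -
  define u where "u e t = (if e \<in> R then len M e - t else t)" for e t
  define N where "N = reverse_edges R M"
  have N: "verts N = verts M" "edges N = edges M" "ends N = ends M" "len N = len M"
    "chart N e t = chart M e (u e t)" for e t
    by (simp_all add: N_def reverse_edges_def u_def)
  have mg: "metric_graph M" using model_graph[OF model] .
  have lpos: "0 < len M e" if "e \<in> edges M" for e using mg that by (auto simp: metric_graph_def)
  have u_in: "u e t \<in> {0..len M e} \<longleftrightarrow> t \<in> {0..len M e}" and u_inv: "t \<in> {0..len M e} \<Longrightarrow> u e (u e t) = t"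
    and u_int: "u e t \<in> {0<..<len M e} \<longleftrightarrow> t \<in> {0<..<len M e}"
    if "e \<in> edges M" for e t
    using lpos[OF that] R[OF _ that] unfolding u_def by (cases "len M e"; cases t; auto)+
  have u_ends: "{#chart M e (u e 0), chart M e (u e (len M e))#} = {#chart M e 0, chart M e (len M e)#}"
    and u_infinite: "len M e = \<infinity> \<Longrightarrow> u e t = t"
    if "e \<in> edges M" for e t
    using lpos[OF that] R[OF _ that] unfolding u_def by (cases "len M e"; auto simp: add_mset_commute zero_ereal_def)+
  have u_img: "u e ` {0..len M e} = {0..len M e}" "u e ` {0<..<len M e} = {0<..<len M e}" if "e \<in> edges M" for e
  proof -
    show "u e ` {0..len M e} = {0..len M e}"
      using u_in[OF that] u_inv[OF that] by (metis (no_types, lifting) image_iff subsetI subset_antisym)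
    have "\<And>t. t \<in> {0<..<len M e} \<Longrightarrow> u e (u e t) = t"
      using u_inv[OF that] by (meson atLeastAtMost_iff greaterThanLessThan_iff less_imp_le)
    then show "u e ` {0<..<len M e} = {0<..<len M e}"
      using u_int[OF that] by (metis (no_types, lifting) image_iff subsetI subset_antisym)
  qed
  have u_dist: "\<bar>u e t - u e s\<bar> = \<bar>t - s\<bar>" if "e \<in> edges M" "t \<in> {0..len M e}" "s \<in> {0..len M e}" for e s t
    using lpos[OF that(1)] R[OF _ that(1)] that(2,3) unfolding u_def
    by (cases "len M e"; cases s; cases t) auto
  have chart_img: "chart N e ` {0..len M e} = chart M e ` {0..len M e}"
      "chart N e ` {0<..<len M e} = chart M e ` {0<..<len M e}" if "e \<in> edges M" for e
    using u_img[OF that] N(5) by (metis (mono_tags, lifting) image_cong image_image)+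
  have "metric_graph N"
    unfolding metric_graph_def
  proof (intro conjI ballI impI)
    have "finite_multigraph M" "connected_multigraph M" using mg unfolding metric_graph_def by blast+
    then show "finite_multigraph N" "connected_multigraph N"
      unfolding finite_multigraph_def connected_multigraph_def N .
    fix e assume "e \<in> edges N"
    then have e: "e \<in> edges M" by (simp add: N)
    have me: "0 < len M e" "chart M e ` {0..len M e} = e" "ends M e = {#chart M e 0, chart M e (len M e)#}"
        "inj_on (chart M e) {0<..<len M e}" "chart M e ` {0<..<len M e} \<inter> verts M = {}"
        "len M e = \<infinity> \<Longrightarrow> leaf_end M (chart M e \<infinity>)"
      using mg e unfolding metric_graph_def by blast+
    show "0 < len N e" "chart N e ` {0..len N e} = e" "chart N e ` {0<..<len N e} \<inter> verts N = {}"
      using me chart_img[OF e] N by auto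
    show "ends N e = {#chart N e 0, chart N e (len N e)#}" using me u_ends[OF e] N by simp
    show "inj_on (chart N e) {0<..<len N e}"
      unfolding N
    proof (rule inj_onI)
      fix s t assume st: "s \<in> {0<..<len M e}" "t \<in> {0<..<len M e}" "chart M e (u e s) = chart M e (u e t)"
      then have "u e s = u e t" using u_int[OF e] me(4) by (meson inj_onD)
      then show "s = t" using u_inv[OF e] st by (metis atLeastAtMost_iff greaterThanLessThan_iff less_imp_le)
    qed
    show "leaf_end N (chart N e \<infinity>)" if "len N e = \<infinity>"
      using me(6) u_infinite[OF e] that by (simp add: N leaf_end_def vertex_degree_def)
    show "chart N e ` {0<..<len N e} \<inter> chart N e' ` {0<..<len N e'} = {}"
      if "e' \<in> edges N" "e \<noteq> e'" for e'
    proof -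
      have e': "e' \<in> edges M" using that by (simp add: N)
      then have "chart M e ` {0<..<len M e} \<inter> chart M e' ` {0<..<len M e'} = {}"
        using mg e that unfolding metric_graph_def by blast
      then show ?thesis using chart_img[OF e] chart_img[OF e'] N by simp
    qed
  qed
  moreover have "openin (topo \<Gamma>) U \<longleftrightarrow> U \<subseteq> points \<Gamma> \<and>
      (\<forall>e\<in>edges N. openin (top_of_set {0..len N e}) {t \<in> {0..len N e}. chart N e t \<in> U})" for U
  proof -
    have "openin (top_of_set {0..len M e}) {t \<in> {0..len M e}. chart M e (u e t) \<in> U} \<longleftrightarrow>
        openin (top_of_set {0..len M e}) {t \<in> {0..len M e}. chart M e t \<in> U}" if e: "e \<in> edges M" for e
    proof (cases "e \<in> R")
      case True
      define S where "S = {t \<in> {0..len M e}. chart M e t \<in> U}"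
      define T where "T = {t \<in> {0..len M e}. chart M e (u e t) \<in> U}"
      have ue: "u e t = len M e - t" for t using True by (simp add: u_def)
      have "T = {t \<in> {0..len M e}. len M e - t \<in> S}" "S = {t \<in> {0..len M e}. len M e - t \<in> T}"
        unfolding S_def T_def ue[symmetric] using u_in[OF e] u_inv[OF e] by auto
      then have "openin (top_of_set {0..len M e}) T \<longleftrightarrow> openin (top_of_set {0..len M e}) S"
        using openin_reflect_ereal_interval[of "len M e"] lpos[OF e] R[OF True e]
        by (metis less_imp_le)
      then show ?thesis unfolding S_def T_def .
    qed (simp add: u_def)
    then show ?thesis unfolding model_openin[OF model, of U] N by blast
  qed
  moreover have "path_distance N x y = path_distance M x y" for x y
  proof -
    define U where "U = map (\<lambda>(e, s, t). (e, u e s, u e t))"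
    have 1: "route M x (U r) y \<and> route_length (U r) = route_length r" if "route N x r y" for r x
      using that
    proof (induction r arbitrary: x)
      case (Cons seg r)
      obtain e s t where "seg = (e, s, t)" by (cases seg)
      then show ?case using Cons u_in u_dist by (auto simp: N U_def route_length_Cons simp del: atLeastAtMost_iff)
    qed (simp_all add: U_def)
    have 2: "route N x (U r) y \<and> route_length (U r) = route_length r" if "route M x r y" for r x
      using that
    proof (induction r arbitrary: x)
      case (Cons seg r)
      obtain e s t where "seg = (e, s, t)" by (cases seg)
      then show ?case using Cons u_in u_inv u_dist by (auto simp: N U_def route_length_Cons simp del: atLeastAtMost_iff)
    qed (simp_all add: U_def)
    show ?thesis unfolding path_distance_def
      by (rule INF_eq) (use 1 2 in \<open>metis mem_Collect_eq order_refl\<close>)+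
  qed
  ultimately show ?thesis
    using model unfolding model_of_def N_def[symmetric] by (simp add: N)
qed

section \<open>Images of models\<close>

text \<open>The map \<open>\<psi>\<close> commutes with the charts. For \<open>N = M\<close> this says that \<open>\<psi>\<close> induces an automorphism of the
  model, and the group actions below are described in this form.\<close>

definition image_model :: "('p \<Rightarrow> 'q) \<Rightarrow> 'p model \<Rightarrow> 'q model \<Rightarrow> bool" where
  "image_model \<psi> M N \<longleftrightarrow> verts N = \<psi> ` verts M \<and> edges N = (`) \<psi> ` edges M \<and>
     (\<forall>e\<in>edges M. len N (\<psi> ` e) = len M e \<and>
        (\<forall>t\<in>{0..len M e}. chart N (\<psi> ` e) t = \<psi> (chart M e t)))"

text \<open>Here \<open>A\<close> is the set of the maps by which a group acts. The distance in the quotient is the distance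
  to an orbit. No model occurs, so quotient maps that arise from different models can be compared.\<close>

definition quotient_by ::
  "('p \<Rightarrow> 'p) set \<Rightarrow> 'p curve \<Rightarrow> 'q curve \<Rightarrow> ('p \<Rightarrow> 'q) \<Rightarrow> bool" where
  "quotient_by A \<Gamma> \<Gamma>' \<psi> \<longleftrightarrow> points \<Gamma>' = \<psi> ` points \<Gamma> \<and>
     (\<forall>x\<in>points \<Gamma>. \<forall>y\<in>points \<Gamma>. \<psi> x = \<psi> y \<longleftrightarrow> (\<exists>a\<in>A. y = a x)) \<and>
     (\<forall>U. openin (topo \<Gamma>') U \<longleftrightarrow> U \<subseteq> points \<Gamma>' \<and> openin (topo \<Gamma>) {x \<in> points \<Gamma>. \<psi> x \<in> U}) \<and>
     (\<forall>x\<in>points \<Gamma>. \<forall>y\<in>points \<Gamma>. distance \<Gamma>' (\<psi> x) (\<psi> y) =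
        (INF y'\<in>{y'\<in>points \<Gamma>. \<psi> y' = \<psi> y}. distance \<Gamma> x y'))"

lemma image_modelD:
  assumes "image_model \<psi> M N"
  shows "verts N = \<psi> ` verts M" "edges N = (`) \<psi> ` edges M"
    and "e \<in> edges M \<Longrightarrow> \<psi> ` e \<in> edges N"
    and "e \<in> edges M \<Longrightarrow> len N (\<psi> ` e) = len M e"
    and "e \<in> edges M \<Longrightarrow> t \<in> {0..len M e} \<Longrightarrow> chart N (\<psi> ` e) t = \<psi> (chart M e t)"
  using assms by (auto simp: image_model_def)

lemma route_image:
  assumes "image_model \<psi> M N" and "route M x r y"
  shows "\<exists>r'. route N (\<psi> x) r' (\<psi> y) \<and> route_length r' = route_length r"
  using assms(2)
proof (induction r arbitrary: x)
  case Nil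
  then show ?case by (auto intro!: exI[of _ "[]"] simp: route_length_def)
next
  case (Cons seg r)
  obtain e s t where seg: "seg = (e, s, t)" by (cases seg)
  then obtain r' where "route N (\<psi> (chart M e t)) r' (\<psi> y)" "route_length r' = route_length r"
    using Cons by auto
  then show ?case using Cons.prems image_modelD[OF assms(1)] seg
    by (intro exI[of _ "(\<psi> ` e, s, t) # r'"]) (auto simp: route_length_Cons)
qed

locale model_quotient = loopless_model M \<Gamma> for M :: "'p model" and \<Gamma> +
  fixes A :: "('p \<Rightarrow> 'p) set" and \<psi> :: "'p \<Rightarrow> 'q"
  assumes automorphism: "a \<in> A \<Longrightarrow> image_model a M M"
    and fibres: "x \<in> points \<Gamma> \<Longrightarrow> y \<in> points \<Gamma> \<Longrightarrow> \<psi> x = \<psi> y \<longleftrightarrow> (\<exists>a\<in>A. y = a x)"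
begin

lemma aut_edge: "a \<in> A \<Longrightarrow> e \<in> edges M \<Longrightarrow> a ` e \<in> edges M"
  and aut_len: "a \<in> A \<Longrightarrow> e \<in> edges M \<Longrightarrow> len M (a ` e) = len M e"
  and aut_chart: "a \<in> A \<Longrightarrow> e \<in> edges M \<Longrightarrow> t \<in> {0..len M e} \<Longrightarrow>
    a (chart M e t) = chart M (a ` e) t"
  and aut_vert: "a \<in> A \<Longrightarrow> v \<in> verts M \<Longrightarrow> a v \<in> verts M"
  using image_modelD[OF automorphism] by auto

lemma aut_point: "a \<in> A \<Longrightarrow> x \<in> points \<Gamma> \<Longrightarrow> a x \<in> points \<Gamma>"
  using aut_edge aut_vert unfolding points_eq by blast

lemma aut_invariant: "a \<in> A \<Longrightarrow> x \<in> points \<Gamma> \<Longrightarrow> \<psi> (a x) = \<psi> x"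
  using fibres[of x "a x"] aut_point by metis

text \<open>A segment has a lift from any point above its start: lift it to some edge above its edge, and move
  the lift by an automorphism.\<close>

lemma route_lift:
  assumes im: "image_model \<psi> M N" and "route N (\<psi> x) r z" "x \<in> points \<Gamma>"
  shows "\<exists>r' y. route M x r' y \<and> route_length r' = route_length r \<and> y \<in> points \<Gamma> \<and> \<psi> y = z"
  using assms(2,3)
proof (induction r arbitrary: x)
  case Nil
  then show ?case by (auto intro!: exI[of _ "[]"] simp: route_length_def)
next
  case (Cons seg r)
  obtain f s t where seg: "seg = (f, s, t)" by (cases seg)
  then have "f \<in> edges N" using Cons by simp
  then obtain e where e: "e \<in> edges M" "f = \<psi> ` e" using image_modelD(2)[OF im] by blast
  have st: "s \<in> {0..len M e}" "t \<in> {0..len M e}" "\<psi> (chart M e s) = \<psi> x"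
      "route N (\<psi> (chart M e t)) r z"
    using Cons.prems image_modelD[OF im] e seg by auto
  then obtain a where a: "a \<in> A" "x = a (chart M e s)"
    using fibres[of "chart M e s" x] chart_in_points[OF e(1)] Cons.prems(2) by metis
  have ae: "a ` e \<in> edges M" "len M (a ` e) = len M e" "chart M (a ` e) t = a (chart M e t)"
      "chart M (a ` e) s = a (chart M e s)"
    using aut_edge aut_len aut_chart a e st by auto
  have pt: "chart M e t \<in> points \<Gamma>" using chart_in_points e st by blast
  then have "\<psi> (a (chart M e t)) = \<psi> (chart M e t)" using aut_invariant a by blast
  then obtain r' y where "route M (a (chart M e t)) r' y" "route_length r' = route_length r"
      "y \<in> points \<Gamma>" "\<psi> y = z"
    using Cons.IH[of "a (chart M e t)"] st aut_point[OF a(1) pt] by auto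
  then show ?case using ae st a
    by (intro exI[of _ "(a ` e, s, t) # r'"] exI[of _ y]) (auto simp: seg route_length_Cons)
qed

text \<open>Routes from \<open>\<psi> x\<close> to \<open>\<psi> y\<close> are the images of routes of the same length from \<open>x\<close> to points of the
  orbit of \<open>y\<close>.\<close>

lemma path_distance_image:
  assumes im: "image_model \<psi> M N" and x: "x \<in> points \<Gamma>" and y: "y \<in> points \<Gamma>"
  shows "path_distance N (\<psi> x) (\<psi> y) = (INF y'\<in>{y'\<in>points \<Gamma>. \<psi> y' = \<psi> y}. distance \<Gamma> x y')"
proof (rule antisym)
  show "path_distance N (\<psi> x) (\<psi> y) \<le> (INF y'\<in>{y'\<in>points \<Gamma>. \<psi> y' = \<psi> y}. distance \<Gamma> x y')"
  proof (rule INF_greatest)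
    fix y' assume y': "y' \<in> {y' \<in> points \<Gamma>. \<psi> y' = \<psi> y}"
    have "path_distance N (\<psi> x) (\<psi> y) \<le> path_distance M x y'"
      unfolding path_distance_def[of M]
    proof (rule INF_greatest)
      fix r assume "r \<in> {r. route M x r y'}"
      then obtain r' where "route N (\<psi> x) r' (\<psi> y)" "route_length r' = route_length r"
        using route_image[OF im] y' by fastforce
      then show "path_distance N (\<psi> x) (\<psi> y) \<le> route_length r" using path_distance_le by metis
    qed
    then show "path_distance N (\<psi> x) (\<psi> y) \<le> distance \<Gamma> x y'" using distance_eq x y' by simp
  qed
  show "(INF y'\<in>{y'\<in>points \<Gamma>. \<psi> y' = \<psi> y}. distance \<Gamma> x y') \<le> path_distance N (\<psi> x) (\<psi> y)"
    unfolding path_distance_def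
  proof (rule INF_greatest)
    fix r assume "r \<in> {r. route N (\<psi> x) r (\<psi> y)}"
    then obtain r' y' where r': "route M x r' y'" "route_length r' = route_length r"
        "y' \<in> points \<Gamma>" "\<psi> y' = \<psi> y"
      using route_lift[OF im _ x] by blast
    then have "(INF y'\<in>{y'\<in>points \<Gamma>. \<psi> y' = \<psi> y}. distance \<Gamma> x y') \<le> distance \<Gamma> x y'"
      by (intro INF_lower) auto
    also have "\<dots> \<le> route_length r" using path_distance_le[OF r'(1)] distance_eq x r' by simp
    finally show "(INF y'\<in>{y'\<in>points \<Gamma>. \<psi> y' = \<psi> y}. distance \<Gamma> x y') \<le> route_length r" .
  qed
qed

lemma image_model_openin:
  assumes im: "image_model \<psi> M N" and U: "U \<subseteq> \<psi> ` points \<Gamma>"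
  shows "openin (topo \<Gamma>) {x \<in> points \<Gamma>. \<psi> x \<in> U} \<longleftrightarrow>
    (\<forall>f\<in>edges N. openin (top_of_set {0..len N f}) {t \<in> {0..len N f}. chart N f t \<in> U})"
proof -
  have "{t \<in> {0..len N (\<psi> ` e)}. chart N (\<psi> ` e) t \<in> U} =
      {t \<in> {0..len M e}. chart M e t \<in> {x \<in> points \<Gamma>. \<psi> x \<in> U}}" if "e \<in> edges M" for e
    using image_modelD[OF im] chart_in_points that by auto
  then show ?thesis
    unfolding openin_iff[of "{x \<in> points \<Gamma>. \<psi> x \<in> U}"] image_modelD(2)[OF im]
    using image_modelD(4)[OF im] by auto
qed

lemma quotient_by_if_image_model:
  assumes im: "image_model \<psi> M N" and N: "model_of N \<Gamma>'"
  shows "quotient_by A \<Gamma> \<Gamma>' \<psi>"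
proof -
  have pts: "points \<Gamma>' = \<psi> ` points \<Gamma>"
    unfolding points_eq model_points[OF N] image_modelD(1,2)[OF im] by auto
  show ?thesis unfolding quotient_by_def
  proof (intro conjI ballI allI)
    show "openin (topo \<Gamma>') U \<longleftrightarrow> U \<subseteq> points \<Gamma>' \<and> openin (topo \<Gamma>) {x \<in> points \<Gamma>. \<psi> x \<in> U}" for U
      using model_openin[OF N, of U] image_model_openin[OF im, of U] pts by auto
    show "distance \<Gamma>' (\<psi> x) (\<psi> y) = (INF y'\<in>{y'\<in>points \<Gamma>. \<psi> y' = \<psi> y}. distance \<Gamma> x y')"
      if "x \<in> points \<Gamma>" "y \<in> points \<Gamma>" for x y
      using path_distance_image[OF im that] model_distance[OF N] that pts by auto
  qed (use pts fibres in auto)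
qed

end

section \<open>The quotient of a model\<close>

text \<open>If \<open>\<psi>\<close> folded an edge or identified its ends, then the image of the edge would not be an edge of a
  loopless model.\<close>

locale injective_model_quotient = model_quotient +
  assumes inj: "e \<in> edges M \<Longrightarrow> inj_on \<psi> e"
begin

lemma aut_interior_meet:
  assumes "a \<in> A" "e \<in> edges M" "e' \<in> edges M" "0 < t" "t < len M e" "a (chart M e t) \<in> e'"
  shows "e' = a ` e"
proof (rule ccontr)
  assume ne: "e' \<noteq> a ` e"
  have t: "t \<in> {0..len M e}" using assms by auto
  have ae: "a ` e \<in> edges M" using aut_edge assms by blast
  have c: "a (chart M e t) = chart M (a ` e) t" using aut_chart[OF assms(1,2) t] .
  have "a (chart M e t) \<in> a ` e" using chart_in[OF assms(2) t] by blast
  then have "chart M (a ` e) t \<in> verts M"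
    using edges_meet_in_vert[OF assms(3) ae ne assms(6)] c by simp
  then show False using interior_not_vert[OF ae, of t] aut_len[OF assms(1,2)] assms by simp
qed

lemma edge_interiorE:
  assumes "e \<in> edges M" obtains t where "0 < t" "t < len M e"
  using dense len_pos[OF assms] by blast

text \<open>An interior point of \<open>e\<close> has a translate in \<open>e'\<close>, and a translate of an interior point lies on no
  other edge than the translate of \<open>e\<close>.\<close>

lemma edge_orbit:
  assumes e: "e \<in> edges M" "e' \<in> edges M" and eq: "\<psi> ` e = \<psi> ` e'"
  shows "\<exists>a\<in>A. e' = a ` e"
proof -
  obtain t where t: "0 < t" "t < len M e" using edge_interiorE[OF e(1)] .
  then have t': "t \<in> {0..len M e}" by auto
  then obtain z where z: "z \<in> e'" "\<psi> (chart M e t) = \<psi> z" using eq chart_in[OF e(1)] by blast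
  then obtain a where "a \<in> A" "z = a (chart M e t)"
    using fibres chart_in_points[OF e(1) t'] edge_subset_points[OF e(2)] by blast
  then show ?thesis using aut_interior_meet[OF _ e t] z by blast
qed

definition edge_rep :: "'b set \<Rightarrow> 'a set" where
  "edge_rep f = (SOME e. e \<in> edges M \<and> \<psi> ` e = f)"

text \<open>The edges of one orbit have the same length, and their charts become equal after composition with
  \<open>\<psi>\<close>; so the choice of a representative is immaterial.\<close>

definition quotient_model :: "'b model" where
  "quotient_model = \<lparr>verts = \<psi> ` verts M, edges = (`) \<psi> ` edges M,
     ends = \<lambda>f. image_mset \<psi> (ends M (edge_rep f)), len = \<lambda>f. len M (edge_rep f),
     chart = \<lambda>f t. \<psi> (chart M (edge_rep f) t)\<rparr>"

lemma edge_rep: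
  assumes e: "e \<in> edges M"
  obtains a where "a \<in> A" "edge_rep (\<psi> ` e) = a ` e" "edge_rep (\<psi> ` e) \<in> edges M"
proof -
  have "edge_rep (\<psi> ` e) \<in> edges M \<and> \<psi> ` edge_rep (\<psi> ` e) = \<psi> ` e"
    unfolding edge_rep_def using someI[of "\<lambda>e'. e' \<in> edges M \<and> \<psi> ` e' = \<psi> ` e" e] e by blast
  then show thesis using edge_orbit[OF e] that by metis
qed

lemma image_model_quotient_model: "image_model \<psi> M quotient_model"
proof -
  have "len quotient_model (\<psi> ` e) = len M e \<and>
      (\<forall>t\<in>{0..len M e}. chart quotient_model (\<psi> ` e) t = \<psi> (chart M e t))"
    if e: "e \<in> edges M" for e
  proof -
    obtain a where a: "a \<in> A" "edge_rep (\<psi> ` e) = a ` e" using edge_rep[OF e] .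
    have "\<psi> (chart M (a ` e) t) = \<psi> (chart M e t)" if "t \<in> {0..len M e}" for t
      using aut_chart[OF a(1) e that] aut_invariant[OF a(1) chart_in_points[OF e that]] by simp
    then show ?thesis using a aut_len[OF a(1) e] by (simp add: quotient_model_def)
  qed
  then show ?thesis by (simp add: image_model_def quotient_model_def)
qed

lemmas qm = image_modelD[OF image_model_quotient_model]

lemma ends_quotient_model:
  assumes e: "e \<in> edges M"
  shows "ends quotient_model (\<psi> ` e) = {#\<psi> (chart M e 0), \<psi> (chart M e (len M e))#}"
    and "ends quotient_model (\<psi> ` e) = image_mset \<psi> (ends M e)"
proof -
  obtain a where a: "a \<in> A" "edge_rep (\<psi> ` e) = a ` e" "edge_rep (\<psi> ` e) \<in> edges M"
    using edge_rep[OF e] .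
  have l: "0 \<in> {0..len M e}" "len M e \<in> {0..len M e}" using len_pos[OF e] by auto
  have "\<psi> (chart M (a ` e) t) = \<psi> (chart M e t)" if "t \<in> {0..len M e}" for t
    using aut_chart[OF a(1) e that] aut_invariant[OF a(1) chart_in_points[OF e that]] by simp
  then show 1: "ends quotient_model (\<psi> ` e) = {#\<psi> (chart M e 0), \<psi> (chart M e (len M e))#}"
    using a ends_eq[OF a(3)] aut_len[OF a(1) e] l by (simp add: quotient_model_def)
  then show "ends quotient_model (\<psi> ` e) = image_mset \<psi> (ends M e)" using ends_eq[OF e] by simp
qed

lemma ends_distinct: "e \<in> edges M \<Longrightarrow> \<psi> (chart M e 0) \<noteq> \<psi> (chart M e (len M e))"
  using inj_on_eq_iff[OF inj, of e "chart M e 0" "chart M e (len M e)"] chart_in[of e]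
    chart_eq_iff[of e 0 "len M e"] len_pos[of e] by auto

lemma connected_quotient_model: "connected_multigraph quotient_model"
proof -
  let ?R = "\<lambda>M. {(a, b). \<exists>e\<in>edges M. ends M e = {#a, b#}}"
  have R_step: "(\<psi> u, \<psi> v) \<in> ?R quotient_model" if uv: "(u, v) \<in> ?R M" for u v
  proof -
    from uv obtain e where "e \<in> edges M" "ends M e = {#u, v#}" by blast
    then have "\<psi> ` e \<in> edges quotient_model" "ends quotient_model (\<psi> ` e) = {#\<psi> u, \<psi> v#}"
      using ends_quotient_model(2) qm(3) by simp_all
    then show ?thesis by blast
  qed
  have "(\<psi> u, \<psi> v) \<in> (?R quotient_model)\<^sup>*" if "(u, v) \<in> (?R M)\<^sup>*" for u v
    using that
  proof induction
    case (step v w)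
    then show ?case using rtrancl_into_rtrancl[OF step.IH \<open>(v, w) \<in> ?R M\<close>[THEN R_step]] by blast
  qed blast
  moreover have "\<forall>u\<in>verts M. \<forall>v\<in>verts M. (u, v) \<in> (?R M)\<^sup>*"
    using graph unfolding metric_graph_def connected_multigraph_def by (elim conjE)
  ultimately have "\<forall>u\<in>verts M. \<forall>v\<in>verts M. (\<psi> u, \<psi> v) \<in> (?R quotient_model)\<^sup>*" by simp
  then show ?thesis
    unfolding connected_multigraph_def qm(1) ball_simps using verts_nonempty by simp
qed

text \<open>An edge at the image of \<open>v\<close> is the image of an edge at a translate of \<open>v\<close>, hence also of an edge at
  \<open>v\<close> itself. If \<open>v\<close> is a leaf end then there is only one.\<close>

lemma leaf_end_quotient_model:
  assumes e: "e \<in> edges M" and leaf: "leaf_end M (chart M e (len M e))"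
  shows "leaf_end quotient_model (\<psi> (chart M e (len M e)))"
proof -
  define v where "v = chart M e (len M e)"
  have ev: "count (ends M e) v \<noteq> 0" unfolding v_def using ends_eq[OF e] by simp
  have "e' = e" if "e' \<in> edges M" "v \<in># ends M e'" for e'
  proof (rule ccontr)
    assume ne: "e' \<noteq> e"
    have "(\<Sum>e\<in>{e, e'}. count (ends M e) v) \<le> vertex_degree M v"
      unfolding vertex_degree_def using finite_edges e that by (intro sum_mono2) auto
    moreover have "count (ends M e') v \<noteq> 0" using that by simp
    ultimately show False using leaf ev ne unfolding leaf_end_def v_def[symmetric] by simp
  qed
  note unique = this
  have only: "f = \<psi> ` e" if f: "f \<in> edges quotient_model" "\<psi> v \<in># ends quotient_model f" for f
  proof -
    obtain e' where e': "e' \<in> edges M" "f = \<psi> ` e'" using f(1) qm(2) by blast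
    then obtain u where u: "u \<in># ends M e'" "\<psi> u = \<psi> v" using f(2) ends_quotient_model(2) by auto
    have "u \<in> points \<Gamma>" "v \<in> points \<Gamma>"
      using u(1) ends_eq[OF e'(1)] end_verts[OF e'(1)] end_verts[OF e] points_eq unfolding v_def by auto
    then obtain a where a: "a \<in> A" "v = a u" using fibres u(2) by blast
    have l: "0 \<in> {0..len M e'}" "len M e' \<in> {0..len M e'}" using len_pos[OF e'(1)] by auto
    have "v \<in># ends M (a ` e')"
      using u(1) ends_eq[OF e'(1)] ends_eq[OF aut_edge[OF a(1) e'(1)]] aut_len[OF a(1) e'(1)]
        aut_chart[OF a(1) e'(1)] l a(2) by auto
    then have "a ` e' = e" using unique aut_edge[OF a(1) e'(1)] by blast
    moreover have "\<psi> ` a ` e' = \<psi> ` e'"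
      unfolding image_image using aut_invariant[OF a(1)] edge_subset_points[OF e'(1)] by (intro image_cong) auto
    ultimately show ?thesis using e' by simp
  qed
  have "vertex_degree quotient_model (\<psi> v) = (\<Sum>f\<in>{\<psi> ` e}. count (ends quotient_model f) (\<psi> v))"
    unfolding vertex_degree_def
  proof (rule sum.mono_neutral_right)
    show "finite (edges quotient_model)" using finite_edges qm(2) by simp
    show "\<forall>f\<in>edges quotient_model - {\<psi> ` e}. count (ends quotient_model f) (\<psi> v) = 0"
      using only by (auto simp: count_eq_zero_iff)
  qed (use e qm in auto)
  also have "\<dots> = 1" using ends_quotient_model(1)[OF e] ends_distinct[OF e] unfolding v_def by simp
  finally show ?thesis
    using end_verts[OF e] qm(1) unfolding leaf_end_def v_def by blast
qed

lemma loopless_quotient_model: "loopless quotient_model"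
  unfolding loopless_def qm(2)
  using ends_quotient_model(1) ends_distinct ends_distinct[symmetric]
  by (auto simp: add_mset_eq_single add_eq_conv_ex)

lemma metric_graph_quotient_model: "metric_graph quotient_model"
  unfolding metric_graph_def
proof (intro conjI ballI impI)
  show "finite_multigraph quotient_model"
    unfolding finite_multigraph_def qm(1,2)
    using finite_edges finite_verts ends_quotient_model(1) end_verts by auto
  show "connected_multigraph quotient_model" by (rule connected_quotient_model)
  fix f assume "f \<in> edges quotient_model"
  then obtain e where e: "e \<in> edges M" and f: "f = \<psi> ` e" using qm(2) by blast
  have lf: "len quotient_model f = len M e" using qm(4)[OF e] f by simp
  have cf: "chart quotient_model f ` T = \<psi> ` chart M e ` T" if "T \<subseteq> {0..len M e}" for T
    unfolding image_image f using that qm(5)[OF e] by (intro image_cong) auto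
  have l: "0 \<in> {0..len M e}" "len M e \<in> {0..len M e}" using len_pos[OF e] by auto
  have sub: "{0<..<len M e} \<subseteq> {0..len M e}" by auto
  show "0 < len quotient_model f" using len_pos[OF e] lf by simp
  show "chart quotient_model f ` {0..len quotient_model f} = f"
    using cf chart_image[OF e] lf f by simp
  show "ends quotient_model f = {#chart quotient_model f 0, chart quotient_model f (len quotient_model f)#}"
    using ends_quotient_model(1)[OF e] qm(5)[OF e l(1)] qm(5)[OF e l(2)] lf f by simp
  have "inj_on (\<lambda>t. \<psi> (chart M e t)) {0..len M e}"
    using comp_inj_on[OF chart_inj[OF e]] inj[OF e] chart_image[OF e] by (simp add: comp_def)
  then show "inj_on (chart quotient_model f) {0<..<len quotient_model f}"
    unfolding lf using qm(5)[OF e] inj_on_cong[of "{0..len M e}" "chart quotient_model f" "\<lambda>t. \<psi> (chart M e t)"] f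
    by (metis inj_on_subset sub)
  show "chart quotient_model f ` {0<..<len quotient_model f} \<inter> verts quotient_model = {}"
    unfolding lf cf[OF sub] qm(1)
  proof (rule equals0I)
    fix y assume "y \<in> \<psi> ` chart M e ` {0<..<len M e} \<inter> \<psi> ` verts M"
    then obtain t v where tv: "0 < t" "t < len M e" "v \<in> verts M" "\<psi> (chart M e t) = \<psi> v" by auto
    then have t: "t \<in> {0..len M e}" by auto
    then obtain a where a: "a \<in> A" "v = a (chart M e t)"
      using fibres chart_in_points[OF e t] tv(3,4) points_eq by blast
    then show False
      using interior_not_vert[OF aut_edge[OF a(1) e], of t] aut_chart[OF a(1) e t]
        aut_len[OF a(1) e] tv by simp
  qed
  show "leaf_end quotient_model (chart quotient_model f \<infinity>)" if "len quotient_model f = \<infinity>"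
  proof -
    have "len M e = \<infinity>" using that lf by simp
    then have "leaf_end M (chart M e (len M e))" using graph e unfolding metric_graph_def by metis
    then show ?thesis using leaf_end_quotient_model[OF e] qm(5)[OF e l(2)] f \<open>len M e = \<infinity>\<close> by simp
  qed
  show "chart quotient_model f ` {0<..<len quotient_model f} \<inter>
      chart quotient_model f' ` {0<..<len quotient_model f'} = {}"
    if "f' \<in> edges quotient_model" "f \<noteq> f'" for f'
  proof (rule equals0I)
    from that(1) obtain e' where e': "e' \<in> edges M" and f': "f' = \<psi> ` e'"
      unfolding qm(2) by (elim imageE)
    fix y assume "y \<in> chart quotient_model f ` {0<..<len quotient_model f} \<inter>
      chart quotient_model f' ` {0<..<len quotient_model f'}"
    then obtain s t where "s \<in> {0<..<len M e}" "t \<in> {0<..<len M e'}"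
        "y = chart quotient_model f s" "y = chart quotient_model f' t"
      unfolding lf f' qm(4)[OF e'] by (elim IntE imageE)
    then have st: "0 < s" "s < len M e" "0 < t" "t < len M e'"
        "chart quotient_model f s = chart quotient_model f' t" by simp_all
    have st': "s \<in> {0..len M e}" "t \<in> {0..len M e'}" using st by auto
    have "\<psi> (chart M e s) = \<psi> (chart M e' t)"
      using st(5) qm(5)[OF e st'(1)] qm(5)[OF e' st'(2)] f f' by simp
    then obtain a where a: "a \<in> A" "chart M e' t = a (chart M e s)"
      using fibres chart_in_points[OF e st'(1)] chart_in_points[OF e' st'(2)] by blast
    then have "e' = a ` e"
      using aut_interior_meet[OF a(1) e e' st(1,2)] chart_in[OF e' st'(2)] by simp
    moreover have "\<psi> ` a ` e = \<psi> ` e"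
      unfolding image_image using aut_invariant[OF a(1)] edge_subset_points[OF e] by (intro image_cong) auto
    ultimately show False using that f f' by simp
  qed
qed

lemma model_of_quotient_model:
  assumes q: "quotient_by A \<Gamma> \<Gamma>' \<psi>"
  shows "model_of quotient_model \<Gamma>'"
  unfolding model_of_def
proof (intro conjI ballI allI)
  have pts: "points \<Gamma>' = \<psi> ` points \<Gamma>" using q by (simp add: quotient_by_def)
  show "metric_graph quotient_model" by (rule metric_graph_quotient_model)
  show "points \<Gamma>' = verts quotient_model \<union> \<Union> (edges quotient_model)"
    unfolding pts qm(1,2) points_eq by auto
  show "openin (topo \<Gamma>') U \<longleftrightarrow> U \<subseteq> points \<Gamma>' \<and> (\<forall>f\<in>edges quotient_model.
      openin (top_of_set {0..len quotient_model f}) {t \<in> {0..len quotient_model f}. chart quotient_model f t \<in> U})" for U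
    using q image_model_openin[OF image_model_quotient_model, of U] pts unfolding quotient_by_def by auto
  fix x y assume xy: "x \<in> points \<Gamma>'" "y \<in> points \<Gamma>'"
  then obtain x' y' where xy': "x' \<in> points \<Gamma>" "y' \<in> points \<Gamma>" "x = \<psi> x'" "y = \<psi> y'"
    using pts by blast
  then have "distance \<Gamma>' x y = (INF y''\<in>{y''\<in>points \<Gamma>. \<psi> y'' = \<psi> y'}. distance \<Gamma> x' y'')"
    using q unfolding quotient_by_def by blast
  also have "\<dots> = path_distance quotient_model x y"
    using path_distance_image[OF image_model_quotient_model xy'(1,2)] xy' by simp
  finally show "distance \<Gamma>' x y = path_distance quotient_model x y" .
qed

end

section \<open>Finite harmonic morphisms of positive degree\<close>

lemma (in loopless_graph) isolated_vertex:
  assumes v: "v \<in> verts M" and no: "\<And>e. e \<in> edges M \<Longrightarrow> v \<notin> e"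
  shows "verts M = {v}"
proof -
  have "u = v" if "(v, u) \<in> {(a, b). \<exists>e\<in>edges M. ends M e = {#a, b#}}\<^sup>*" for u
    using that
  proof (cases rule: converse_rtranclE)
    case (step w)
    then obtain e where e: "e \<in> edges M" "ends M e = {#v, w#}" by blast
    then have "v \<in># ends M e" by simp
    then have "v = chart M e 0 \<or> v = chart M e (len M e)" using ends_eq[OF e(1)] by simp
    then have "v \<in> e" using chart_in[OF e(1), of 0] chart_in[OF e(1), of "len M e"] len_pos[OF e(1)] by auto
    then show ?thesis using no e(1) by blast
  qed simp
  moreover have "\<forall>u\<in>verts M. \<forall>v\<in>verts M. (u, v) \<in> {(a, b). \<exists>e\<in>edges M. ends M e = {#a, b#}}\<^sup>*"
    using graph unfolding metric_graph_def connected_multigraph_def by (elim conjE)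
  ultimately show ?thesis using v by blast
qed

text \<open>A positive degree makes the morphism surjective: a sum that equals \<open>d\<close> is not empty.\<close>

locale harmonic_morphism =
  fixes \<Gamma> :: "'p curve" and \<Gamma>' :: "'q curve" and \<psi> :: "'p \<Rightarrow> 'q"
    and M :: "'p model" and N :: "'q model" and D :: "'p set \<Rightarrow> nat" and m :: "'p \<Rightarrow> nat" and d :: nat
  assumes morphism: "finite_morphism_wrt \<Gamma> \<Gamma>' \<psi> M N D"
    and harmonic: "harmonic_wrt \<psi> M N D m"
    and degree: "v' \<in> verts N \<Longrightarrow> (\<Sum>v | v \<in> verts M \<and> \<psi> v = v'. m v) = d"
    and degree_pos: "0 < d"
begin

lemma continuous: "continuous_map (topo \<Gamma>) (topo \<Gamma>') \<psi>"
  and vert_vert: "v \<in> verts M \<Longrightarrow> \<psi> v \<in> verts N"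
  and edge_edge: "e \<in> edges M \<Longrightarrow> \<psi> ` e \<in> edges N"
  and D_pos: "e \<in> edges M \<Longrightarrow> D e > 0"
  and dilation: "e \<in> edges M \<Longrightarrow> x \<in> e \<Longrightarrow> y \<in> e \<Longrightarrow>
    distance \<Gamma>' (\<psi> x) (\<psi> y) = ereal (D e) * distance \<Gamma> x y"
  using morphism unfolding finite_morphism_wrt_def by blast+

sublocale M: loopless_model M \<Gamma>
  using morphism model_graph unfolding finite_morphism_wrt_def by unfold_locales blast+

sublocale N: loopless_model N \<Gamma>'
  using morphism model_graph unfolding finite_morphism_wrt_def by unfold_locales blast+

lemma inj: assumes e: "e \<in> edges M" shows "inj_on \<psi> e"
proof (rule inj_onI, rule ccontr)
  fix x y assume xy: "x \<in> e" "y \<in> e" "\<psi> x = \<psi> y" "x \<noteq> y"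
  have "distance \<Gamma>' (\<psi> x) (\<psi> y) = 0"
    using N.distance_self[of "\<psi> x"] N.edge_subset_points[OF edge_edge[OF e]] xy by auto
  moreover have "0 < ereal (D e) * distance \<Gamma> x y"
    using M.distance_edge_pos[OF e xy(1,2,4)] D_pos[OF e] by (simp add: ereal_zero_less_0_iff)
  ultimately show False using dilation[OF e xy(1,2)] by (metis less_irrefl)
qed

text \<open>Vertices go to vertices, and \<open>\<psi>\<close> is injective on \<open>e\<close>; thus the ends of \<open>e\<close> use up both ends of the
  image edge, and no interior point of \<open>e\<close> can be mapped to a vertex.\<close>

lemma ends_cover:
  assumes e: "e \<in> edges M"
  shows "{\<psi> (chart M e 0), \<psi> (chart M e (len M e))} = {chart N (\<psi> ` e) 0, chart N (\<psi> ` e) (len N (\<psi> ` e))}"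
proof -
  define a b where "a = chart N (\<psi> ` e) 0" and "b = chart N (\<psi> ` e) (len N (\<psi> ` e))"
  have l: "0 \<in> {0..len M e}" "len M e \<in> {0..len M e}" using M.len_pos[OF e] by auto
  have "y \<in> {a, b}" if y: "y \<in> \<psi> ` e" "y \<in> verts N" for y
  proof -
    obtain t where "t \<in> {0..len N (\<psi> ` e)}" "y = chart N (\<psi> ` e) t"
      using N.in_edgeE[OF edge_edge[OF e] y(1)] .
    then show ?thesis using N.vert_iff[OF edge_edge[OF e], of t] y(2) unfolding a_def b_def by auto
  qed
  then have "{\<psi> (chart M e 0), \<psi> (chart M e (len M e))} \<subseteq> {a, b}"
    using vert_vert M.end_verts[OF e] M.chart_in[OF e l(1)] M.chart_in[OF e l(2)] by blast
  moreover have "\<psi> (chart M e 0) \<noteq> \<psi> (chart M e (len M e))"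
    using inj_on_eq_iff[OF inj[OF e] M.chart_in[OF e l(1)] M.chart_in[OF e l(2)]]
      M.chart_eq_iff[OF e l] M.len_pos[OF e] by auto
  ultimately show ?thesis unfolding a_def[symmetric] b_def[symmetric] by auto
qed

lemma vert_iff_edge:
  assumes e: "e \<in> edges M" and x: "x \<in> e"
  shows "\<psi> x \<in> verts N \<longleftrightarrow> x \<in> verts M"
proof
  assume v: "\<psi> x \<in> verts N"
  have l: "0 \<in> {0..len M e}" "len M e \<in> {0..len M e}" using M.len_pos[OF e] by auto
  obtain t where t: "t \<in> {0..len N (\<psi> ` e)}" "\<psi> x = chart N (\<psi> ` e) t"
    using N.in_edgeE[OF edge_edge[OF e] imageI[OF x]] .
  then have "t = 0 \<or> t = len N (\<psi> ` e)" using N.vert_iff[OF edge_edge[OF e] t(1)] v by simp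
  then have "\<psi> x \<in> {chart N (\<psi> ` e) 0, chart N (\<psi> ` e) (len N (\<psi> ` e))}" using t(2) by auto
  then have "\<psi> x = \<psi> (chart M e 0) \<or> \<psi> x = \<psi> (chart M e (len M e))"
    unfolding ends_cover[OF e, symmetric] by blast
  then have "x = chart M e 0 \<or> x = chart M e (len M e)"
    using inj_on_eq_iff[OF inj[OF e] x M.chart_in[OF e l(1)]]
      inj_on_eq_iff[OF inj[OF e] x M.chart_in[OF e l(2)]] by blast
  then show "x \<in> verts M" using M.end_verts[OF e] by blast
qed (rule vert_vert)

lemma vert_iff: "x \<in> points \<Gamma> \<Longrightarrow> \<psi> x \<in> verts N \<longleftrightarrow> x \<in> verts M"
  unfolding M.points_eq using vert_iff_edge vert_vert by blast

lemma finite_over: "finite {e \<in> edges M. \<psi> ` e = f}"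
  using M.finite_edges by simp

text \<open>Add the local degrees of the vertices above one end of \<open>f\<close>. Each edge above \<open>f\<close> has exactly one end
  there, so its dilation factor is counted once.\<close>

lemma sum_edge_degree:
  assumes f: "f \<in> edges N"
  shows "(\<Sum>e | e \<in> edges M \<and> \<psi> ` e = f. D e) = d"
proof -
  define v' where "v' = chart N f 0"
  have v': "v' \<in> verts N" "v' \<in> f"
    unfolding v'_def using N.end_verts[OF f] N.chart_in[OF f, of 0] N.len_pos[OF f] by auto
  define A where "A = {v \<in> verts M. \<psi> v = v'}"
  define B where "B = {e \<in> edges M. \<psi> ` e = f}"
  have fin: "finite A" "finite B" unfolding A_def B_def using M.finite_verts M.finite_edges by auto
  have one: "card {v \<in> A. v \<in> e} = 1" if "e \<in> B" for e
  proof -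
    have e: "e \<in> edges M" "\<psi> ` e = f" using that by (auto simp: B_def)
    then obtain x where x: "x \<in> e" "\<psi> x = v'" using v' by blast
    have "{v \<in> A. v \<in> e} = {x}"
      using x vert_iff_edge[OF e(1) x(1)] v' inj_onD[OF inj[OF e(1)]] unfolding A_def by blast
    then show ?thesis by simp
  qed
  have "d = (\<Sum>v\<in>A. m v)" unfolding A_def using degree[OF v'(1)] by simp
  also have "\<dots> = (\<Sum>v\<in>A. \<Sum>e | e \<in> B \<and> v \<in> e. D e)"
  proof (rule sum.cong)
    fix v assume "v \<in> A"
    then have "(\<Sum>e | e \<in> edges M \<and> \<psi> ` e = f \<and> v \<in> e. D e) = m v"
      using harmonic f v'(2) unfolding harmonic_wrt_def A_def by blast
    then show "m v = (\<Sum>e | e \<in> B \<and> v \<in> e. D e)" unfolding B_def by (simp add: conj_assoc)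
  qed simp
  also have "\<dots> = (\<Sum>e\<in>B. \<Sum>v | v \<in> A \<and> v \<in> e. D e)"
    using fin by (rule sum.swap_restrict)
  also have "\<dots> = (\<Sum>e\<in>B. D e)" using one by (intro sum.cong) auto
  finally show ?thesis unfolding B_def by simp
qed

lemma edges_eq: "edges N = (`) \<psi> ` edges M"
proof
  show "edges N \<subseteq> (`) \<psi> ` edges M"
  proof
    fix f assume "f \<in> edges N"
    then have "(\<Sum>e | e \<in> edges M \<and> \<psi> ` e = f. D e) \<noteq> 0" using sum_edge_degree degree_pos by simp
    then have "{e \<in> edges M. \<psi> ` e = f} \<noteq> {}" by (metis sum.empty)
    then show "f \<in> (`) \<psi> ` edges M" by blast
  qed
qed (use edge_edge in blast)

lemma verts_eq: "verts N = \<psi> ` verts M"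
proof
  show "verts N \<subseteq> \<psi> ` verts M"
  proof
    fix v' assume "v' \<in> verts N"
    then have "(\<Sum>v | v \<in> verts M \<and> \<psi> v = v'. m v) \<noteq> 0" using degree degree_pos by simp
    then have "{v \<in> verts M. \<psi> v = v'} \<noteq> {}" by (metis sum.empty)
    then show "v' \<in> \<psi> ` verts M" by blast
  qed
qed (use vert_vert in blast)

lemma points_image: "points \<Gamma>' = \<psi> ` points \<Gamma>"
  unfolding N.points_eq M.points_eq edges_eq verts_eq by auto

lemma local_degree_pos:
  assumes v: "v \<in> verts M" and e: "e \<in> edges M" "v \<in> e"
  shows "0 < m v"
proof -
  have "(\<Sum>e2 | e2 \<in> edges M \<and> \<psi> ` e2 = \<psi> ` e \<and> v \<in> e2. D e2) = m v"
    using harmonic v edge_edge[OF e(1)] e(2) unfolding harmonic_wrt_def by blast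
  moreover have "D e \<le> (\<Sum>e2 | e2 \<in> edges M \<and> \<psi> ` e2 = \<psi> ` e \<and> v \<in> e2. D e2)"
    using e M.finite_edges by (intro member_le_sum) auto
  ultimately show ?thesis using D_pos[OF e(1)] by simp
qed

lemma edge_fibre_card_le:
  assumes f: "f \<in> edges N" and y: "y \<in> f" "y \<notin> verts N"
  shows "finite {x \<in> points \<Gamma>. \<psi> x = y} \<and> card {x \<in> points \<Gamma>. \<psi> x = y} \<le> card {e \<in> edges M. \<psi> ` e = f}"
proof -
  let ?B = "{e \<in> edges M. \<psi> ` e = f}"
  have "{x \<in> points \<Gamma>. \<psi> x = y} \<subseteq> (\<lambda>e. the_inv_into e \<psi> y) ` ?B"
  proof
    fix x assume x: "x \<in> {x \<in> points \<Gamma>. \<psi> x = y}"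
    then have "x \<notin> verts M" using y vert_vert by blast
    then obtain e where e: "e \<in> edges M" "x \<in> e" using x M.points_eq by auto
    then have "\<psi> ` e = f"
      using N.edges_meet_in_vert[OF edge_edge[OF e(1)] f, of y] x y by blast
    moreover have "the_inv_into e \<psi> y = x" using the_inv_into_f_f[OF inj[OF e(1)] e(2)] x by simp
    ultimately show "x \<in> (\<lambda>e. the_inv_into e \<psi> y) ` ?B" using e(1) by blast
  qed
  then show ?thesis
    using finite_over[of f] by (meson surj_card_le finite_surj)
qed

text \<open>Above a vertex, each point contributes a positive local degree to \<open>d\<close>. Above an interior point of an
  edge, there is at most one point on each edge, and each edge contributes a positive dilation
  factor to \<open>d\<close>.\<close>

lemma fibre_card_le:
  assumes "y \<in> points \<Gamma>'"
  shows "finite {x \<in> points \<Gamma>. \<psi> x = y} \<and> card {x \<in> points \<Gamma>. \<psi> x = y} \<le> d"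
proof (cases "y \<in> verts N")
  case True
  have eq: "{x \<in> points \<Gamma>. \<psi> x = y} = {v \<in> verts M. \<psi> v = y}"
    using vert_iff True M.points_eq by auto
  have fin: "finite {v \<in> verts M. \<psi> v = y}" using M.finite_verts by simp
  show ?thesis
  proof (cases "\<forall>v\<in>verts M. \<exists>e\<in>edges M. v \<in> e")
    case all: True
    have "card {v \<in> verts M. \<psi> v = y} = (\<Sum>v | v \<in> verts M \<and> \<psi> v = y. 1)" by simp
    also have "\<dots> \<le> (\<Sum>v | v \<in> verts M \<and> \<psi> v = y. m v)"
    proof (rule sum_mono)
      fix v assume "v \<in> {v \<in> verts M. \<psi> v = y}"
      then show "1 \<le> m v" using local_degree_pos all by (metis One_nat_def Suc_leI mem_Collect_eq)
    qed
    finally show ?thesis using degree[OF True] fin eq by simp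
  next
    case False
    then obtain v where "verts M = {v}" using M.isolated_vertex by blast
    then have "card {v \<in> verts M. \<psi> v = y} \<le> card {v}" by (intro card_mono) auto
    then show ?thesis using degree_pos fin eq by simp
  qed
next
  case False
  then obtain f where f: "f \<in> edges N" "y \<in> f" using assms N.points_eq by auto
  have "card {e \<in> edges M. \<psi> ` e = f} = (\<Sum>e | e \<in> edges M \<and> \<psi> ` e = f. 1)" by simp
  also have "\<dots> \<le> (\<Sum>e | e \<in> edges M \<and> \<psi> ` e = f. D e)"
    using D_pos by (intro sum_mono) (simp add: Suc_leI)
  also have "\<dots> = d" by (rule sum_edge_degree[OF f(1)])
  finally show ?thesis using edge_fibre_card_le[OF f False] by linarith
qed

lemma dilation_one:
  assumes f: "f \<in> edges N" and many: "d \<le> card {e \<in> edges M. \<psi> ` e = f}"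
    and e: "e \<in> edges M" "\<psi> ` e = f"
  shows "D e = 1"
proof (rule ccontr)
  assume "D e \<noteq> 1"
  then have "1 < D e" using D_pos[OF e(1)] by simp
  then have "(\<Sum>e | e \<in> edges M \<and> \<psi> ` e = f. 1) < (\<Sum>e | e \<in> edges M \<and> \<psi> ` e = f. D e)"
    using finite_over e D_pos by (intro sum_strict_mono_ex1) (auto simp: Suc_leI intro!: bexI[of _ e])
  then show False using many sum_edge_degree[OF f] by simp
qed

end

lemma has_degree_harmonic_morphism:
  assumes "has_degree \<Gamma> \<Gamma>' \<psi> d" "0 < d"
  obtains M N D m where "harmonic_morphism \<Gamma> \<Gamma>' \<psi> M N D m d"
  using assms unfolding has_degree_def harmonic_morphism_def by blast

section \<open>Galois coverings are quotients\<close>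

lemma closed_superset_of_open_interval:
  fixes l :: ereal
  assumes "0 < l" "closed X" "{0<..<l} \<subseteq> X" shows "{0..l} \<subseteq> X"
  using closure_minimal[OF assms(3,2)] assms(1) by simp

lemma (in loopless_graph) interior_avoids_finite:
  assumes e: "e \<in> edges M" and B: "finite B"
  obtains t where "0 < t" "t < len M e" "chart M e t \<notin> B"
proof -
  have "inj_on (chart M e) {0<..<len M e}"
    using chart_inj[OF e] by (rule inj_on_subset) auto
  then have "infinite (chart M e ` {0<..<len M e})"
    using len_pos[OF e] by (simp add: finite_image_iff infinite_Ioo)
  then have "\<not> chart M e ` {0<..<len M e} \<subseteq> B" using B finite_subset by blast
  then obtain t where "t \<in> {0<..<len M e}" "chart M e t \<notin> B" by blast
  then show thesis using that[of t] by simp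
qed

locale galois_morphism = harmonic_morphism +
  fixes K :: "('g, 'k) monoid_scheme" and \<alpha>
  assumes galois: "galois_covering K \<alpha> \<Gamma> \<Gamma>' \<psi>"
    and finite_group: "finite (carrier K)" and d_eq: "d = order K"
begin

lemma action: "group_action K (points \<Gamma>) \<alpha>"
  and action_continuous: "g \<in> carrier K \<Longrightarrow> continuous_map (topo \<Gamma>) (topo \<Gamma>) (\<alpha> g)"
  and finite_nontrivial: "finite {x \<in> points \<Gamma>. stabilizer K \<alpha> x \<noteq> {\<one>\<^bsub>K\<^esub>}}"
  using galois unfolding galois_covering_def isometric_action_def by blast+

lemma act_point: "g \<in> carrier K \<Longrightarrow> x \<in> points \<Gamma> \<Longrightarrow> \<alpha> g x \<in> points \<Gamma>"
  using group_action.element_image[OF action] by blast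

lemma fibre_action:
  assumes "y \<in> points \<Gamma>'"
  shows "transitive_action K {x \<in> points \<Gamma>. \<psi> x = y} (\<lambda>g. restrict (\<alpha> g) {x \<in> points \<Gamma>. \<psi> x = y})"
  using galois assms unfolding galois_covering_def Let_def by blast

lemma image_point: "x \<in> points \<Gamma> \<Longrightarrow> \<psi> x \<in> points \<Gamma>'"
  unfolding points_image by blast

lemma act_invariant:
  assumes g: "g \<in> carrier K" and x: "x \<in> points \<Gamma>"
  shows "\<psi> (\<alpha> g x) = \<psi> x"
proof -
  let ?F = "{z \<in> points \<Gamma>. \<psi> z = \<psi> x}"
  have "group_action K ?F (\<lambda>g. restrict (\<alpha> g) ?F)"
    using fibre_action[OF image_point[OF x]] by (rule transitive_action.axioms)
  then have "restrict (\<alpha> g) ?F x \<in> ?F"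
    by (rule group_action.element_image[OF _ g _ refl]) (use x in simp)
  then show ?thesis using x by simp
qed

lemma fibres_eq_orbits:
  assumes x: "x \<in> points \<Gamma>" and y: "y \<in> points \<Gamma>"
  shows "\<psi> x = \<psi> y \<longleftrightarrow> (\<exists>a\<in>\<alpha> ` carrier K. y = a x)"
proof
  assume eq: "\<psi> x = \<psi> y"
  let ?F = "{z \<in> points \<Gamma>. \<psi> z = \<psi> x}"
  obtain g where "g \<in> carrier K" "restrict (\<alpha> g) ?F x = y"
    using transitive_action.unique_orbit[OF fibre_action[OF image_point[OF x]], of x y] x y eq
    by (elim meta_impE bexE) simp_all
  then show "\<exists>a\<in>\<alpha> ` carrier K. y = a x" using x by auto
next
  assume "\<exists>a\<in>\<alpha> ` carrier K. y = a x"
  then obtain g where "g \<in> carrier K" "y = \<alpha> g x" by (elim bexE imageE) simp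
  then show "\<psi> x = \<psi> y" using act_invariant[OF _ x] by simp
qed

lemma generic_point:
  assumes e: "e \<in> edges M"
  obtains t where "0 < t" "t < len M e" "stabilizer K \<alpha> (chart M e t) = {\<one>\<^bsub>K\<^esub>}"
proof -
  obtain t where t: "0 < t" "t < len M e"
      "chart M e t \<notin> {x \<in> points \<Gamma>. stabilizer K \<alpha> x \<noteq> {\<one>\<^bsub>K\<^esub>}}"
    using M.interior_avoids_finite[OF e finite_nontrivial] .
  moreover have "chart M e t \<in> points \<Gamma>" using t(1,2) by (auto intro!: M.chart_in_points[OF e])
  ultimately show thesis using that[of t] by simp
qed

text \<open>An orbit with trivial stabilizers has \<open>|K| = d\<close> points in one fibre, so at least \<open>d\<close> edges lie above
  the image edge; their dilation factors are positive and add up to \<open>d\<close>.\<close>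

lemma dilation_eq_one:
  assumes e: "e \<in> edges M" shows "D e = 1"
proof -
  obtain t where t: "0 < t" "t < len M e" "stabilizer K \<alpha> (chart M e t) = {\<one>\<^bsub>K\<^esub>}"
    using generic_point[OF e] .
  then have t': "t \<in> {0..len M e}" by auto
  define x where "x = chart M e t"
  have x: "x \<in> e" "x \<in> points \<Gamma>" "x \<notin> verts M"
    using M.chart_in[OF e t'] M.chart_in_points[OF e t'] M.interior_not_vert[OF e t(1,2)]
    unfolding x_def by auto
  have y: "\<psi> x \<in> \<psi> ` e" "\<psi> x \<notin> verts N" using x vert_iff by auto
  note fibre = edge_fibre_card_le[OF edge_edge[OF e] y]
  have "order K = card (orbit K \<alpha> x)"
    using group_action.orbit_stabilizer_theorem[OF action x(2)] t(3) x_def by simp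
  also have "\<dots> \<le> card {z \<in> points \<Gamma>. \<psi> z = \<psi> x}"
    using fibre act_invariant act_point x unfolding orbit_def by (intro card_mono) auto
  finally have "d \<le> card {e' \<in> edges M. \<psi> ` e' = \<psi> ` e}" using fibre d_eq by linarith
  then show ?thesis using dilation_one[OF edge_edge[OF e]] e by blast
qed

lemma edge_isometric:
  "e \<in> edges M \<Longrightarrow> x \<in> e \<Longrightarrow> y \<in> e \<Longrightarrow> distance \<Gamma>' (\<psi> x) (\<psi> y) = distance \<Gamma> x y"
  using dilation[of e x y] dilation_eq_one[of e] by simp

text \<open>Edges above the same edge may be parametrised in opposite directions. Those on which \<open>\<psi>\<close> reverses the
  parameter are reversed.\<close>

lemma aligned_model:
  obtains M' where "loopless_model M' \<Gamma>" "image_model \<psi> M' N" "edges M' = edges M" "verts M' = verts M"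
proof -
  define R where "R = {e \<in> edges M. \<not> (\<forall>t\<in>{0..len M e}. \<psi> (chart M e t) = chart N (\<psi> ` e) t)}"
  have iso: "len N (\<psi> ` e) = len M e \<and>
    ((\<forall>t\<in>{0..len M e}. \<psi> (chart M e t) = chart N (\<psi> ` e) t) \<or>
     len M e \<noteq> \<infinity> \<and> (\<forall>t\<in>{0..len M e}. \<psi> (chart M e t) = chart N (\<psi> ` e) (len M e - t)))"
    if "e \<in> edges M" for e
    by (rule model_edge_isometry[OF M.loopless_model_axioms N.loopless_model_axioms continuous that
        edge_edge[OF that] edge_isometric[OF that]])
  have "model_of (reverse_edges R M) \<Gamma>"
    using iso unfolding R_def by (intro model_of_reverse_edges M.model) blast
  moreover have "loopless (reverse_edges R M)"
    using M.loopless by (simp add: loopless_def reverse_edges_def)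
  ultimately have "loopless_model (reverse_edges R M) \<Gamma>"
    using model_graph by unfold_locales
  moreover have "image_model \<psi> (reverse_edges R M) N"
  proof -
    have "\<psi> (chart M e (if e \<in> R then len M e - t else t)) = chart N (\<psi> ` e) t"
      if e: "e \<in> edges M" and t: "t \<in> {0..len M e}" for e t
    proof (cases "e \<in> R")
      case True
      then have rev: "len M e \<noteq> \<infinity>" "\<forall>t\<in>{0..len M e}. \<psi> (chart M e t) = chart N (\<psi> ` e) (len M e - t)"
        using iso[OF e] unfolding R_def by auto
      have "len M e - t \<in> {0..len M e}" "len M e - (len M e - t) = t"
        using rev(1) t by (cases "len M e"; cases t; auto)+
      then show ?thesis using rev(2) True by metis
    qed (use e t R_def in auto)
    then show ?thesis
      using iso verts_eq edges_eq unfolding image_model_def by (simp add: reverse_edges_def)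
  qed
  ultimately show thesis using that[of "reverse_edges R M"] by (simp add: reverse_edges_def)
qed

context
  fixes L
  assumes L: "loopless_model L \<Gamma>" and im: "image_model \<psi> L N"
    and same: "edges L = edges M" "verts L = verts M"
begin

interpretation L: loopless_model L \<Gamma> by (fact L)

lemma act_vert: "g \<in> carrier K \<Longrightarrow> v \<in> verts M \<Longrightarrow> \<alpha> g v \<in> verts M"
  using vert_iff[of "\<alpha> g v"] act_point[of g v] act_invariant[of g v] vert_vert[of v] M.points_eq by simp

lemma act_vert_iff:
  assumes g: "g \<in> carrier K" and x: "x \<in> points \<Gamma>"
  shows "\<alpha> g x \<in> verts M \<longleftrightarrow> x \<in> verts M"
  using vert_iff[OF act_point[OF g x]] vert_iff[OF x] act_invariant[OF g x] by simp

text \<open>An edge \<open>e2\<close> is closed and its interior is open, so by continuity the parameters of the open edge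
  that \<open>g\<close> sends into \<open>e2\<close> form an open and closed subset of an interval. Hence \<open>g\<close> maps the open edge
  into a single edge, and the ends follow because this edge is closed. The parameter is preserved
  since it can be read off from the image under \<open>\<psi>\<close>, which \<open>g\<close> does not change.\<close>

lemma act_edge:
  assumes g: "g \<in> carrier K" and e: "e \<in> edges L"
  obtains e2 where "e2 \<in> edges L" "len L e2 = len L e"
    "\<And>t. t \<in> {0..len L e} \<Longrightarrow> \<alpha> g (chart L e t) = chart L e2 t"
proof -
  define p where "p t = \<alpha> g (chart L e t)" for t
  define l where "l = len L e"
  have l: "0 < l" using L.len_pos[OF e] l_def by simp
  have p_pt: "p t \<in> points \<Gamma>" if "t \<in> {0..l}" for t
    unfolding p_def using act_point[OF g] L.chart_in_points[OF e] that l_def by blast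
  have p_novert: "p t \<notin> verts L" if "t \<in> {0<..<l}" for t
  proof -
    have t: "0 < t" "t < len L e" "t \<in> {0..len L e}" using that l_def by auto
    show ?thesis unfolding p_def same
      using act_vert_iff[OF g L.chart_in_points[OF e t(3)]] L.interior_not_vert[OF e t(1,2)] same by simp
  qed
  have \<psi>p: "\<psi> (p t) = chart N (\<psi> ` e) t" if "t \<in> {0..l}" for t
    unfolding p_def using act_invariant[OF g L.chart_in_points[OF e]] image_modelD(5)[OF im e] that l_def
    by metis
  obtain t0 where t0: "t0 \<in> {0<..<l}" using dense[OF l] by auto
  then have t0': "t0 \<in> {0..l}" by auto
  obtain e2 where e2: "e2 \<in> edges L" "p t0 \<in> e2"
    using p_pt[OF t0'] p_novert[OF t0] L.points_eq by auto
  define T where "T = {t \<in> {0<..<l}. p t \<in> e2}"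
  have "openin (top_of_set {0<..<l}) T"
  proof -
    let ?I = "chart L e2 ` {0<..<len L e2}"
    have "openin (topo \<Gamma>) {x \<in> points \<Gamma>. \<alpha> g x \<in> ?I}"
      by (rule openin_continuous_map_preimage[OF action_continuous[OF g] L.openin_interior[OF e2(1)]])
    then have "openin (top_of_set {0..l}) {t \<in> {0..l}. chart L e t \<in> {x \<in> points \<Gamma>. \<alpha> g x \<in> ?I}}"
      using L.openin_iff e unfolding l_def by blast
    then obtain S where S: "open S"
        "{t \<in> {0..l}. chart L e t \<in> {x \<in> points \<Gamma>. \<alpha> g x \<in> ?I}} = {0..l} \<inter> S"
      by (auto simp: openin_open)
    have "p t \<in> e2 \<longleftrightarrow> t \<in> S" if t: "t \<in> {0<..<l}" for t
    proof -
      have t': "t \<in> {0..l}" using t by auto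
      have "p t \<in> e2 \<longleftrightarrow> p t \<in> ?I"
      proof
        assume "p t \<in> e2"
        then obtain s where s: "s \<in> {0..len L e2}" "p t = chart L e2 s" using L.in_edgeE[OF e2(1)] by blast
        then have "s \<noteq> 0" "s \<noteq> len L e2" using p_novert[OF t] L.vert_iff[OF e2(1) s(1)] by auto
        then show "p t \<in> ?I" using s by (auto simp: less_le)
      next
        assume "p t \<in> ?I"
        then obtain s where "s \<in> {0<..<len L e2}" "p t = chart L e2 s" by blast
        moreover from this have "s \<in> {0..len L e2}" by auto
        ultimately show "p t \<in> e2" using L.chart_in[OF e2(1)] by simp
      qed
      also have "\<dots> \<longleftrightarrow> t \<in> {t \<in> {0..l}. chart L e t \<in> {x \<in> points \<Gamma>. \<alpha> g x \<in> ?I}}"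
        using t' L.chart_in_points[OF e, of t] unfolding p_def l_def by simp
      also have "\<dots> \<longleftrightarrow> t \<in> S" unfolding S(2) using t' by simp
      finally show ?thesis .
    qed
    then have "T = {0<..<l} \<inter> S" unfolding T_def by blast
    then show ?thesis using S(1) by (auto simp: openin_open)
  qed
  moreover have clo: "closed {t \<in> {0..l}. p t \<in> e2}"
  proof -
    have "closedin (topo \<Gamma>) e2"
      using L.closedin_chart_image[OF e2(1) closed_atLeastAtMost order_refl] L.chart_image[OF e2(1)] by simp
    then have "closedin (topo \<Gamma>) {x \<in> points \<Gamma>. \<alpha> g x \<in> e2}"
      by (rule closedin_continuous_map_preimage[OF action_continuous[OF g]])
    then have "closed {t \<in> {0..len L e}. chart L e t \<in> {x \<in> points \<Gamma>. \<alpha> g x \<in> e2}}"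
      by (rule L.closedin_imp_closed[OF e])
    also have "{t \<in> {0..len L e}. chart L e t \<in> {x \<in> points \<Gamma>. \<alpha> g x \<in> e2}} = {t \<in> {0..l}. p t \<in> e2}"
      using L.chart_in_points[OF e] unfolding p_def l_def by auto
    finally show ?thesis .
  qed
  moreover have T_eq: "T = {0<..<l} \<inter> {t \<in> {0..l}. p t \<in> e2}" unfolding T_def by auto
  ultimately have "openin (top_of_set {0<..<l}) T" "closedin (top_of_set {0<..<l}) T"
    by (auto simp: closedin_closed)
  moreover have "T \<noteq> {}" using t0 e2 unfolding T_def by blast
  ultimately have "T = {0<..<l}" using connected_clopen[of "{0<..<l}"] connected_Ioo by blast
  then have "{0<..<l} \<subseteq> {t \<in> {0..l}. p t \<in> e2}" unfolding T_eq by (simp only: Int_absorb2 inf.absorb_iff1)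
  then have sub: "{0..l} \<subseteq> {t \<in> {0..l}. p t \<in> e2}"
    using closed_superset_of_open_interval[OF l clo] by blast
  have \<psi>e2: "\<psi> ` e2 = \<psi> ` e"
  proof (rule ccontr)
    assume ne: "\<psi> ` e2 \<noteq> \<psi> ` e"
    have "\<psi> (p t0) \<in> \<psi> ` e"
      using act_invariant[OF g L.chart_in_points[OF e]] L.chart_in[OF e] t0' unfolding p_def l_def by simp
    then have "\<psi> (p t0) \<in> verts N"
      using N.edges_meet_in_vert[OF image_modelD(3)[OF im e2(1)] image_modelD(3)[OF im e] ne] e2(2) by blast
    then show False using vert_iff[OF p_pt[OF t0']] p_novert[OF t0] same by simp
  qed
  have l2: "len L e2 = l"
    using image_modelD(4)[OF im e2(1)] image_modelD(4)[OF im e] \<psi>e2 l_def by simp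
  have "p t = chart L e2 t" if t: "t \<in> {0..l}" for t
  proof -
    have "p t \<in> e2" using sub t by blast
    then obtain s where s: "s \<in> {0..len L e2}" "p t = chart L e2 s" using L.in_edgeE[OF e2(1)] by blast
    have "chart N (\<psi> ` e) s = chart N (\<psi> ` e) t"
      using \<psi>p[OF t] image_modelD(5)[OF im e2(1) s(1)] \<psi>e2 s(2) by simp
    then have "s = t"
      using N.chart_eq_iff[OF image_modelD(3)[OF im e], of s t] s(1) t l2 image_modelD(4)[OF im e] l_def
      by simp
    then show ?thesis using s(2) by simp
  qed
  then show thesis using that e2(1) l2 unfolding p_def l_def by blast
qed

lemma act_automorphism:
  assumes g: "g \<in> carrier K"
  shows "image_model (\<alpha> g) L L"
proof -
  have grp: "group K" using action by (simp add: group_action_def group_hom_def)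
  have img: "\<alpha> h ` e \<in> edges L \<and> len L (\<alpha> h ` e) = len L e \<and>
      (\<forall>t\<in>{0..len L e}. chart L (\<alpha> h ` e) t = \<alpha> h (chart L e t))"
    if h: "h \<in> carrier K" and e: "e \<in> edges L" for h e
  proof -
    obtain e2 where e2: "e2 \<in> edges L" "len L e2 = len L e"
      "\<And>t. t \<in> {0..len L e} \<Longrightarrow> \<alpha> h (chart L e t) = chart L e2 t"
      using act_edge[OF h e] by metis
    have "\<alpha> h ` e = (\<lambda>t. \<alpha> h (chart L e t)) ` {0..len L e}"
      using L.chart_image[OF e] by (metis image_image)
    also have "\<dots> = chart L e2 ` {0..len L e2}" using e2 by (intro image_cong) auto
    also have "\<dots> = e2" using L.chart_image[OF e2(1)] .
    finally show ?thesis using e2 by simp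
  qed
  have inv: "inv\<^bsub>K\<^esub> g \<in> carrier K" using g grp by simp
  have cancel: "\<alpha> g (\<alpha> (inv\<^bsub>K\<^esub> g) x) = x" if x: "x \<in> points \<Gamma>" for x
    using group_action.composition_rule[OF action x g inv] group_action.id_eq_one[OF action] g grp x
    by (metis group.r_inv restrict_apply')
  have "verts L = \<alpha> g ` verts L"
  proof
    show "verts L \<subseteq> \<alpha> g ` verts L"
    proof
      fix v assume v: "v \<in> verts L"
      then have "\<alpha> g (\<alpha> (inv\<^bsub>K\<^esub> g) v) = v" using cancel L.points_eq by simp
      moreover have "\<alpha> (inv\<^bsub>K\<^esub> g) v \<in> verts L" using act_vert[OF inv] v same by simp
      ultimately show "v \<in> \<alpha> g ` verts L" by (metis imageI)
    qed
  qed (use act_vert[OF g] same in auto)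
  moreover have "edges L = (`) (\<alpha> g) ` edges L"
  proof
    show "edges L \<subseteq> (`) (\<alpha> g) ` edges L"
    proof
      fix e assume e: "e \<in> edges L"
      have "\<alpha> g ` (\<alpha> (inv\<^bsub>K\<^esub> g) ` e) = e"
        unfolding image_image using cancel L.edge_subset_points[OF e] by force
      moreover have "\<alpha> (inv\<^bsub>K\<^esub> g) ` e \<in> edges L" using img[OF inv e] by blast
      ultimately show "e \<in> (`) (\<alpha> g) ` edges L" by (metis imageI)
    qed
  qed (use img[OF g] in auto)
  ultimately show ?thesis unfolding image_model_def using img[OF g] by blast
qed

lemma aligned_model_quotient: "model_quotient L \<Gamma> (\<alpha> ` carrier K) \<psi>"
  using act_automorphism fibres_eq_orbits by unfold_locales auto

end

end

lemma galois_coveringE: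
  assumes "galois_covering K \<alpha> \<Gamma> \<Gamma>' \<psi>" "finite (carrier K)"
  obtains M N D m where "galois_morphism \<Gamma> \<Gamma>' \<psi> M N D m (order K) K \<alpha>"
proof -
  have "group_action K (points \<Gamma>) \<alpha>"
    using assms(1) unfolding galois_covering_def isometric_action_def by blast
  then have "group K" by (simp add: group_action_def group_hom_def)
  then have "0 < order K" using assms(2) by (simp add: group.is_monoid monoid.order_gt_0_iff_finite)
  moreover have "has_degree \<Gamma> \<Gamma>' \<psi> (order K)" using assms(1) unfolding galois_covering_def by blast
  ultimately obtain M N D m where "harmonic_morphism \<Gamma> \<Gamma>' \<psi> M N D m (order K)"
    using has_degree_harmonic_morphism by metis
  then show thesis using that assms by (simp add: galois_morphism_def galois_morphism_axioms_def)
qed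

theorem galois_covering_quotient_by:
  assumes "galois_covering K \<alpha> \<Gamma> \<Gamma>' \<psi>" "finite (carrier K)"
  shows "quotient_by (\<alpha> ` carrier K) \<Gamma> \<Gamma>' \<psi>"
proof -
  obtain M N D m where "galois_morphism \<Gamma> \<Gamma>' \<psi> M N D m (order K) K \<alpha>"
    using galois_coveringE[OF assms] .
  then interpret galois_morphism \<Gamma> \<Gamma>' \<psi> M N D m "order K" K \<alpha> .
  obtain L where L: "loopless_model L \<Gamma>" "image_model \<psi> L N" "edges L = edges M" "verts L = verts M"
    using aligned_model .
  then interpret model_quotient L \<Gamma> "\<alpha> ` carrier K" \<psi> by (rule aligned_model_quotient)
  show ?thesis using quotient_by_if_image_model[OF L(2) N.model] .
qed

section \<open>The model adapted to the group\<close>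

text \<open>A single model on which the whole group acts serves the quotients by all subgroups at once. By
  \<open>rigid\<close> the quotient maps are injective on edges. By \<open>nearest\<close> they preserve the distances between
  points of one edge: as distances are global, a translate of \<open>y\<close> on another edge could otherwise be
  closer to \<open>x\<close> than \<open>y\<close>. The last assumption excludes that a nontrivial group acts on a point.\<close>

locale galois_model = loopless_model M \<Gamma> for M :: "'p model" and \<Gamma> +
  fixes G :: "('g, 'm) monoid_scheme" and \<alpha> :: "'g \<Rightarrow> 'p \<Rightarrow> 'p"
  assumes isometric: "isometric_action G \<alpha> \<Gamma>"
    and finite_group: "finite (carrier G)"
    and finite_nontrivial: "finite {x \<in> points \<Gamma>. stabilizer G \<alpha> x \<noteq> {\<one>\<^bsub>G\<^esub>}}"
    and act_automorphism: "g \<in> carrier G \<Longrightarrow> image_model (\<alpha> g) M M"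
    and rigid: "e \<in> edges M \<Longrightarrow> x \<in> e \<Longrightarrow> g \<in> carrier G \<Longrightarrow> \<alpha> g x \<in> e \<Longrightarrow> \<alpha> g x = x"
    and nearest: "e \<in> edges M \<Longrightarrow> x \<in> e \<Longrightarrow> y \<in> e \<Longrightarrow> g \<in> carrier G \<Longrightarrow>
      distance \<Gamma> x y \<le> distance \<Gamma> x (\<alpha> g y)"
    and trivial_if_no_edges: "edges M = {} \<Longrightarrow> order G = 1"

text \<open>For \<open>nearest\<close>: the covering preserves distances on edges, and distances in the target are distances
  to orbits.\<close>

theorem galois_covering_galois_model:
  assumes "galois_covering G \<alpha> \<Gamma> \<Gamma>' \<psi>" "finite (carrier G)"
    and single: "is_singleton (points \<Gamma>) \<Longrightarrow> order G = 1"
  obtains L where "galois_model L \<Gamma> G \<alpha>"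
proof -
  obtain M N D m where "galois_morphism \<Gamma> \<Gamma>' \<psi> M N D m (order G) G \<alpha>"
    using galois_coveringE[OF assms(1,2)] .
  then interpret galois_morphism \<Gamma> \<Gamma>' \<psi> M N D m "order G" G \<alpha> .
  obtain L where L: "loopless_model L \<Gamma>" "image_model \<psi> L N" "edges L = edges M" "verts L = verts M"
    using aligned_model .
  interpret L: loopless_model L \<Gamma> by (fact L)
  have q: "quotient_by (\<alpha> ` carrier G) \<Gamma> \<Gamma>' \<psi>" using galois_covering_quotient_by[OF assms(1,2)] .
  have "galois_model L \<Gamma> G \<alpha>"
  proof
    show "isometric_action G \<alpha> \<Gamma>" using assms(1) unfolding galois_covering_def by blast
    show "image_model (\<alpha> g) L L" if "g \<in> carrier G" for g by (rule act_automorphism[OF L that])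
    show "\<alpha> g x = x" if "e \<in> edges L" "x \<in> e" "g \<in> carrier G" "\<alpha> g x \<in> e" for e x g
      using inj_onD[OF inj, of e "\<alpha> g x" x] act_invariant[of g x] L.edge_subset_points that L(3) by blast
    show "distance \<Gamma> x y \<le> distance \<Gamma> x (\<alpha> g y)"
      if e: "e \<in> edges L" "x \<in> e" "y \<in> e" and g: "g \<in> carrier G" for e x y g
    proof -
      have xy: "x \<in> points \<Gamma>" "y \<in> points \<Gamma>" using L.edge_subset_points e by blast+
      have "distance \<Gamma> x y = distance \<Gamma>' (\<psi> x) (\<psi> y)" using edge_isometric e L(3) by simp
      also have "\<dots> = (INF y'\<in>{y'\<in>points \<Gamma>. \<psi> y' = \<psi> y}. distance \<Gamma> x y')"
        using q xy unfolding quotient_by_def by blast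
      also have "\<dots> \<le> distance \<Gamma> x (\<alpha> g y)"
        using act_point[OF g xy(2)] act_invariant[OF g xy(2)] by (intro INF_lower) auto
      finally show ?thesis .
    qed
    show "order G = 1" if "edges L = {}"
    proof (rule single)
      obtain v where "v \<in> verts L" using L.verts_nonempty by blast
      then have "verts L = {v}" using L.isolated_vertex that by blast
      then show "is_singleton (points \<Gamma>)" unfolding L.points_eq that by (simp add: is_singleton_def)
    qed
  qed (use finite_nontrivial finite_group in auto)
  then show thesis using that by blast
qed

section \<open>Quotients by subgroups\<close>

lemma has_degree_finite_harmonic: "has_degree \<Gamma> \<Gamma>' \<psi> d \<Longrightarrow> finite_harmonic \<Gamma> \<Gamma>' \<psi>"
  unfolding has_degree_def finite_harmonic_def by blast

lemma quotient_byD: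
  assumes "quotient_by A \<Gamma> \<Gamma>' \<psi>"
  shows "points \<Gamma>' = \<psi> ` points \<Gamma>"
    and "x \<in> points \<Gamma> \<Longrightarrow> y \<in> points \<Gamma> \<Longrightarrow> \<psi> x = \<psi> y \<longleftrightarrow> (\<exists>a\<in>A. y = a x)"
    and "openin (topo \<Gamma>') U \<longleftrightarrow> U \<subseteq> points \<Gamma>' \<and> openin (topo \<Gamma>) {x \<in> points \<Gamma>. \<psi> x \<in> U}"
    and "x \<in> points \<Gamma> \<Longrightarrow> y \<in> points \<Gamma> \<Longrightarrow> distance \<Gamma>' (\<psi> x) (\<psi> y) =
        (INF y'\<in>{y'\<in>points \<Gamma>. \<psi> y' = \<psi> y}. distance \<Gamma> x y')"
proof -
  note q = assms[unfolded quotient_by_def]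
  note q' = q[THEN conjunct2] q[THEN conjunct2, THEN conjunct2]
  show "points \<Gamma>' = \<psi> ` points \<Gamma>" by (rule q[THEN conjunct1])
  show "\<psi> x = \<psi> y \<longleftrightarrow> (\<exists>a\<in>A. y = a x)" if "x \<in> points \<Gamma>" "y \<in> points \<Gamma>"
    by (rule q'(1)[THEN conjunct1, rule_format, OF that])
  show "openin (topo \<Gamma>') U \<longleftrightarrow> U \<subseteq> points \<Gamma>' \<and> openin (topo \<Gamma>) {x \<in> points \<Gamma>. \<psi> x \<in> U}"
    by (rule q'(2)[THEN conjunct1, rule_format])
  show "distance \<Gamma>' (\<psi> x) (\<psi> y) = (INF y'\<in>{y'\<in>points \<Gamma>. \<psi> y' = \<psi> y}. distance \<Gamma> x y')"
    if "x \<in> points \<Gamma>" "y \<in> points \<Gamma>"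
    by (rule q'(2)[THEN conjunct2, rule_format, OF that])
qed

context galois_model
begin

lemma action: "group_action G (points \<Gamma>) \<alpha>"
  using isometric unfolding isometric_action_def by blast

lemma group_G: "group G"
  using action by (simp add: group_action_def group_hom_def)

lemma act_point: "g \<in> carrier G \<Longrightarrow> x \<in> points \<Gamma> \<Longrightarrow> \<alpha> g x \<in> points \<Gamma>"
  using group_action.element_image[OF action] by blast

lemma act_mult: "g \<in> carrier G \<Longrightarrow> h \<in> carrier G \<Longrightarrow> x \<in> points \<Gamma> \<Longrightarrow>
    \<alpha> (g \<otimes>\<^bsub>G\<^esub> h) x = \<alpha> g (\<alpha> h x)"
  using group_action.composition_rule[OF action] by blast

lemma act_one: "x \<in> points \<Gamma> \<Longrightarrow> \<alpha> \<one>\<^bsub>G\<^esub> x = x"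
  using group_action.id_eq_one[OF action] by (metis restrict_apply')

lemma act_eq_iff:
  assumes "g \<in> carrier G" "h \<in> carrier G" "x \<in> points \<Gamma>"
  shows "\<alpha> g x = \<alpha> h x \<longleftrightarrow> inv\<^bsub>G\<^esub> h \<otimes>\<^bsub>G\<^esub> g \<in> stabilizer G \<alpha> x"
proof -
  interpret group G by (rule group_G)
  have "\<alpha> (inv\<^bsub>G\<^esub> h) (\<alpha> h x) = x"
    using act_mult[of "inv\<^bsub>G\<^esub> h" h x] act_one assms by simp
  moreover have "\<alpha> h (\<alpha> (inv\<^bsub>G\<^esub> h \<otimes>\<^bsub>G\<^esub> g) x) = \<alpha> g x"
    using act_mult[of h "inv\<^bsub>G\<^esub> h \<otimes>\<^bsub>G\<^esub> g" x] assms by (simp flip: m_assoc)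
  ultimately show ?thesis
    unfolding stabilizer_def using act_mult[of "inv\<^bsub>G\<^esub> h" g x] assms by auto
qed

lemma generic_eq:
  assumes e: "e \<in> edges M"
  obtains x where "x \<in> e"
    "\<And>g h. g \<in> carrier G \<Longrightarrow> h \<in> carrier G \<Longrightarrow> \<alpha> g x = \<alpha> h x \<Longrightarrow> g = h"
proof -
  interpret group G by (rule group_G)
  obtain t where t: "0 < t" "t < len M e"
      "chart M e t \<notin> {x \<in> points \<Gamma>. stabilizer G \<alpha> x \<noteq> {\<one>\<^bsub>G\<^esub>}}"
    using interior_avoids_finite[OF e finite_nontrivial] .
  then have t': "t \<in> {0..len M e}" by auto
  have pt: "chart M e t \<in> points \<Gamma>" using chart_in_points[OF e t'] .
  have "g = h" if "g \<in> carrier G" "h \<in> carrier G" "\<alpha> g (chart M e t) = \<alpha> h (chart M e t)" for g h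
  proof -
    have "inv\<^bsub>G\<^esub> h \<otimes>\<^bsub>G\<^esub> g = \<one>\<^bsub>G\<^esub>" using act_eq_iff[OF that(1,2) pt] that(3) t(3) pt by simp
    then show ?thesis using that(1,2) by (metis inv_equality inv_inv inv_closed)
  qed
  then show thesis using that[OF chart_in[OF e t']] by blast
qed

text \<open>Two elements that move an edge to the same edge agree at each of its points by \<open>rigid\<close>, in
  particular at a point with trivial stabilizer.\<close>

lemma act_edge_eq:
  assumes e: "e \<in> edges M" and gh: "g \<in> carrier G" "h \<in> carrier G" and eq: "\<alpha> g ` e = \<alpha> h ` e"
  shows "g = h"
proof -
  interpret group G by (rule group_G)
  have "\<alpha> g x = \<alpha> h x" if x: "x \<in> e" for x
  proof -
    have pt: "x \<in> points \<Gamma>" using edge_subset_points[OF e] x by blast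
    have k: "g \<otimes>\<^bsub>G\<^esub> inv\<^bsub>G\<^esub> h \<in> carrier G" using gh by simp
    have "\<alpha> (g \<otimes>\<^bsub>G\<^esub> inv\<^bsub>G\<^esub> h) (\<alpha> h x) = \<alpha> g x"
      using act_mult[OF k gh(2) pt] gh by (simp add: m_assoc)
    moreover have "\<alpha> g x \<in> \<alpha> h ` e" "\<alpha> h x \<in> \<alpha> h ` e" using eq x by blast+
    moreover have "\<alpha> h ` e \<in> edges M" using image_modelD(3)[OF act_automorphism[OF gh(2)] e] .
    ultimately show ?thesis using rigid[of "\<alpha> h ` e" "\<alpha> h x" "g \<otimes>\<^bsub>G\<^esub> inv\<^bsub>G\<^esub> h"] k by simp
  qed
  moreover obtain x where "x \<in> e"
    "\<And>g h. g \<in> carrier G \<Longrightarrow> h \<in> carrier G \<Longrightarrow> \<alpha> g x = \<alpha> h x \<Longrightarrow> g = h"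
    using generic_eq[OF e] by blast
  ultimately show ?thesis using gh by blast
qed

lemma injective_model_quotient:
  assumes H: "subgroup H G"
    and fib: "\<And>x y. x \<in> points \<Gamma> \<Longrightarrow> y \<in> points \<Gamma> \<Longrightarrow> \<psi> x = \<psi> y \<longleftrightarrow> (\<exists>a\<in>\<alpha> ` H. y = a x)"
  shows "injective_model_quotient M \<Gamma> (\<alpha> ` H) \<psi>"
proof
  have HG: "h \<in> carrier G" if "h \<in> H" for h using subgroup.mem_carrier[OF H that] .
  show "image_model a M M" if "a \<in> \<alpha> ` H" for a using act_automorphism HG that by blast
  show "\<psi> x = \<psi> y \<longleftrightarrow> (\<exists>a\<in>\<alpha> ` H. y = a x)" if "x \<in> points \<Gamma>" "y \<in> points \<Gamma>" for x y
    by (rule fib[OF that])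
  show "inj_on \<psi> e" if e: "e \<in> edges M" for e
  proof (rule inj_onI)
    fix x y assume xy: "x \<in> e" "y \<in> e" "\<psi> x = \<psi> y"
    then obtain h where h: "h \<in> H" "y = \<alpha> h x" using fib edge_subset_points[OF e] by blast
    then show "x = y" using rigid[OF e xy(1) HG[OF h(1)]] xy(2) by simp
  qed
qed

lemma quotient_edge_isometric:
  assumes H: "subgroup H G" and q: "quotient_by (\<alpha> ` H) \<Gamma> \<Gamma>' \<psi>"
    and e: "e \<in> edges M" and xy: "x \<in> e" "y \<in> e"
  shows "distance \<Gamma>' (\<psi> x) (\<psi> y) = distance \<Gamma> x y"
proof -
  have pt: "x \<in> points \<Gamma>" "y \<in> points \<Gamma>" using edge_subset_points[OF e] xy by blast+
  have "distance \<Gamma>' (\<psi> x) (\<psi> y) = (INF y'\<in>{y'\<in>points \<Gamma>. \<psi> y' = \<psi> y}. distance \<Gamma> x y')"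
    by (rule quotient_byD(4)[OF q pt])
  also have "\<dots> = distance \<Gamma> x y"
  proof (rule antisym)
    show "(INF y'\<in>{y'\<in>points \<Gamma>. \<psi> y' = \<psi> y}. distance \<Gamma> x y') \<le> distance \<Gamma> x y"
      using pt by (intro INF_lower) auto
    show "distance \<Gamma> x y \<le> (INF y'\<in>{y'\<in>points \<Gamma>. \<psi> y' = \<psi> y}. distance \<Gamma> x y')"
    proof (rule INF_greatest)
      fix y' assume y': "y' \<in> {y'\<in>points \<Gamma>. \<psi> y' = \<psi> y}"
      then have "\<psi> y = \<psi> y'" "y' \<in> points \<Gamma>" by simp_all
      then obtain h where "h \<in> H" "y' = \<alpha> h y" using quotient_byD(2)[OF q pt(2)] by blast
      then show "distance \<Gamma> x y \<le> distance \<Gamma> x y'"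
        using nearest[OF e xy] subgroup.mem_carrier[OF H] by blast
    qed
  qed
  finally show ?thesis .
qed

text \<open>For \<open>H2 \<subseteq> H1\<close>, let \<open>\<theta>\<close> be the induced map between the quotients. With \<open>H2\<close> trivial, it is
  the quotient map of \<open>H1\<close> itself.\<close>

context
  fixes H1 H2 and \<Gamma>1 :: "'q curve" and \<Gamma>2 :: "'r curve" and \<psi>1 \<psi>2 \<theta>
  assumes H1: "subgroup H1 G" and H2: "subgroup H2 G" and H21: "H2 \<subseteq> H1"
    and q1: "quotient_by (\<alpha> ` H1) \<Gamma> \<Gamma>1 \<psi>1" and q2: "quotient_by (\<alpha> ` H2) \<Gamma> \<Gamma>2 \<psi>2"
    and factor: "\<And>x. x \<in> points \<Gamma> \<Longrightarrow> \<psi>1 x = \<theta> (\<psi>2 x)"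
begin

interpretation Q1: injective_model_quotient M \<Gamma> "\<alpha> ` H1" \<psi>1
  by (rule injective_model_quotient[OF H1 quotient_byD(2)[OF q1]])

interpretation Q2: injective_model_quotient M \<Gamma> "\<alpha> ` H2" \<psi>2
  by (rule injective_model_quotient[OF H2 quotient_byD(2)[OF q2]])

interpretation group G by (rule group_G)

lemma mem_carrier_G: "h \<in> H1 \<Longrightarrow> h \<in> carrier G" "h \<in> H2 \<Longrightarrow> h \<in> carrier G" "h \<in> H2 \<Longrightarrow> h \<in> H1"
  using subgroup.mem_carrier[OF H1] H21 by auto

lemma finite_subgroups: "finite H1" "finite H2"
  using finite_subset[OF _ finite_group] mem_carrier_G by blast+

lemma card_subgroup_pos: "0 < card H2"
  using finite_subgroups(2) subgroup.one_closed[OF H2] by (auto simp: card_gt_0_iff)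

lemma upper_invariant: "h \<in> H1 \<Longrightarrow> x \<in> points \<Gamma> \<Longrightarrow> \<psi>1 (\<alpha> h x) = \<psi>1 x"
  using Q1.aut_invariant by blast

lemma lower_invariant: "h \<in> H2 \<Longrightarrow> x \<in> points \<Gamma> \<Longrightarrow> \<psi>2 (\<alpha> h x) = \<psi>2 x"
  using Q2.aut_invariant by blast

lemma factor_edge: "e \<in> edges M \<Longrightarrow> \<theta> ` \<psi>2 ` e = \<psi>1 ` e"
  unfolding image_image using factor subsetD[OF edge_subset_points] by (intro image_cong) auto

text \<open>If \<open>v\<close> lies above \<open>w\<close>, the local degree of \<open>\<theta>\<close> at \<open>w\<close> is the index of the stabilizer of \<open>v\<close> in \<open>H2\<close> in
  that in \<open>H1\<close>. The number of passages is \<open>|H2|\<close> times this index; it can be counted with cosets of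
  \<open>H2\<close> only, and over all \<open>w\<close> the passages partition \<open>H1\<close>, which yields the degree.\<close>

definition passages :: "'p \<Rightarrow> 'r \<Rightarrow> 'g set" where
  "passages v w = {h \<in> H1. \<psi>2 (\<alpha> h v) = w}"

text \<open>Choose an edge \<open>e\<close> at \<open>v\<close> above \<open>f\<close>. Then \<open>h \<mapsto> \<psi>2 (h e)\<close> maps the passages onto the edges at \<open>w\<close>
  above \<open>f\<close>, and since \<open>H1\<close> acts freely on the translates of \<open>e\<close>, two elements have the same value
  exactly if they lie in the same coset \<open>H2 h\<close>.\<close>

lemma passages_card:
  assumes v: "v \<in> points \<Gamma>" and w: "\<theta> w = \<psi>1 v" and f: "f \<in> edges Q1.quotient_model" "\<psi>1 v \<in> f"
  shows "card (passages v w) = card {f2 \<in> edges Q2.quotient_model. \<theta> ` f2 = f \<and> w \<in> f2} * card H2"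
proof -
  obtain e0 where e0: "e0 \<in> edges M" "f = \<psi>1 ` e0" using f(1) Q1.qm(2) by blast
  then obtain v' where v': "v' \<in> e0" "\<psi>1 v' = \<psi>1 v" using f(2) by auto
  then obtain a where a: "a \<in> \<alpha> ` H1" "v = a v'"
    using Q1.fibres edge_subset_points[OF e0(1)] v by blast
  define e where "e = a ` e0"
  have e: "e \<in> edges M" "v \<in> e" unfolding e_def using Q1.aut_edge[OF a(1) e0(1)] a(2) v'(1) by auto
  have ef: "\<psi>1 ` e = f"
    unfolding e_def e0(2) image_image
    using Q1.aut_invariant[OF a(1)] edge_subset_points[OF e0(1)] by (intro image_cong) auto
  have ept: "x \<in> points \<Gamma>" if "x \<in> e" for x using edge_subset_points[OF e(1)] that by blast
  define S where "S = passages v w"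
  define F where "F h = \<psi>2 ` \<alpha> h ` e" for h
  have he: "\<alpha> h ` e \<in> edges M" if "h \<in> H1" for h using Q1.aut_edge[of "\<alpha> h" e] e(1) that by blast
  have upper_invariant_edge: "\<psi>1 ` \<alpha> h ` e = \<psi>1 ` e" if "h \<in> H1" for h
    unfolding image_image using upper_invariant[OF that] ept by (intro image_cong) auto
  have FS: "F ` S = {f2 \<in> edges Q2.quotient_model. \<theta> ` f2 = f \<and> w \<in> f2}"
  proof (intro subset_antisym subsetI)
    fix f2 assume "f2 \<in> F ` S"
    then obtain h where h: "h \<in> H1" "\<psi>2 (\<alpha> h v) = w" "f2 = F h" unfolding S_def passages_def by blast
    then show "f2 \<in> {f2 \<in> edges Q2.quotient_model. \<theta> ` f2 = f \<and> w \<in> f2}"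
      using he[OF h(1)] factor_edge[OF he[OF h(1)]] upper_invariant_edge[OF h(1)] ef e(2) Q2.qm(3)
      unfolding F_def by auto
  next
    fix f2 assume "f2 \<in> {f2 \<in> edges Q2.quotient_model. \<theta> ` f2 = f \<and> w \<in> f2}"
    then have f2: "f2 \<in> edges Q2.quotient_model" "\<theta> ` f2 = f" "w \<in> f2" by simp_all
    obtain e2 where e2: "e2 \<in> edges M" "f2 = \<psi>2 ` e2" using f2(1) Q2.qm(2) by blast
    then have "\<psi>1 ` e = \<psi>1 ` e2" using f2(2) factor_edge[OF e2(1)] ef by simp
    then obtain h where h: "h \<in> H1" "e2 = \<alpha> h ` e" using Q1.edge_orbit[OF e(1) e2(1)] by blast
    then obtain x where x: "x \<in> e" "w = \<psi>2 (\<alpha> h x)" using f2(3) e2(2) by blast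
    have "\<psi>1 x = \<psi>1 v"
      using w x(2) factor[OF act_point[OF mem_carrier_G(1)[OF h(1)] ept[OF x(1)]]] upper_invariant[OF h(1) ept[OF x(1)]] by simp
    then have "x = v" using inj_onD[OF Q1.inj[OF e(1)]] x(1) e(2) by blast
    then have "h \<in> S" using h x unfolding S_def passages_def by simp
    moreover have "f2 = F h" unfolding F_def e2(2) h(2) ..
    ultimately show "f2 \<in> F ` S" by blast
  qed
  have finS: "finite S" unfolding S_def passages_def using finite_subgroups by simp
  have coset: "card {h \<in> S. F h = F h0} = card H2" if h0: "h0 \<in> S" for h0
  proof -
    have h0': "h0 \<in> H1" "\<psi>2 (\<alpha> h0 v) = w" using h0 unfolding S_def passages_def by simp_all
    have "{h \<in> S. F h = F h0} = (\<lambda>k. k \<otimes>\<^bsub>G\<^esub> h0) ` H2"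
    proof (intro subset_antisym subsetI)
      fix h assume "h \<in> {h \<in> S. F h = F h0}"
      then have h: "h \<in> H1" "\<psi>2 ` \<alpha> h0 ` e = \<psi>2 ` \<alpha> h ` e"
        unfolding S_def passages_def F_def by simp_all
      obtain k where k: "k \<in> H2" "\<alpha> h ` e = \<alpha> k ` \<alpha> h0 ` e"
        using Q2.edge_orbit[OF he[OF h0'(1)] he[OF h(1)] h(2)] by blast
      have "\<alpha> k ` \<alpha> h0 ` e = \<alpha> (k \<otimes>\<^bsub>G\<^esub> h0) ` e"
        unfolding image_image using act_mult mem_carrier_G k(1) h0'(1) ept by (intro image_cong) auto
      then have "h = k \<otimes>\<^bsub>G\<^esub> h0"
        using act_edge_eq[OF e(1), of h "k \<otimes>\<^bsub>G\<^esub> h0"] k mem_carrier_G h h0' by simp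
      then show "h \<in> (\<lambda>k. k \<otimes>\<^bsub>G\<^esub> h0) ` H2" using k(1) by blast
    next
      fix h assume "h \<in> (\<lambda>k. k \<otimes>\<^bsub>G\<^esub> h0) ` H2"
      then obtain k where k: "k \<in> H2" "h = k \<otimes>\<^bsub>G\<^esub> h0" by blast
      have hx: "\<psi>2 (\<alpha> h x) = \<psi>2 (\<alpha> h0 x)" if "x \<in> points \<Gamma>" for x
        using act_mult[of k h0 x] lower_invariant[OF k(1) act_point[of h0 x]] mem_carrier_G k h0' that by simp
      have "h \<in> S" unfolding S_def passages_def
        using hx[OF v] h0' k subgroup.m_closed[OF H1, of k h0] mem_carrier_G by simp
      moreover have "F h = F h0" unfolding F_def image_image using hx ept by (intro image_cong) auto
      ultimately show "h \<in> {h \<in> S. F h = F h0}" by simp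
    qed
    moreover have "inj_on (\<lambda>k. k \<otimes>\<^bsub>G\<^esub> h0) H2"
      using mem_carrier_G h0' by (intro inj_onI) simp
    ultimately show ?thesis by (simp add: card_image)
  qed
  have "card S = (\<Sum>f2\<in>F ` S. card {h \<in> S. F h = f2})"
    using sum.image_gen[OF finS, of "\<lambda>_. 1::nat" F] by simp
  also have "\<dots> = (\<Sum>f2\<in>F ` S. card H2)"
    using coset by (intro sum.cong) auto
  finally show ?thesis unfolding S_def[symmetric] FS by simp
qed

lemma passages_translate:
  assumes v: "v \<in> points \<Gamma>" "v' \<in> points \<Gamma>" and eq: "\<psi>1 v = \<psi>1 v'"
  shows "card (passages v' w) = card (passages v w)"
proof -
  obtain k where k: "k \<in> H1" "v' = \<alpha> k v" using Q1.fibres[OF v] eq by blast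
  have mem: "h \<in> passages v' w \<longleftrightarrow> h \<in> H1 \<and> h \<otimes>\<^bsub>G\<^esub> k \<in> passages v w" for h
    unfolding passages_def using k act_mult[of h k v] v mem_carrier_G subgroup.m_closed[OF H1] by auto
  have "passages v w \<subseteq> (\<lambda>h. h \<otimes>\<^bsub>G\<^esub> k) ` passages v' w"
  proof
    fix h assume h: "h \<in> passages v w"
    then have hH: "h \<in> H1" unfolding passages_def by simp
    have "(h \<otimes>\<^bsub>G\<^esub> inv\<^bsub>G\<^esub> k) \<otimes>\<^bsub>G\<^esub> k = h" using mem_carrier_G hH k by (simp add: m_assoc)
    moreover have "h \<otimes>\<^bsub>G\<^esub> inv\<^bsub>G\<^esub> k \<in> H1"
      using subgroup.m_closed[OF H1] subgroup.m_inv_closed[OF H1] hH k by simp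
    ultimately show "h \<in> (\<lambda>h. h \<otimes>\<^bsub>G\<^esub> k) ` passages v' w" using mem h by (metis imageI)
  qed
  then have "passages v w = (\<lambda>h. h \<otimes>\<^bsub>G\<^esub> k) ` passages v' w" using mem by blast
  moreover have "inj_on (\<lambda>h. h \<otimes>\<^bsub>G\<^esub> k) (passages v' w)"
    using mem_carrier_G k unfolding passages_def by (intro inj_onI) simp
  ultimately show ?thesis by (simp add: card_image)
qed

text \<open>By \<open>passages_translate\<close> the choice of a point above \<open>w\<close> is immaterial.\<close>

definition local_degree :: "'r \<Rightarrow> nat" where
  "local_degree w = card (passages (SOME v. v \<in> points \<Gamma> \<and> \<psi>2 v = w) w) div card H2"

lemma local_degree:
  assumes v: "v \<in> points \<Gamma>" and u: "u \<in> points \<Gamma>" "\<psi>2 u = w" and eq: "\<psi>1 u = \<psi>1 v"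
  shows "local_degree w = card (passages v w) div card H2"
proof -
  define s where "s = (SOME v. v \<in> points \<Gamma> \<and> \<psi>2 v = w)"
  have s: "s \<in> points \<Gamma> \<and> \<psi>2 s = w"
    unfolding s_def using someI[of "\<lambda>v. v \<in> points \<Gamma> \<and> \<psi>2 v = w" u] u by blast
  then have "\<psi>1 s = \<psi>1 v" using factor[of s] factor[of u] u eq by simp
  then show ?thesis
    using passages_translate[OF v] s unfolding local_degree_def s_def[symmetric] by simp
qed

lemma passages_dvd:
  assumes v: "v \<in> verts M" and w: "\<theta> w = \<psi>1 v"
  shows "card H2 dvd card (passages v w)"
proof (cases "\<exists>e\<in>edges M. v \<in> e")
  case True
  then obtain e where e: "e \<in> edges M" "v \<in> e" by blast
  then show ?thesis
    using passages_card[OF _ w Q1.qm(3)[OF e(1)]] edge_subset_points[OF e(1)] by auto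
next
  \<comment> \<open>Without edges the group is trivial.\<close>
  case False
  then have "verts M = {v}" using isolated_vertex[OF v] by blast
  then have "edges M = {}"
    using end_verts(1) chart_in[of _ 0] len_pos False
    by (metis (no_types, lifting) all_not_in_conv atLeastAtMost_iff less_imp_le order_refl singletonD)
  then have "card (carrier G) = 1" using trivial_if_no_edges by (simp add: order_def)
  moreover have "card H2 \<le> card (carrier G)" using mem_carrier_G finite_group by (intro card_mono) auto
  ultimately have "card H2 = 1" using card_subgroup_pos by linarith
  then show ?thesis by simp
qed

text \<open>The points above the image of \<open>v\<close> are the images of the \<open>h v\<close> with \<open>h \<in> H1\<close>, so the passages from \<open>v\<close>
  to these points partition \<open>H1\<close>.\<close>

lemma has_degree_index: "has_degree \<Gamma>2 \<Gamma>1 \<theta> (card H1 div card H2)"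
  unfolding has_degree_def
proof (intro exI conjI ballI)
  let ?N1 = Q1.quotient_model and ?N2 = Q2.quotient_model
  have pts1: "points \<Gamma>1 = \<psi>1 ` points \<Gamma>" and pts2: "points \<Gamma>2 = \<psi>2 ` points \<Gamma>"
    using quotient_byD(1) q1 q2 by blast+
  show "finite_morphism_wrt \<Gamma>2 \<Gamma>1 \<theta> ?N2 ?N1 (\<lambda>_. 1)"
    unfolding finite_morphism_wrt_def
  proof (intro conjI ballI)
    show "continuous_map (topo \<Gamma>2) (topo \<Gamma>1) \<theta>"
      unfolding continuous_map_def
    proof (intro conjI allI impI)
      show "\<theta> \<in> points \<Gamma>2 \<rightarrow> points \<Gamma>1" unfolding pts1 pts2 using factor by force
      fix U assume U: "openin (topo \<Gamma>1) U"
      have "{x \<in> points \<Gamma>. \<psi>2 x \<in> {y \<in> points \<Gamma>2. \<theta> y \<in> U}} = {x \<in> points \<Gamma>. \<psi>1 x \<in> U}"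
        unfolding pts2 using factor by auto
      then show "openin (topo \<Gamma>2) {y \<in> points \<Gamma>2. \<theta> y \<in> U}"
        using quotient_byD(3)[OF q1, of U] quotient_byD(3)[OF q2, of "{y \<in> points \<Gamma>2. \<theta> y \<in> U}"] U by auto
    qed
    show "model_of ?N2 \<Gamma>2" "loopless ?N2" "model_of ?N1 \<Gamma>1" "loopless ?N1"
      using Q1.model_of_quotient_model[OF q1] Q2.model_of_quotient_model[OF q2]
        Q1.loopless_quotient_model Q2.loopless_quotient_model by blast+
    show "\<theta> v \<in> verts ?N1" if "v \<in> verts ?N2" for v
      using that factor points_eq unfolding Q1.qm(1) Q2.qm(1) by force
    fix f assume "f \<in> edges ?N2"
    then obtain e where e: "e \<in> edges M" "f = \<psi>2 ` e" unfolding Q2.qm(2) by blast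
    show "\<theta> ` f \<in> edges ?N1" using factor_edge[OF e(1)] Q1.qm(3)[OF e(1)] e(2) by simp
    show "distance \<Gamma>1 (\<theta> x) (\<theta> y) = ereal (real 1) * distance \<Gamma>2 x y" if "x \<in> f" "y \<in> f" for x y
    proof -
      from that obtain x' y' where xy: "x' \<in> e" "y' \<in> e" "x = \<psi>2 x'" "y = \<psi>2 y'" using e(2) by blast
      then show ?thesis
        using quotient_edge_isometric[OF H1 q1 e(1) xy(1,2)] quotient_edge_isometric[OF H2 q2 e(1) xy(1,2)]
          factor edge_subset_points[OF e(1)] by (simp add: subset_iff flip: one_ereal_def)
    qed
  qed simp
  show "harmonic_wrt \<theta> ?N2 ?N1 (\<lambda>_. 1) local_degree"
    unfolding harmonic_wrt_def
  proof (intro ballI impI)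
    fix w f assume "w \<in> verts ?N2" and f: "f \<in> edges ?N1" "\<theta> w \<in> f"
    then obtain v where v: "v \<in> verts M" "w = \<psi>2 v" unfolding Q2.qm(1) by blast
    then have pt: "v \<in> points \<Gamma>" using points_eq by simp
    have tw: "\<theta> w = \<psi>1 v" using factor[OF pt] v(2) by simp
    have "local_degree w = card (passages v w) div card H2"
      using local_degree[OF pt pt] v(2) by simp
    also have "\<dots> = card {f2 \<in> edges ?N2. \<theta> ` f2 = f \<and> w \<in> f2}"
      using passages_card[OF pt tw f(1)] f(2) tw card_subgroup_pos by simp
    finally show "(\<Sum>f2 | f2 \<in> edges ?N2 \<and> \<theta> ` f2 = f \<and> w \<in> f2. 1) = local_degree w" by simp
  qed
  fix v1 assume "v1 \<in> verts ?N1"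
  then obtain v where v: "v \<in> verts M" "v1 = \<psi>1 v" unfolding Q1.qm(1) by blast
  then have pt: "v \<in> points \<Gamma>" using points_eq by simp
  let ?W = "{w \<in> verts ?N2. \<theta> w = v1}"
  have W: "?W = (\<lambda>h. \<psi>2 (\<alpha> h v)) ` H1"
  proof (intro subset_antisym subsetI)
    fix w assume "w \<in> ?W"
    then obtain u where u: "u \<in> verts M" "w = \<psi>2 u" "\<theta> w = v1" unfolding Q2.qm(1) by blast
    then have upt: "u \<in> points \<Gamma>" using points_eq by simp
    then have "\<psi>1 v = \<psi>1 u" using factor[OF upt] u v by simp
    then obtain h where "h \<in> H1" "u = \<alpha> h v" using Q1.fibres[OF pt upt] by blast
    then show "w \<in> (\<lambda>h. \<psi>2 (\<alpha> h v)) ` H1" using u by blast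
  next
    fix w assume "w \<in> (\<lambda>h. \<psi>2 (\<alpha> h v)) ` H1"
    then obtain h where h: "h \<in> H1" "w = \<psi>2 (\<alpha> h v)" by blast
    have "\<theta> w = v1" using factor[OF act_point[OF mem_carrier_G(1)[OF h(1)] pt]] upper_invariant[OF h(1) pt] h v by simp
    moreover have "\<alpha> h v \<in> verts M" using Q1.aut_vert h(1) v(1) by blast
    ultimately show "w \<in> ?W" using h(2) Q2.qm(1) by blast
  qed
  have deg: "local_degree w * card H2 = card (passages v w)" if w: "w \<in> ?W" for w
  proof -
    from w obtain u where u: "u \<in> verts M" "w = \<psi>2 u" "\<theta> w = v1" unfolding Q2.qm(1) by blast
    then have upt: "u \<in> points \<Gamma>" using points_eq by simp
    have "local_degree w = card (passages v w) div card H2"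
      using local_degree[OF pt upt] factor[OF upt] u v by simp
    moreover have "card H2 dvd card (passages v w)" using passages_dvd[OF v(1)] u v by simp
    ultimately show ?thesis by simp
  qed
  have "card H1 = (\<Sum>w\<in>?W. card (passages v w))"
    unfolding W passages_def using sum.image_gen[OF finite_subgroups(1), of "\<lambda>_. 1::nat" "\<lambda>h. \<psi>2 (\<alpha> h v)"] by simp
  also have "\<dots> = (\<Sum>w\<in>?W. local_degree w) * card H2"
    unfolding sum_distrib_right using deg by (intro sum.cong) auto
  finally show "(\<Sum>w | w \<in> verts ?N2 \<and> \<theta> w = v1. local_degree w) = card H1 div card H2"
    using card_subgroup_pos by simp
qed

end

end

section \<open>The correspondence\<close>

lemma group_action_restrict:
  assumes act: "group_action K E \<alpha>" and F: "F \<subseteq> E"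
    and stable: "\<And>g x. g \<in> carrier K \<Longrightarrow> x \<in> F \<Longrightarrow> \<alpha> g x \<in> F"
  shows "group_action K F (\<lambda>g. restrict (\<alpha> g) F)"
proof -
  interpret group_action K E \<alpha> by (fact act)
  interpret K: group K using group_hom by (simp add: group_hom_def)
  have cancel: "\<alpha> g (\<alpha> (inv\<^bsub>K\<^esub> g) x) = x" if "g \<in> carrier K" "x \<in> F" for g x
  proof -
    have x: "x \<in> E" using F that(2) by blast
    have "\<alpha> (g \<otimes>\<^bsub>K\<^esub> inv\<^bsub>K\<^esub> g) x = \<alpha> g (\<alpha> (inv\<^bsub>K\<^esub> g) x)"
      by (rule composition_rule[OF x that(1) K.inv_closed[OF that(1)]])
    moreover have "\<alpha> \<one>\<^bsub>K\<^esub> x = x" using id_eq_one x by (metis restrict_apply')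
    ultimately show ?thesis using that(1) by simp
  qed
  have bij: "restrict (\<alpha> g) F \<in> Bij F" if g: "g \<in> carrier K" for g
  proof -
    have "inj_on (\<alpha> g) F" using inj_prop[OF g] F by (rule inj_on_subset)
    moreover have "F \<subseteq> \<alpha> g ` F"
    proof
      fix x assume x: "x \<in> F"
      then have "\<alpha> (inv\<^bsub>K\<^esub> g) x \<in> F" using stable K.inv_closed[OF g] by blast
      then show "x \<in> \<alpha> g ` F" using cancel[OF g x] by (metis imageI)
    qed
    ultimately have "bij_betw (\<alpha> g) F F" using stable[OF g] by (auto simp: bij_betw_def)
    then show ?thesis unfolding Bij_def by (simp add: bij_betw_def)
  qed
  have "restrict (\<alpha> (g \<otimes>\<^bsub>K\<^esub> h)) F = restrict (\<alpha> g) F \<otimes>\<^bsub>BijGroup F\<^esub> restrict (\<alpha> h) F"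
    if gh: "g \<in> carrier K" "h \<in> carrier K" for g h
  proof -
    have "restrict (\<alpha> (g \<otimes>\<^bsub>K\<^esub> h)) F = compose F (restrict (\<alpha> g) F) (restrict (\<alpha> h) F)"
    proof
      fix x
      show "restrict (\<alpha> (g \<otimes>\<^bsub>K\<^esub> h)) F x = compose F (restrict (\<alpha> g) F) (restrict (\<alpha> h) F) x"
        using composition_rule[of x g h] gh F stable[OF gh(2), of x] by (auto simp: compose_def)
    qed
    then show ?thesis using bij[OF gh(1)] bij[OF gh(2)] by (simp add: BijGroup_def)
  qed
  then have "(\<lambda>g. restrict (\<alpha> g) F) \<in> hom K (BijGroup F)"
    using bij by (auto simp: hom_def BijGroup_def)
  then show ?thesis
    using K.group_axioms group_BijGroup by (simp add: group_action_def group_hom_def group_hom_axioms_def)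
qed

lemma degree_one_inj_on:
  assumes "has_degree \<Gamma> \<Gamma>' \<psi> 1" shows "inj_on \<psi> (points \<Gamma>)"
proof (rule inj_onI)
  obtain M N D m where "harmonic_morphism \<Gamma> \<Gamma>' \<psi> M N D m 1"
    using has_degree_harmonic_morphism[OF assms zero_less_one] .
  then interpret harmonic_morphism \<Gamma> \<Gamma>' \<psi> M N D m 1 .
  fix x y assume xy: "x \<in> points \<Gamma>" "y \<in> points \<Gamma>" "\<psi> x = \<psi> y"
  have "\<psi> x \<in> points \<Gamma>'" unfolding points_image using xy(1) by blast
  from fibre_card_le[OF this] have "finite {z \<in> points \<Gamma>. \<psi> z = \<psi> x}"
    "card {z \<in> points \<Gamma>. \<psi> z = \<psi> x} \<le> Suc 0" by simp_all
  then show "x = y" using xy by (simp add: card_le_Suc0_iff_eq)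
qed

lemma quotient_by_factor:
  assumes q1: "quotient_by A1 \<Gamma> \<Gamma>1 \<psi>1" and q2: "quotient_by A2 \<Gamma> \<Gamma>2 \<psi>2" and sub: "A2 \<subseteq> A1"
  obtains \<theta> where "\<And>x. x \<in> points \<Gamma> \<Longrightarrow> \<psi>1 x = \<theta> (\<psi>2 x)"
proof -
  define \<theta> where "\<theta> y = \<psi>1 (SOME x. x \<in> points \<Gamma> \<and> \<psi>2 x = y)" for y
  have "\<psi>1 x = \<theta> (\<psi>2 x)" if x: "x \<in> points \<Gamma>" for x
  proof -
    define z where "z = (SOME z. z \<in> points \<Gamma> \<and> \<psi>2 z = \<psi>2 x)"
    have z: "z \<in> points \<Gamma> \<and> \<psi>2 z = \<psi>2 x"
      unfolding z_def using someI[of "\<lambda>z. z \<in> points \<Gamma> \<and> \<psi>2 z = \<psi>2 x" x] x by blast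
    then have "\<exists>a\<in>A1. x = a z" using quotient_byD(2)[OF q2, of z x] x sub by blast
    then have "\<psi>1 z = \<psi>1 x" using quotient_byD(2)[OF q1, of z x] x z by blast
    then show ?thesis unfolding \<theta>_def z_def[symmetric] by simp
  qed
  then show thesis using that by blast
qed

context galois_model
begin

text \<open>This makes the quotient map by \<open>H\<close> an instance of \<open>has_degree_index\<close>, with the trivial subgroup as \<open>H2\<close>.\<close>

lemma quotient_by_trivial: "quotient_by (\<alpha> ` {\<one>\<^bsub>G\<^esub>}) \<Gamma> \<Gamma> (\<lambda>x. x)"
proof -
  show ?thesis
    unfolding quotient_by_def
  proof (intro conjI ballI allI)
    show "points \<Gamma> = (\<lambda>x. x) ` points \<Gamma>" by simp
    show "x = y \<longleftrightarrow> (\<exists>a\<in>\<alpha> ` {\<one>\<^bsub>G\<^esub>}. y = a x)" if "x \<in> points \<Gamma>" for x y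
      using act_one[OF that] by auto
    show "openin (topo \<Gamma>) U \<longleftrightarrow> U \<subseteq> points \<Gamma> \<and> openin (topo \<Gamma>) {x \<in> points \<Gamma>. x \<in> U}" for U
    proof -
      have "{x \<in> points \<Gamma>. x \<in> U} = U" if "U \<subseteq> points \<Gamma>" using that by blast
      then show ?thesis using openin_subset by metis
    qed
    show "distance \<Gamma> x y = (INF y'\<in>{y'\<in>points \<Gamma>. y' = y}. distance \<Gamma> x y')" if "y \<in> points \<Gamma>" for x y
    proof -
      have "{y' \<in> points \<Gamma>. y' = y} = {y}" using that by blast
      then show ?thesis by simp
    qed
  qed
qed

lemma quotient_has_degree:
  assumes H: "subgroup H G" and q: "quotient_by (\<alpha> ` H) \<Gamma> \<Gamma>' \<psi>"
  shows "has_degree \<Gamma> \<Gamma>' \<psi> (card H)"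
proof -
  have "has_degree \<Gamma> \<Gamma>' \<psi> (card H div card {\<one>\<^bsub>G\<^esub>})"
    using subgroup.one_closed[OF H]
    by (intro has_degree_index[OF H group.triv_subgroup[OF group_G] _ q quotient_by_trivial]) auto
  then show ?thesis by simp
qed

lemma quotient_tropical_curve:
  assumes H: "subgroup H G" and q: "quotient_by (\<alpha> ` H) \<Gamma> \<Gamma>' \<psi>"
  shows "tropical_curve \<Gamma>'"
proof -
  interpret injective_model_quotient M \<Gamma> "\<alpha> ` H" \<psi>
    by (rule injective_model_quotient[OF H quotient_byD(2)[OF q]])
  show ?thesis unfolding tropical_curve_def using model_of_quotient_model[OF q] by blast
qed

lemma quotient_galois_covering:
  assumes H: "subgroup H G" and q: "quotient_by (\<alpha> ` H) \<Gamma> \<Gamma>' \<psi>"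
  shows "galois_covering (G\<lparr>carrier := H\<rparr>) \<alpha> \<Gamma> \<Gamma>' \<psi>"
proof -
  let ?K = "G\<lparr>carrier := H\<rparr>"
  have HG: "h \<in> carrier G" if "h \<in> H" for h using subgroup.mem_carrier[OF H that] .
  have actK: "group_action ?K (points \<Gamma>) \<alpha>"
    by (rule group_action.induced_action[OF action H])
  have "isometric_action ?K \<alpha> \<Gamma>"
    using isometric actK HG unfolding isometric_action_def by auto
  moreover have deg: "has_degree \<Gamma> \<Gamma>' \<psi> (order ?K)"
    using quotient_has_degree[OF H q] by (simp add: order_def)
  moreover have "transitive_action ?K {x \<in> points \<Gamma>. \<psi> x = y} (\<lambda>g. restrict (\<alpha> g) {x \<in> points \<Gamma>. \<psi> x = y})"
    for y
  proof -
    let ?F = "{x \<in> points \<Gamma>. \<psi> x = y}"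
    have stable: "\<alpha> g x \<in> ?F" if "g \<in> carrier ?K" "x \<in> ?F" for g x
    proof -
      have g: "g \<in> H" and x: "x \<in> points \<Gamma>" "\<psi> x = y" using that by simp_all
      have "\<psi> x = \<psi> (\<alpha> g x)"
        using quotient_byD(2)[OF q x(1) act_point[OF HG[OF g] x(1)]] g by blast
      then show ?thesis using act_point[OF HG[OF g] x(1)] x(2) by simp
    qed
    have act: "group_action ?K ?F (\<lambda>g. restrict (\<alpha> g) ?F)"
      by (rule group_action_restrict[OF actK _ stable]) auto
    have "\<exists>g\<in>carrier ?K. restrict (\<alpha> g) ?F x = z" if "x \<in> ?F" "z \<in> ?F" for x z
    proof -
      have xz: "x \<in> points \<Gamma>" "z \<in> points \<Gamma>" "\<psi> x = \<psi> z" using that by simp_all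
      then obtain h where "h \<in> H" "z = \<alpha> h x" using quotient_byD(2)[OF q xz(1,2)] by blast
      then show ?thesis using that by (intro bexI[of _ h]) simp_all
    qed
    then show ?thesis using act by (simp add: transitive_action_def transitive_action_axioms_def)
  qed
  moreover have "finite {x \<in> points \<Gamma>. stabilizer ?K \<alpha> x \<noteq> {\<one>\<^bsub>?K\<^esub>}}"
  proof (rule finite_subset[OF _ finite_nontrivial])
    show "{x \<in> points \<Gamma>. stabilizer ?K \<alpha> x \<noteq> {\<one>\<^bsub>?K\<^esub>}} \<subseteq>
        {x \<in> points \<Gamma>. stabilizer G \<alpha> x \<noteq> {\<one>\<^bsub>G\<^esub>}}"
      using HG act_one subgroup.one_closed[OF H] unfolding stabilizer_def by auto
  qed
  ultimately show ?thesis
    unfolding galois_covering_def Let_def using has_degree_finite_harmonic[OF deg] by blast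
qed

text \<open>A deck transformation moves a point with trivial stabilizer in the same way as some element of
  \<open>H\<close>, and is therefore equal to it.\<close>

lemma quotient_deck_group:
  assumes H: "subgroup H G" and q: "quotient_by (\<alpha> ` H) \<Gamma> \<Gamma>' \<psi>"
  shows "deck_group G \<alpha> \<Gamma> \<psi> = H"
proof (intro subset_antisym subsetI)
  have HG: "h \<in> carrier G" if "h \<in> H" for h using subgroup.mem_carrier[OF H that] .
  fix g assume "g \<in> deck_group G \<alpha> \<Gamma> \<psi>"
  then have g: "g \<in> carrier G" "\<And>x. x \<in> points \<Gamma> \<Longrightarrow> \<psi> (\<alpha> g x) = \<psi> x" by (auto simp: deck_group_def)
  show "g \<in> H"
  proof (cases "edges M = {}")
    case True
    then have "card (carrier G) = 1" using trivial_if_no_edges by (simp add: order_def)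
    then show ?thesis using g(1) HG subgroup.one_closed[OF H] by (metis card_1_singletonE singletonD)
  next
    case False
    then obtain e where e: "e \<in> edges M" by blast
    obtain x where x: "x \<in> e"
      "\<And>g h. g \<in> carrier G \<Longrightarrow> h \<in> carrier G \<Longrightarrow> \<alpha> g x = \<alpha> h x \<Longrightarrow> g = h"
      using generic_eq[OF e] by blast
    have pt: "x \<in> points \<Gamma>" using edge_subset_points[OF e] x(1) by blast
    obtain h where h: "h \<in> H" "\<alpha> g x = \<alpha> h x"
      using quotient_byD(2)[OF q pt act_point[OF g(1) pt]] g(2)[OF pt] by auto
    then show ?thesis using x(2)[OF g(1) HG[OF h(1)] h(2)] by simp
  qed
next
  fix h assume h: "h \<in> H"
  have hG: "h \<in> carrier G" using subgroup.mem_carrier[OF H h] .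
  have "\<psi> (\<alpha> h x) = \<psi> x" if x: "x \<in> points \<Gamma>" for x
    using quotient_byD(2)[OF q x act_point[OF hG x]] h by auto
  then show "h \<in> deck_group G \<alpha> \<Gamma> \<psi>" using hG by (simp add: deck_group_def)
qed

lemma act_orbit_iff:
  assumes H: "subgroup H G" and x: "x \<in> points \<Gamma>" and h: "h \<in> H"
  shows "(\<exists>k\<in>H. y = \<alpha> k (\<alpha> h x)) \<longleftrightarrow> (\<exists>k\<in>H. y = \<alpha> k x)"
proof -
  interpret group G by (rule group_G)
  have HG: "h \<in> carrier G" if "h \<in> H" for h using subgroup.mem_carrier[OF H that] .
  show ?thesis
  proof
    assume "\<exists>k\<in>H. y = \<alpha> k (\<alpha> h x)"
    then obtain k where k: "k \<in> H" "y = \<alpha> k (\<alpha> h x)" by blast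
    then have "y = \<alpha> (k \<otimes>\<^bsub>G\<^esub> h) x" using act_mult[OF HG HG x] h by simp
    then show "\<exists>k\<in>H. y = \<alpha> k x" using subgroup.m_closed[OF H k(1) h] by blast
  next
    assume "\<exists>k\<in>H. y = \<alpha> k x"
    then obtain k where k: "k \<in> H" "y = \<alpha> k x" by blast
    have kh: "k \<otimes>\<^bsub>G\<^esub> inv\<^bsub>G\<^esub> h \<in> H"
      using subgroup.m_closed[OF H] subgroup.m_inv_closed[OF H] k(1) h by simp
    have "\<alpha> (k \<otimes>\<^bsub>G\<^esub> inv\<^bsub>G\<^esub> h) (\<alpha> h x) = \<alpha> ((k \<otimes>\<^bsub>G\<^esub> inv\<^bsub>G\<^esub> h) \<otimes>\<^bsub>G\<^esub> h) x"
      using act_mult[OF HG[OF kh] HG[OF h] x] by simp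
    also have "(k \<otimes>\<^bsub>G\<^esub> inv\<^bsub>G\<^esub> h) \<otimes>\<^bsub>G\<^esub> h = k" using HG k(1) h by (simp add: m_assoc)
    finally show "\<exists>k\<in>H. y = \<alpha> k (\<alpha> h x)" using kh k(2) by metis
  qed
qed

text \<open>A point of the quotient is named by the image under \<open>\<iota>\<close> of a chosen point of the orbit. As distance
  serves the path distance of the quotient model; by \<open>path_distance_image\<close> it is the distance from
  any point of one orbit to the other orbit.\<close>

lemma quotient_exists:
  fixes \<iota> :: "'p \<Rightarrow> 'c"
  assumes H: "subgroup H G" and \<iota>: "inj_on \<iota> (points \<Gamma>)"
  obtains \<Gamma>' :: "'c curve" and \<psi> where "quotient_by (\<alpha> ` H) \<Gamma> \<Gamma>' \<psi>"
proof -
  have HG: "h \<in> carrier G" if "h \<in> H" for h using subgroup.mem_carrier[OF H that] .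
  define orb where "orb x y \<longleftrightarrow> (\<exists>h\<in>H. y = \<alpha> h x)" for x y
  define rep where "rep x = (SOME y. orb x y)" for x
  define \<psi> where "\<psi> x = \<iota> (rep x)" for x
  have orb_refl: "orb x x" if "x \<in> points \<Gamma>" for x
    unfolding orb_def using act_one[OF that] subgroup.one_closed[OF H] by metis
  have orb_eq: "orb y = orb x" if "x \<in> points \<Gamma>" "orb x y" for x y
  proof
    fix z
    from that(2) obtain h where "h \<in> H" "y = \<alpha> h x" unfolding orb_def by blast
    then show "orb y z = orb x z" using act_orbit_iff[OF H that(1)] unfolding orb_def by blast
  qed
  have rep: "orb x (rep x)" if "x \<in> points \<Gamma>" for x
    unfolding rep_def using someI[of "orb x" x] orb_refl[OF that] by blast
  have rep_pt: "rep x \<in> points \<Gamma>" if "x \<in> points \<Gamma>" for x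
  proof -
    from rep[OF that] obtain h where "h \<in> H" "rep x = \<alpha> h x" unfolding orb_def by blast
    then show ?thesis using act_point[OF HG that, of h] by simp
  qed
  have fib: "\<psi> x = \<psi> y \<longleftrightarrow> (\<exists>a\<in>\<alpha> ` H. y = a x)" if x: "x \<in> points \<Gamma>" and y: "y \<in> points \<Gamma>" for x y
  proof -
    have "\<psi> x = \<psi> y \<longleftrightarrow> rep x = rep y"
      unfolding \<psi>_def using inj_on_eq_iff[OF \<iota> rep_pt[OF x] rep_pt[OF y]] .
    also have "\<dots> \<longleftrightarrow> orb x y"
    proof
      assume "rep x = rep y"
      then have "orb y = orb x" using orb_eq[OF x rep[OF x]] orb_eq[OF y rep[OF y]] by simp
      then show "orb x y" using orb_refl[OF y] by simp
    next
      assume "orb x y"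
      then show "rep x = rep y" unfolding rep_def using orb_eq[OF x] by simp
    qed
    finally show ?thesis unfolding orb_def by simp
  qed
  interpret injective_model_quotient M \<Gamma> "\<alpha> ` H" \<psi>
    by (rule injective_model_quotient[OF H fib])
  define quot_open where "quot_open U \<longleftrightarrow> U \<subseteq> \<psi> ` points \<Gamma> \<and> openin (topo \<Gamma>) {x \<in> points \<Gamma>. \<psi> x \<in> U}" for U
  have "istopology quot_open"
    unfolding istopology_def
  proof (intro conjI allI impI)
    fix S T assume "quot_open S" "quot_open T"
    moreover have "{x \<in> points \<Gamma>. \<psi> x \<in> S \<inter> T} = {x \<in> points \<Gamma>. \<psi> x \<in> S} \<inter> {x \<in> points \<Gamma>. \<psi> x \<in> T}" by blast
    ultimately show "quot_open (S \<inter> T)" unfolding quot_open_def by auto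
  next
    fix \<K> assume K: "\<forall>K\<in>\<K>. quot_open K"
    have "{x \<in> points \<Gamma>. \<psi> x \<in> \<Union>\<K>} = (\<Union>K\<in>\<K>. {x \<in> points \<Gamma>. \<psi> x \<in> K})" by blast
    then show "quot_open (\<Union>\<K>)" using K unfolding quot_open_def by auto
  qed
  then have top: "openin (topology quot_open) = quot_open" by (rule topology_inverse')
  define \<Gamma>' where "\<Gamma>' = \<lparr>topo = topology quot_open, distance = path_distance quotient_model\<rparr>"
  have "quot_open (\<psi> ` points \<Gamma>)"
  proof -
    have "{x \<in> points \<Gamma>. \<psi> x \<in> \<psi> ` points \<Gamma>} = points \<Gamma>" by blast
    then show ?thesis unfolding quot_open_def by simp
  qed
  then have "\<psi> ` points \<Gamma> \<subseteq> topspace (topology quot_open)"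
    using openin_subset[of "topology quot_open" "\<psi> ` points \<Gamma>"] top by simp
  moreover have "quot_open (topspace (topology quot_open))" using openin_topspace[of "topology quot_open"] top by simp
  then have "topspace (topology quot_open) \<subseteq> \<psi> ` points \<Gamma>" unfolding quot_open_def by (rule conjunct1)
  ultimately have "topspace (topology quot_open) = \<psi> ` points \<Gamma>" by (rule subset_antisym[rotated])
  then have pts: "points \<Gamma>' = \<psi> ` points \<Gamma>" unfolding \<Gamma>'_def by simp
  have "quotient_by (\<alpha> ` H) \<Gamma> \<Gamma>' \<psi>"
    unfolding quotient_by_def
  proof (intro conjI ballI allI)
    show "points \<Gamma>' = \<psi> ` points \<Gamma>" by (rule pts)
    show "\<psi> x = \<psi> y \<longleftrightarrow> (\<exists>a\<in>\<alpha> ` H. y = a x)" if "x \<in> points \<Gamma>" "y \<in> points \<Gamma>" for x y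
      by (rule fib[OF that])
    show "openin (topo \<Gamma>') U \<longleftrightarrow> U \<subseteq> points \<Gamma>' \<and> openin (topo \<Gamma>) {x \<in> points \<Gamma>. \<psi> x \<in> U}" for U
      unfolding pts by (simp add: \<Gamma>'_def top quot_open_def)
    show "distance \<Gamma>' (\<psi> x) (\<psi> y) = (INF y'\<in>{y'\<in>points \<Gamma>. \<psi> y' = \<psi> y}. distance \<Gamma> x y')"
      if "x \<in> points \<Gamma>" "y \<in> points \<Gamma>" for x y
      unfolding \<Gamma>'_def using path_distance_image[OF image_model_quotient_model that] by simp
  qed
  then show thesis using that by blast
qed

lemma galois_arrow_quotient:
  assumes "(\<Gamma>'', \<psi>) \<in> galois_arrows G \<alpha> \<Gamma>"
  shows "subgroup (deck_group G \<alpha> \<Gamma> \<psi>) G"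
    and "quotient_by (\<alpha> ` deck_group G \<alpha> \<Gamma> \<psi>) \<Gamma> \<Gamma>'' \<psi>"
proof -
  let ?H = "deck_group G \<alpha> \<Gamma> \<psi>"
  have g: "galois_covering (G\<lparr>carrier := ?H\<rparr>) \<alpha> \<Gamma> \<Gamma>'' \<psi>"
    using assms unfolding galois_arrows_def by simp
  then have "group_action (G\<lparr>carrier := ?H\<rparr>) (points \<Gamma>) \<alpha>"
    unfolding galois_covering_def isometric_action_def by blast
  then have "group (G\<lparr>carrier := ?H\<rparr>)" by (simp add: group_action_def group_hom_def)
  moreover have sub: "?H \<subseteq> carrier G" unfolding deck_group_def by blast
  ultimately show "subgroup ?H G" using group.group_incl_imp_subgroup[OF group_G] by blast
  show "quotient_by (\<alpha> ` ?H) \<Gamma> \<Gamma>'' \<psi>"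
    using galois_covering_quotient_by[OF g] finite_subset[OF sub finite_group] by simp
qed

lemma quotient_galois_arrow:
  assumes H: "subgroup H G" and q: "quotient_by (\<alpha> ` H) \<Gamma> \<Gamma>' \<psi>"
  shows "(\<Gamma>', \<psi>) \<in> galois_arrows G \<alpha> \<Gamma>"
  using quotient_tropical_curve[OF H q] has_degree_finite_harmonic[OF quotient_has_degree[OF H q]]
    quotient_galois_covering[OF H q] quotient_deck_group[OF H q]
  unfolding galois_arrows_def by simp

lemma arrow_factor_iff:
  assumes a1: "(\<Gamma>1, \<psi>1) \<in> galois_arrows G \<alpha> \<Gamma>" and a2: "(\<Gamma>2, \<psi>2) \<in> galois_arrows G \<alpha> \<Gamma>"
  shows "(\<exists>\<theta>. finite_harmonic \<Gamma>2 \<Gamma>1 \<theta> \<and> (\<forall>x\<in>points \<Gamma>. \<psi>1 x = (\<theta> \<circ> \<psi>2) x)) \<longleftrightarrow>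
    deck_group G \<alpha> \<Gamma> \<psi>2 \<subseteq> deck_group G \<alpha> \<Gamma> \<psi>1"
proof
  assume "\<exists>\<theta>. finite_harmonic \<Gamma>2 \<Gamma>1 \<theta> \<and> (\<forall>x\<in>points \<Gamma>. \<psi>1 x = (\<theta> \<circ> \<psi>2) x)"
  then obtain \<theta> where "\<And>x. x \<in> points \<Gamma> \<Longrightarrow> \<psi>1 x = \<theta> (\<psi>2 x)" by auto
  then show "deck_group G \<alpha> \<Gamma> \<psi>2 \<subseteq> deck_group G \<alpha> \<Gamma> \<psi>1"
    using act_point unfolding deck_group_def by auto
next
  assume sub: "deck_group G \<alpha> \<Gamma> \<psi>2 \<subseteq> deck_group G \<alpha> \<Gamma> \<psi>1"
  note g1 = galois_arrow_quotient[OF a1] and g2 = galois_arrow_quotient[OF a2]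
  obtain \<theta> where \<theta>: "\<And>x. x \<in> points \<Gamma> \<Longrightarrow> \<psi>1 x = \<theta> (\<psi>2 x)"
    using quotient_by_factor[OF g1(2) g2(2) image_mono[OF sub]] by blast
  have "finite_harmonic \<Gamma>2 \<Gamma>1 \<theta>"
    using has_degree_finite_harmonic[OF has_degree_index[OF g1(1) g2(1) sub g1(2) g2(2) \<theta>]] .
  then show "\<exists>\<theta>. finite_harmonic \<Gamma>2 \<Gamma>1 \<theta> \<and> (\<forall>x\<in>points \<Gamma>. \<psi>1 x = (\<theta> \<circ> \<psi>2) x)" using \<theta> by auto
qed

text \<open>A factor of degree one is injective, so it does not change the deck group. Conversely, equal groups
  have index one.\<close>

lemma arrow_equiv_iff:
  "((\<Gamma>1, \<psi>1), (\<Gamma>2, \<psi>2)) \<in> arrow_equiv G \<alpha> \<Gamma> \<longleftrightarrow>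
    (\<Gamma>1, \<psi>1) \<in> galois_arrows G \<alpha> \<Gamma> \<and> (\<Gamma>2, \<psi>2) \<in> galois_arrows G \<alpha> \<Gamma> \<and>
    deck_group G \<alpha> \<Gamma> \<psi>1 = deck_group G \<alpha> \<Gamma> \<psi>2"
proof -
  have "(\<exists>\<theta>. finite_harmonic \<Gamma>2 \<Gamma>1 \<theta> \<and> has_degree \<Gamma>2 \<Gamma>1 \<theta> 1 \<and> (\<forall>x\<in>points \<Gamma>. \<psi>1 x = (\<theta> \<circ> \<psi>2) x)) \<longleftrightarrow>
      deck_group G \<alpha> \<Gamma> \<psi>1 = deck_group G \<alpha> \<Gamma> \<psi>2"
    if a1: "(\<Gamma>1, \<psi>1) \<in> galois_arrows G \<alpha> \<Gamma>" and a2: "(\<Gamma>2, \<psi>2) \<in> galois_arrows G \<alpha> \<Gamma>"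
  proof
    note g1 = galois_arrow_quotient[OF a1] and g2 = galois_arrow_quotient[OF a2]
    { assume "\<exists>\<theta>. finite_harmonic \<Gamma>2 \<Gamma>1 \<theta> \<and> has_degree \<Gamma>2 \<Gamma>1 \<theta> 1 \<and> (\<forall>x\<in>points \<Gamma>. \<psi>1 x = (\<theta> \<circ> \<psi>2) x)"
      then obtain \<theta> where \<theta>: "has_degree \<Gamma>2 \<Gamma>1 \<theta> 1" "\<And>x. x \<in> points \<Gamma> \<Longrightarrow> \<psi>1 x = \<theta> (\<psi>2 x)" by auto
      have "\<psi>1 x = \<psi>1 y \<longleftrightarrow> \<psi>2 x = \<psi>2 y" if "x \<in> points \<Gamma>" "y \<in> points \<Gamma>" for x y
        using \<theta>(2) that inj_on_eq_iff[OF degree_one_inj_on[OF \<theta>(1)], of "\<psi>2 x" "\<psi>2 y"]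
          quotient_byD(1)[OF g2(2)] by simp
      then show "deck_group G \<alpha> \<Gamma> \<psi>1 = deck_group G \<alpha> \<Gamma> \<psi>2"
        using act_point unfolding deck_group_def by auto }
    assume eq: "deck_group G \<alpha> \<Gamma> \<psi>1 = deck_group G \<alpha> \<Gamma> \<psi>2"
    let ?H = "deck_group G \<alpha> \<Gamma> \<psi>1"
    have q2: "subgroup ?H G" "quotient_by (\<alpha> ` ?H) \<Gamma> \<Gamma>2 \<psi>2" using g2 eq by simp_all
    obtain \<theta> where \<theta>: "\<And>x. x \<in> points \<Gamma> \<Longrightarrow> \<psi>1 x = \<theta> (\<psi>2 x)"
      using quotient_by_factor[OF g1(2) q2(2) order_refl] by blast
    have "has_degree \<Gamma>2 \<Gamma>1 \<theta> (card ?H div card ?H)"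
      by (rule has_degree_index[OF g1(1) q2(1) order_refl g1(2) q2(2) \<theta>])
    moreover have "0 < card ?H" by (rule card_subgroup_pos[OF g1(1) q2(1) order_refl g1(2) q2(2) \<theta>])
    ultimately have "has_degree \<Gamma>2 \<Gamma>1 \<theta> 1" by simp
    then show "\<exists>\<theta>. finite_harmonic \<Gamma>2 \<Gamma>1 \<theta> \<and> has_degree \<Gamma>2 \<Gamma>1 \<theta> 1 \<and> (\<forall>x\<in>points \<Gamma>. \<psi>1 x = (\<theta> \<circ> \<psi>2) x)"
      using \<theta> has_degree_finite_harmonic by (intro exI[of _ \<theta>]) auto
  qed
  then show ?thesis unfolding arrow_equiv_def by blast
qed

end

theorem theorem1p1:
  fixes G :: "('g, 'm) monoid_scheme"
    and \<alpha> :: "'g \<Rightarrow> 'p \<Rightarrow> 'p"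
    and \<Gamma> :: "'p curve" and \<Gamma>' :: "'q curve"
    and \<phi> :: "'p \<Rightarrow> 'q"
  assumes "group G" and "finite (carrier G)"
    and "tropical_curve \<Gamma>" and "tropical_curve \<Gamma>'"
    and "galois_covering G \<alpha> \<Gamma> \<Gamma>' \<phi>"
    \<comment> \<open>The statement fails for a nontrivial group acting on a singleton, whose self-map has
        every degree: there all arrows are equivalent.\<close>
    and "is_singleton (points \<Gamma>) \<Longrightarrow> order G = 1"
    \<comment> \<open>The type of the points of the targets is large enough to contain the quotients of
        \<open>\<Gamma>\<close>; for instance, it may be the type of the points of \<open>\<Gamma>\<close> itself.\<close>
    and "\<exists>\<iota> :: 'p \<Rightarrow> 'c. inj_on \<iota> (points \<Gamma>)"
  shows "\<exists>F :: ('p, 'c) arrow set \<Rightarrow> 'g set.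
           bij_betw F (galois_classes G \<alpha> \<Gamma>) {H. subgroup H G} \<and>
           (\<forall>a\<in>galois_classes G \<alpha> \<Gamma>. \<forall>b\<in>galois_classes G \<alpha> \<Gamma>.
              class_le \<Gamma> a b \<longleftrightarrow> F b \<subseteq> F a)"
proof -
  obtain M where "galois_model M \<Gamma> G \<alpha>"
    using galois_covering_galois_model[OF assms(5,2,6)] .
  then interpret galois_model M \<Gamma> G \<alpha> .
  obtain \<iota> :: "'p \<Rightarrow> 'c" where \<iota>: "inj_on \<iota> (points \<Gamma>)" using assms(7) by blast
  define A where "A = (galois_arrows G \<alpha> \<Gamma> :: ('p, 'c) arrow set)"
  \<comment> \<open>The correspondence sends a class to the deck group of its members.\<close>
  define deck where "deck x = deck_group G \<alpha> \<Gamma> (snd x)" for x :: "('p, 'c) arrow"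
  define cls where "cls x = {y \<in> A. deck x = deck y}" for x
  define F where "F a = deck (SOME x. x \<in> a)" for a :: "('p, 'c) arrow set"
  have equiv: "arrow_equiv G \<alpha> \<Gamma> `` {x} = cls x" if "x \<in> A" for x
    using that arrow_equiv_iff unfolding cls_def A_def deck_def by (cases x) auto
  have classes: "(galois_classes G \<alpha> \<Gamma> :: ('p, 'c) arrow set set) = cls ` A"
    unfolding galois_classes_def quotient_def A_def[symmetric] using equiv by auto
  have Fcls: "F (cls x) = deck x" if "x \<in> A" for x
    unfolding F_def using someI[of "\<lambda>y. y \<in> cls x" x] that unfolding cls_def by auto
  have deckA: "deck ` A = {H. subgroup H G}"
  proof (intro subset_antisym subsetI)
    fix H assume "H \<in> deck ` A"
    then show "H \<in> {H. subgroup H G}" using galois_arrow_quotient(1) unfolding A_def deck_def by force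
  next
    fix H assume "H \<in> {H. subgroup H G}"
    then have H: "subgroup H G" by simp
    obtain \<Gamma>'' :: "'c curve" and \<psi> where q: "quotient_by (\<alpha> ` H) \<Gamma> \<Gamma>'' \<psi>"
      using quotient_exists[OF H \<iota>] .
    have "(\<Gamma>'', \<psi>) \<in> A" unfolding A_def by (rule quotient_galois_arrow[OF H q])
    moreover have "deck (\<Gamma>'', \<psi>) = H" unfolding deck_def using quotient_deck_group[OF H q] by simp
    ultimately show "H \<in> deck ` A" by force
  qed
  have "bij_betw F (galois_classes G \<alpha> \<Gamma>) {H. subgroup H G}"
    unfolding bij_betw_def classes
  proof
    show "inj_on F (cls ` A)"
      using Fcls unfolding cls_def by (intro inj_onI) force
    show "F ` cls ` A = {H. subgroup H G}"
      unfolding image_image deckA[symmetric] using Fcls by (intro image_cong) auto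
  qed
  moreover have "class_le \<Gamma> (cls x) (cls y) \<longleftrightarrow> F (cls y) \<subseteq> F (cls x)" if "x \<in> A" "y \<in> A" for x y
  proof -
    have "(\<exists>\<theta>. finite_harmonic (fst y') (fst x') \<theta> \<and> (\<forall>z\<in>points \<Gamma>. snd x' z = (\<theta> \<circ> snd y') z)) \<longleftrightarrow>
        deck y \<subseteq> deck x" if "x' \<in> cls x" "y' \<in> cls y" for x' y'
      using arrow_factor_iff[of "fst x'" "snd x'" "fst y'" "snd y'"] that unfolding cls_def A_def deck_def
      by auto
    moreover have "x \<in> cls x" "y \<in> cls y" using that unfolding cls_def by auto
    ultimately have "class_le \<Gamma> (cls x) (cls y) \<longleftrightarrow> deck y \<subseteq> deck x"
      unfolding class_le_def case_prod_unfold by blast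
    then show ?thesis using Fcls that by simp
  qed
  ultimately show ?thesis unfolding classes by blast
qed

end
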